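(* Let $u:\mathbb{R}^N\to\mathbb{R}$ be a $\mathcal G$-periodic function belonging to $H^1_{\rm loc}(\mathbb{R}^N)$. Then the traces of $u$ on opposite faces of $Y$ are equal; that is, for every $k\in\{1,\dots,N\}$, the trace on $\partial Y$ of the restriction of $u$ to the interior of $Y$ satisfies $\operatorname{tr}u(x+\vec g_k)=\operatorname{tr}u(x)$ for almost every $x\in F_k^-$ (with respect to surface measure).
   Context: Let $N\ge2$, let $\vec g_1,\dots,\vec g_N$ be linearly independent vectors in $\mathbb{R}^N$, let $\mathcal G$ be the additive group (lattice) they generate, and let $Y=\{\sum_k s_k\vec g_k : s_k\in[0,1]\}$ be the periodicity cell. A function on $\mathbb{R}^N$ is $\mathcal G$-periodic if it is invariant under translations by vectors of $\mathcal G$. The boundary $\partial Y$ is the union of the pairs of opposite faces $F_k^-=\{y\in Y: s_k=0\}$ and $F_k^+=\{y\in Y : s_k=1\}=F_k^-+\vec g_k$, $k=1,\dots,N$. $\operatorname{tr}$ denotes the usual trace operator $H^1(\operatorname{int}Y)\to L^2(\partial Y)$. *)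

theory Defs
  imports "HOL-Analysis.Analysis" "HOL-Computational_Algebra.Group_Closure"
begin

subsection \<open>Smooth functions and Sobolev spaces\<close>

definition pderiv_at :: "'n::finite \<Rightarrow> (real^'n \<Rightarrow> real) \<Rightarrow> real^'n \<Rightarrow> real" where
  "pderiv_at i f x = frechet_derivative f (at x) (axis i 1)"

primrec C_k :: "nat \<Rightarrow> (real^'n::finite \<Rightarrow> real) \<Rightarrow> bool" where
  "C_k 0 f \<longleftrightarrow> continuous_on UNIV f"
| "C_k (Suc k) f \<longleftrightarrow> (\<forall>x. f differentiable (at x)) \<and> (\<forall>i. C_k k (pderiv_at i f))"

definition smooth :: "(real^'n::finite \<Rightarrow> real) \<Rightarrow> bool" where
  "smooth f \<longleftrightarrow> (\<forall>k. C_k k f)"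

definition test_function :: "(real^'n::finite) set \<Rightarrow> (real^'n \<Rightarrow> real) \<Rightarrow> bool" where
  "test_function \<Omega> \<phi> \<longleftrightarrow>
     smooth \<phi> \<and> compact (closure {x. \<phi> x \<noteq> 0}) \<and> closure {x. \<phi> x \<noteq> 0} \<subseteq> \<Omega>"

definition square_integrable :: "'a measure \<Rightarrow> ('a \<Rightarrow> real) \<Rightarrow> bool" where
  "square_integrable M f \<longleftrightarrow> f \<in> borel_measurable M \<and> integrable M (\<lambda>x. (f x)\<^sup>2)"

definition is_weak_pderiv ::
  "(real^'n::finite) set \<Rightarrow> 'n \<Rightarrow> (real^'n \<Rightarrow> real) \<Rightarrow> (real^'n \<Rightarrow> real) \<Rightarrow> bool" where
  "is_weak_pderiv \<Omega> i u v \<longleftrightarrow>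
     (\<forall>\<phi>. test_function \<Omega> \<phi> \<longrightarrow>
        (\<integral>x. u x * pderiv_at i \<phi> x \<partial>lebesgue_on \<Omega>) = - (\<integral>x. v x * \<phi> x \<partial>lebesgue_on \<Omega>))"

definition H1 :: "(real^'n::finite) set \<Rightarrow> (real^'n \<Rightarrow> real) \<Rightarrow> bool" where
  "H1 \<Omega> u \<longleftrightarrow>
     square_integrable (lebesgue_on \<Omega>) u \<and>
     (\<forall>i. \<exists>v. square_integrable (lebesgue_on \<Omega>) v \<and> is_weak_pderiv \<Omega> i u v)"

definition H1_loc :: "(real^'n::finite) set \<Rightarrow> (real^'n \<Rightarrow> real) \<Rightarrow> bool" where
  "H1_loc \<Omega> u \<longleftrightarrow> (\<forall>V. open V \<and> compact (closure V) \<and> closure V \<subseteq> \<Omega> \<longrightarrow> H1 V u)"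

text \<open>The weak derivative is unique up to null sets, so the choice of representative below is
  immaterial.\<close>

definition weak_pderiv ::
  "(real^'n::finite) set \<Rightarrow> 'n \<Rightarrow> (real^'n \<Rightarrow> real) \<Rightarrow> real^'n \<Rightarrow> real" where
  "weak_pderiv \<Omega> i u = (SOME v. square_integrable (lebesgue_on \<Omega>) v \<and> is_weak_pderiv \<Omega> i u v)"

definition H1_norm :: "(real^'n::finite) set \<Rightarrow> (real^'n \<Rightarrow> real) \<Rightarrow> real" where
  "H1_norm \<Omega> u =
     sqrt ((\<integral>x. (u x)\<^sup>2 \<partial>lebesgue_on \<Omega>) +
           (\<Sum>i\<in>UNIV. \<integral>x. (weak_pderiv \<Omega> i u x)\<^sup>2 \<partial>lebesgue_on \<Omega>))"


subsection \<open>Lattice, periodicity cell and its boundary\<close>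

text \<open>Elements of Sobolev spaces are classes of functions modulo null sets, so invariance under a
  translation is equality almost everywhere. In particular, functions that are periodic at every
  point are covered.\<close>

definition periodic :: "(real^'n::finite) set \<Rightarrow> (real^'n \<Rightarrow> real) \<Rightarrow> bool" where
  "periodic \<G> u \<longleftrightarrow> (\<forall>v\<in>\<G>. AE x in lebesgue. u (x + v) = u x)"

definition cell :: "('n::finite \<Rightarrow> real^'n) \<Rightarrow> (real^'n) set" where
  "cell g = {\<Sum>j\<in>UNIV. s j *\<^sub>R g j | s. \<forall>j. s j \<in> {0..1}}"

definition lower_face :: "('n::finite \<Rightarrow> real^'n) \<Rightarrow> 'n \<Rightarrow> (real^'n) set" where
  "lower_face g k = {\<Sum>j\<in>UNIV. s j *\<^sub>R g j | s. (\<forall>j. s j \<in> {0..1}) \<and> s k = 0}"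

text \<open>The area of the parallelotope spanned by the vectors \<open>g j\<close>, \<open>j \<noteq> k\<close>, is the square root of
  their Gram determinant. To stay within square matrices over the index type, the Gram matrix is
  bordered by a unit row and column at position \<open>k\<close>.\<close>

definition face_area :: "('n::finite \<Rightarrow> real^'n) \<Rightarrow> 'n \<Rightarrow> real" where
  "face_area g k =
     sqrt (det (\<chi> i j. if i = k \<or> j = k then (if i = j then 1 else 0) else g i \<bullet> g j))"

text \<open>Surface measure of the face \<open>lower_face g k + a\<close>: image of Lebesgue measure on
  the unit cube in the coordinates \<open>s j\<close>, \<open>j \<noteq> k\<close>, under the affine parametrization of the face,
  multiplied by the constant area element.\<close>

definition face_measure :: "('n::finite \<Rightarrow> real^'n) \<Rightarrow> 'n \<Rightarrow> real^'n \<Rightarrow> (real^'n) measure" where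
  "face_measure g k a =
     scale_measure (ennreal (face_area g k))
       (distr (\<Pi>\<^sub>M j\<in>UNIV - {k}. restrict_space lborel {0..1}) borel
          (\<lambda>s. a + (\<Sum>j\<in>UNIV - {k}. s j *\<^sub>R g j)))"

text \<open>Surface measure on the boundary of the cell, as a measure on the whole space concentrated on
  the faces; different faces overlap only in null sets.\<close>

definition boundary_measure :: "('n::finite \<Rightarrow> real^'n) \<Rightarrow> (real^'n) measure" where
  "boundary_measure g =
     measure_of UNIV (sets borel)
       (\<lambda>A. \<Sum>k\<in>UNIV. emeasure (face_measure g k 0) A + emeasure (face_measure g k (g k)) A)"

lemma sets_face_measure [simp]: "sets (face_measure g k a) = sets borel"
  by (simp add: face_measure_def)

lemma sets_boundary_measure [simp]: "sets (boundary_measure g) = sets borel"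
  by (simp add: boundary_measure_def sets.sigma_sets_eq[of borel, simplified])

lemma measurable_face_param:
  "(\<lambda>s. a + (\<Sum>j\<in>UNIV - {k}. s j *\<^sub>R g j))
     \<in> borel_measurable (\<Pi>\<^sub>M j\<in>UNIV - {k}. restrict_space lborel {0..1::real})"
  for a :: "real^'n::finite"
proof -
  have "(\<lambda>s. s j) \<in> borel_measurable (\<Pi>\<^sub>M j\<in>UNIV - {k}. restrict_space lborel {0..1::real})"
    if "j \<in> UNIV - {k}" for j
  proof -
    have "(\<lambda>x::real. x) \<in> borel_measurable (restrict_space lborel {0..1})"
      by (intro measurable_restrict_space1) simp
    from measurable_compose[OF measurable_component_singleton[OF that] this] show ?thesis .
  qed
  then show ?thesis
    by (intro borel_measurable_add borel_measurable_sum borel_measurable_scaleR) auto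
qed

lemma emeasure_boundary_measure:
  assumes "A \<in> sets borel"
  shows "emeasure (boundary_measure g) A =
    (\<Sum>k\<in>UNIV. emeasure (face_measure g k 0) A + emeasure (face_measure g k (g k)) A)"
proof (rule emeasure_measure_of[OF boundary_measure_def])
  show "positive (sets (boundary_measure g))
    (\<lambda>A. \<Sum>k\<in>UNIV. emeasure (face_measure g k 0) A + emeasure (face_measure g k (g k)) A)"
    by (simp add: positive_def)
  show "countably_additive (sets (boundary_measure g))
    (\<lambda>A. \<Sum>k\<in>UNIV. emeasure (face_measure g k 0) A + emeasure (face_measure g k (g k)) A)"
    by (auto simp: countably_additive_def suminf_sum suminf_add[symmetric] suminf_emeasure)
qed (use assms in auto)


subsection \<open>The trace operator\<close>

text \<open>The trace operator is the continuous extension to \<open>H1 (interior (cell g))\<close>, with values in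
  \<open>L\<^sup>2\<close> of the boundary, of the restriction of functions smooth up to the boundary.
  By the trace inequality this determines the trace up to null sets of the surface measure.\<close>

definition is_trace ::
  "('n::finite \<Rightarrow> real^'n) \<Rightarrow> (real^'n \<Rightarrow> real) \<Rightarrow> (real^'n \<Rightarrow> real) \<Rightarrow> bool" where
  "is_trace g u f \<longleftrightarrow>
     H1 (interior (cell g)) u \<and>
     square_integrable (boundary_measure g) f \<and>
     (\<exists>\<phi>. (\<forall>n. smooth (\<phi> n)) \<and>
          (\<lambda>n. H1_norm (interior (cell g)) (\<lambda>x. \<phi> n x - u x)) \<longlonglongrightarrow> 0 \<and>
          (\<lambda>n. \<integral>x. (\<phi> n x - f x)\<^sup>2 \<partial>boundary_measure g) \<longlonglongrightarrow> 0)"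

definition tr :: "('n::finite \<Rightarrow> real^'n) \<Rightarrow> (real^'n \<Rightarrow> real) \<Rightarrow> real^'n \<Rightarrow> real" where
  "tr g u = (SOME f. is_trace g u f)"

end

theory Submission
  imports Defs
begin

text \<open>A periodic function can be approximated in \<open>H\<^sup>1\<close> of the cell by smooth functions that take
  equal values at opposite points of the boundary, namely by its mollifications, because mollification
  commutes with translations. The equality survives in the mean-square limit that defines the trace.
  It remains to see that the trace exists, and that it is the same limit for every approximating
  sequence, since nothing is known about the sequence that comes with a given trace.

  Both follow from the trace inequality (\<open>trace_inequality\<close>): the mean square of a smooth
  function over the boundary is at most a constant times its squared \<open>H\<^sup>1\<close> norm in the cell. It is
  the fundamental theorem of calculus on each segment that joins two opposite faces in a direction
  \<open>g k\<close>, integrated over the face; the coordinates \<open>s j\<close> turn the integral over the cell into one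
  over the unit cube, up to a constant factor. Applied to differences, the inequality shows that a
  sequence of smooth functions converging to \<open>u\<close> is Cauchy in the mean square on the boundary,
  so that a limit exists (\<open>ex_trace\<close>), and that two such sequences have the same limit
  (\<open>trace_periodic\<close>).

  The approximation (\<open>H1_mollification\<close>) rests on the convergence of mollifications in the mean
  square (\<open>L2_convergence_conv\<close>), which in turn rests on the continuity of translations in the
  mean. The same convergence proves that weak derivatives are unique up to null sets
  (\<open>weak_pderiv_unique\<close>). This is indispensable here, because the \<open>H\<^sup>1\<close> norm is defined through an
  arbitrary choice of the weak derivatives, and that choice need not be additive.\<close>

section \<open>Smooth functions and bumps\<close>

lemma pderiv_at_eq:
  assumes "(f has_derivative f') (at x)"
  shows "pderiv_at i f x = f' (axis i 1)"
  using frechet_derivative_at[OF assms] by (simp add: pderiv_at_def)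

lemma smooth_imp_C_1: "smooth f \<Longrightarrow> C_k 1 f"
  by (auto simp: smooth_def)

lemma C_1_continuous:
  assumes "C_k 1 f"
  shows "continuous_on UNIV f" and "continuous_on UNIV (pderiv_at i f)"
  using assms by (auto simp: continuous_on_eq_continuous_at differentiable_imp_continuous_within)

lemma smooth_pderiv_at: "smooth f \<Longrightarrow> smooth (pderiv_at i f)"
  unfolding smooth_def by (metis C_k.simps(2))

lemma has_derivative_pderiv_at:
  fixes f :: "real^'n::finite \<Rightarrow> real"
  assumes "f differentiable (at x)"
  shows "(f has_derivative (\<lambda>h. \<Sum>i\<in>UNIV. h $ i * pderiv_at i f x)) (at x)"
proof -
  let ?D = "frechet_derivative f (at x)"
  have D: "(f has_derivative ?D) (at x)"
    using assms by (simp add: frechet_derivative_works)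
  have "linear ?D"
    using D has_derivative_linear by blast
  have "?D h = (\<Sum>i\<in>UNIV. h $ i * pderiv_at i f x)" for h
  proof -
    have "?D h = ?D (\<Sum>i\<in>UNIV. h $ i *\<^sub>R axis i 1)"
      by (simp only: basis_expansion scalar_mult_eq_scaleR[symmetric])
    also have "\<dots> = (\<Sum>i\<in>UNIV. h $ i * pderiv_at i f x)"
      using \<open>linear ?D\<close> by (simp add: linear_sum linear_cmul pderiv_at_def)
    finally show ?thesis .
  qed
  with D show ?thesis
    by (metis (no_types, lifting) ext)
qed

lemma C_k_affine:
  fixes f :: "real^'n::finite \<Rightarrow> real"
  assumes "C_k k f"
  shows "C_k k (\<lambda>y. c * f (a + s *\<^sub>R y))"
  using assms
proof (induction k arbitrary: f c)
  case 0
  then show ?case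
    by (auto intro!: continuous_intros continuous_on_compose2[of UNIV f])
next
  case (Suc k)
  have D: "((\<lambda>y. c * f (a + s *\<^sub>R y)) has_derivative
      (\<lambda>h. c * frechet_derivative f (at (a + s *\<^sub>R y)) (s *\<^sub>R h))) (at y)" for y
  proof -
    have "(f has_derivative frechet_derivative f (at (a + s *\<^sub>R y))) (at (a + s *\<^sub>R y))"
      using Suc.prems by (simp add: frechet_derivative_works)
    moreover have "((\<lambda>y. a + s *\<^sub>R y) has_derivative (\<lambda>h. s *\<^sub>R h)) (at y)"
      by (auto intro!: derivative_eq_intros)
    ultimately have "((\<lambda>y. f (a + s *\<^sub>R y)) has_derivative
        (\<lambda>h. frechet_derivative f (at (a + s *\<^sub>R y)) (s *\<^sub>R h))) (at y)"
      using has_derivative_compose by fastforce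
    then show ?thesis
      by (rule has_derivative_mult_right)
  qed
  have "pderiv_at i (\<lambda>y. c * f (a + s *\<^sub>R y)) = (\<lambda>y. (c * s) * pderiv_at i f (a + s *\<^sub>R y))" for i
  proof
    fix y
    have "linear (frechet_derivative f (at (a + s *\<^sub>R y)))"
      using Suc.prems by (simp add: linear_frechet_derivative)
    then show "pderiv_at i (\<lambda>y. c * f (a + s *\<^sub>R y)) y = (c * s) * pderiv_at i f (a + s *\<^sub>R y)"
      by (simp add: pderiv_at_eq[OF D] linear_cmul pderiv_at_def)
  qed
  moreover have "C_k k (pderiv_at i f)" for i
    using Suc.prems by simp
  moreover have "(\<lambda>y. c * f (a + s *\<^sub>R y)) differentiable (at y)" for y
    using D by (rule differentiableI)
  ultimately show ?case
    using Suc.IH by auto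
qed

lemma pderiv_at_reflect:
  fixes f :: "real^'n::finite \<Rightarrow> real"
  assumes "f differentiable (at (x - y))"
  shows "pderiv_at i (\<lambda>y. f (x - y)) y = - pderiv_at i f (x - y)"
proof -
  let ?D = "frechet_derivative f (at (x - y))"
  have D: "(f has_derivative ?D) (at (x - y))"
    using assms by (simp add: frechet_derivative_works)
  have "((\<lambda>y. x - y) has_derivative (\<lambda>h. - h)) (at y)"
    by (auto intro!: derivative_eq_intros)
  from has_derivative_compose[OF this D]
  have "((\<lambda>y. f (x - y)) has_derivative (\<lambda>h. ?D (- h))) (at y)" .
  from pderiv_at_eq[OF this] show ?thesis
    using linear_neg[OF linear_frechet_derivative[OF assms]] by (simp add: pderiv_at_def)
qed

text \<open>Higher differentiability of functions of one real variable. A derivative is asked for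
  existentially, so that the closure properties become plain inductions.\<close>

primrec C1k :: "nat \<Rightarrow> (real \<Rightarrow> real) \<Rightarrow> bool" where
  "C1k 0 f \<longleftrightarrow> continuous_on UNIV f"
| "C1k (Suc k) f \<longleftrightarrow> (\<exists>f'. (\<forall>x. (f has_real_derivative f' x) (at x)) \<and> C1k k f')"

lemma C1k_SucI:
  "(\<And>x. (f has_real_derivative f' x) (at x)) \<Longrightarrow> C1k k f' \<Longrightarrow> C1k (Suc k) f"
  by auto

lemma C1k_continuous: "C1k k f \<Longrightarrow> continuous_on UNIV f"
  by (cases k) (auto simp: continuous_on_eq_continuous_at intro: DERIV_isCont)

lemma C1k_Suc_D: "C1k (Suc k) f \<Longrightarrow> C1k k f"
proof (induction k arbitrary: f)
  case 0
  then show ?case using C1k_continuous[of "Suc 0" f] by simp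
next
  case (Suc k)
  then show ?case by (metis C1k.simps(2))
qed

lemma C1k_add: "C1k k f \<Longrightarrow> C1k k g \<Longrightarrow> C1k k (\<lambda>x. f x + g x)"
proof (induction k arbitrary: f g)
  case 0
  then show ?case by (simp add: continuous_on_add)
next
  case (Suc k)
  then obtain f' g' where D: "\<And>x. (f has_real_derivative f' x) (at x)" "\<And>x. (g has_real_derivative g' x) (at x)"
    and C: "C1k k f'" "C1k k g'" by auto
  have "((\<lambda>x. f x + g x) has_real_derivative f' x + g' x) (at x)" for x
    using D by (intro DERIV_add)
  then show ?case using Suc.IH[OF C] by (rule C1k_SucI)
qed

lemma C1k_mult: "C1k k f \<Longrightarrow> C1k k g \<Longrightarrow> C1k k (\<lambda>x. f x * g x)"
proof (induction k arbitrary: f g)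
  case (Suc k)
  then obtain f' g' where D: "\<And>x. (f has_real_derivative f' x) (at x)" "\<And>x. (g has_real_derivative g' x) (at x)"
    and C: "C1k k f'" "C1k k g'" by auto
  have "((\<lambda>x. f x * g x) has_real_derivative (f' x * g x + g' x * f x)) (at x)" for x
    using D by (intro DERIV_mult)
  moreover have "C1k k (\<lambda>x. f' x * g x + g' x * f x)"
    using Suc C by (intro C1k_add Suc.IH) (auto intro: C1k_Suc_D simp del: C1k.simps)
  ultimately show ?case by (rule C1k_SucI)
qed (auto intro: continuous_intros)

lemma C1k_affine: "C1k k f \<Longrightarrow> C1k k (\<lambda>x. c * f (a + s * x))"
proof (induction k arbitrary: f c)
  case 0
  then show ?case
    by (auto intro!: continuous_intros continuous_on_compose2[of UNIV f])
next
  case (Suc k)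
  then obtain f' where D: "\<And>x. (f has_real_derivative f' x) (at x)"
    and C: "C1k k f'" by auto
  have "((\<lambda>x. c * f (a + s * x)) has_real_derivative (c * s) * f' (a + s * x)) (at x)" for x
    by (auto intro!: derivative_eq_intros DERIV_chain2[OF D])
  moreover have "C1k k (\<lambda>x. (c * s) * f' (a + s * x))"
    by (rule Suc.IH[OF C])
  ultimately show ?case by (rule C1k_SucI)
qed

text \<open>The functions \<open>p (1/t) exp (-1/t)\<close>, continued by \<open>0\<close>. The derivative of such a function is
  again one of them, for another polynomial; smoothness is then a plain induction over all
  polynomials at once.\<close>

definition flat :: "real poly \<Rightarrow> real \<Rightarrow> real" where
  "flat p t = (if t > 0 then poly p (1 / t) * exp (- (1 / t)) else 0)"

text \<open>This is the difference quotient at the origin: with \<open>s = 1/t\<close> it is a polynomial in \<open>s\<close> times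
  \<open>exp (-s)\<close>.\<close>

lemma flat_tendsto_0: "((\<lambda>t. flat p t / t) \<longlongrightarrow> 0) (at 0)"
proof -
  have *: "((\<lambda>s. poly q s * exp (- s)) \<longlongrightarrow> 0) at_top" for q :: "real poly"
  proof -
    have "((\<lambda>s. \<Sum>i\<le>degree q. coeff q i * (s ^ i / exp s)) \<longlongrightarrow> (\<Sum>i\<le>degree q. coeff q i * 0)) at_top"
      by (intro tendsto_intros tendsto_power_div_exp_0)
    moreover have "(\<Sum>i\<le>degree q. coeff q i * (s ^ i / exp s)) = poly q s * exp (- s)" for s
      unfolding poly_altdef sum_distrib_right
      by (intro sum.cong) (auto simp: exp_minus divide_inverse)
    ultimately show ?thesis
      by simp
  qed
  have inv: "filterlim (\<lambda>t::real. 1 / t) at_top (at_right 0)"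
    using filterlim_inverse_at_top_right by (simp add: inverse_eq_divide)
  have "((\<lambda>t. poly (pCons 0 p) (1 / t) * exp (- (1 / t))) \<longlongrightarrow> 0) (at_right 0)"
    by (rule filterlim_compose[OF * inv])
  then have r: "((\<lambda>t. flat p t / t) \<longlongrightarrow> 0) (at_right 0)"
    by (rule Lim_transform_eventually)
       (auto simp: flat_def eventually_at_filter)
  have l: "((\<lambda>t. flat p t / t) \<longlongrightarrow> 0) (at_left 0)"
    by (rule tendsto_eventually) (auto simp: flat_def eventually_at_filter)
  from l r show ?thesis by (simp add: filterlim_split_at)
qed

lemma has_real_derivative_flat:
  "(flat p has_real_derivative flat ([:0, 0, 1:] * (p - pderiv p)) t) (at t)"
proof -
  consider "t > 0" | "t < 0" | "t = 0" by linarith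
  then show ?thesis
  proof cases
    case 1
    have "((\<lambda>t. 1 / t) has_real_derivative - (1 / t\<^sup>2)) (at t)"
      using 1 by (auto intro!: derivative_eq_intros simp: power2_eq_square)
    note inv = this
    have "((\<lambda>t. poly p (1 / t)) has_real_derivative poly (pderiv p) (1 / t) * - (1 / t\<^sup>2)) (at t)"
      using DERIV_chain2[OF poly_DERIV inv] .
    moreover have "((\<lambda>t. exp (- (1 / t))) has_real_derivative exp (- (1 / t)) * (1 / t\<^sup>2)) (at t)"
      using DERIV_chain2[OF DERIV_exp DERIV_minus[OF inv]] by simp
    ultimately have "((\<lambda>t. poly p (1 / t) * exp (- (1 / t))) has_real_derivative
        flat ([:0, 0, 1:] * (p - pderiv p)) t) (at t)"
      by (rule DERIV_cong[OF DERIV_mult])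
         (use 1 in \<open>simp add: flat_def algebra_simps power2_eq_square\<close>)
    then show ?thesis
      by (rule DERIV_cong_ev[THEN iffD1, rotated 3])
         (use 1 in \<open>auto simp: flat_def eventually_nhds_metric dist_real_def intro!: exI[of _ t]\<close>)
  next
    case 2
    have "((\<lambda>t. 0) has_real_derivative flat ([:0, 0, 1:] * (p - pderiv p)) t) (at t)"
      using 2 by (simp add: flat_def)
    then show ?thesis
      by (rule DERIV_cong_ev[THEN iffD1, rotated 3])
         (use 2 in \<open>auto simp: flat_def eventually_nhds_metric dist_real_def intro!: exI[of _ "-t"]\<close>)
  next
    case 3
    show ?thesis
      using flat_tendsto_0[of p] 3
      by (simp add: has_field_derivative_iff) (simp add: flat_def)
  qed
qed

lemma C1k_flat: "C1k k (flat p)"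
proof (induction k arbitrary: p)
  case 0
  show ?case
    using has_real_derivative_flat by (auto simp: continuous_on_eq_continuous_at intro: DERIV_isCont)
next
  case (Suc k)
  then show ?case
    using has_real_derivative_flat by fastforce
qed

text \<open>A partial derivative replaces just one factor by its derivative, so the class of these products
  is closed under partial differentiation.\<close>

lemma C_k_prod_components:
  fixes F :: "'n::finite \<Rightarrow> real \<Rightarrow> real"
  assumes "\<And>j. C1k k (F j)"
  shows "C_k k (\<lambda>x::real^'n. \<Prod>j\<in>UNIV. F j (x $ j))"
  using assms
proof (induction k arbitrary: F)
  case 0
  have "continuous_on UNIV (\<lambda>x::real^'n. F j (x $ j))" for j
    using 0 continuous_on_compose2[of UNIV "F j" UNIV "\<lambda>x::real^'n. x $ j"]
    by (simp add: continuous_on_component)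
  then show ?case
    by (simp add: continuous_on_prod)
next
  case (Suc k)
  have "\<forall>j. \<exists>f'. (\<forall>x. (F j has_real_derivative f' x) (at x)) \<and> C1k k f'"
    using Suc.prems by simp
  then obtain F' where "\<forall>j. (\<forall>x. (F j has_real_derivative F' j x) (at x)) \<and> C1k k (F' j)"
    by (rule choice[THEN exE])
  then have D: "(F j has_real_derivative F' j x) (at x)" and C: "C1k k (F' j)" for j x
    by blast+
  have deriv: "((\<lambda>x::real^'n. \<Prod>j\<in>UNIV. F j (x $ j)) has_derivative
      (\<lambda>h. \<Sum>i\<in>UNIV. h $ i * F' i (x $ i) * (\<Prod>j\<in>UNIV - {i}. F j (x $ j)))) (at x)" for x
  proof -
    have "((\<lambda>x::real^'n. F j (x $ j)) has_derivative (\<lambda>h. h $ j * F' j (x $ j))) (at x)" for j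
    proof -
      have "((\<lambda>x::real^'n. x $ j) has_derivative (\<lambda>h. h $ j)) (at x)"
        by (simp add: bounded_linear_imp_has_derivative bounded_linear_vec_nth)
      from has_derivative_compose[OF this D[unfolded has_field_derivative_def]]
      show ?thesis by (simp add: mult.commute)
    qed
    from has_derivative_prod[OF this] show ?thesis .
  qed
  have "pderiv_at i (\<lambda>x::real^'n. \<Prod>j\<in>UNIV. F j (x $ j)) = (\<lambda>x. \<Prod>j\<in>UNIV. (F(i := F' i)) j (x $ j))" for i
  proof
    fix x :: "real^'n"
    have "pderiv_at i (\<lambda>x::real^'n. \<Prod>j\<in>UNIV. F j (x $ j)) x
      = (\<Sum>l\<in>UNIV. axis i 1 $ l * F' l (x $ l) * (\<Prod>j\<in>UNIV - {l}. F j (x $ j)))"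
      by (rule pderiv_at_eq[OF deriv])
    also have "\<dots> = (\<Sum>l\<in>{i}. axis i 1 $ l * F' l (x $ l) * (\<Prod>j\<in>UNIV - {l}. F j (x $ j)))"
      by (rule sum.mono_neutral_right) (auto simp: axis_def)
    also have "\<dots> = (\<Prod>j\<in>UNIV. (F(i := F' i)) j (x $ j))"
      by (subst prod.remove[of UNIV i]) (auto intro!: prod.cong)
    finally show "pderiv_at i (\<lambda>x::real^'n. \<Prod>j\<in>UNIV. F j (x $ j)) x
      = (\<Prod>j\<in>UNIV. (F(i := F' i)) j (x $ j))" .
  qed
  moreover have "C_k k (\<lambda>x::real^'n. \<Prod>j\<in>UNIV. (F(i := F' i)) j (x $ j))" for i
    by (rule Suc.IH) (use C Suc.prems C1k_Suc_D in auto)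
  ultimately show ?case
    using deriv by (auto simp: differentiable_def)
qed

text \<open>An approximate identity consists of one such kernel for each small \<open>\<delta>\<close>; the kernels are unrelated
  to each other, rather than rescalings of a fixed bump.\<close>

definition mollifier :: "real \<Rightarrow> (real^'n::finite \<Rightarrow> real) \<Rightarrow> bool" where
  "mollifier \<delta> \<rho> \<longleftrightarrow> smooth \<rho> \<and> (\<forall>x. \<rho> x \<ge> 0) \<and> (\<forall>x. norm x \<ge> \<delta> \<longrightarrow> \<rho> x = 0) \<and>
     integrable lborel \<rho> \<and> (\<integral>x. \<rho> x \<partial>lborel) = 1"

lemma ex_mollifier:
  assumes "\<delta> > 0"
  shows "\<exists>\<rho> :: real^'n::finite \<Rightarrow> real. mollifier \<delta> \<rho>"
proof -
  \<comment> \<open>The bump lives on a cube; this side length places the cube inside the ball of radius \<open>\<delta>\<close>.\<close>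
  define d where "d = \<delta> / CARD('n)"
  have d: "d > 0" using assms by (simp add: d_def)
  define b where "b t = flat 1 (d + t) * flat 1 (d - t)" for t
  have "C1k k b" for k
    unfolding b_def using C1k_mult[OF C1k_affine[of k "flat 1" 1 d 1] C1k_affine[of k "flat 1" 1 d "-1"]]
    by (simp add: C1k_flat)
  have b0: "b t \<ge> 0" for t by (simp add: b_def flat_def)
  have bpos: "b t > 0 \<longleftrightarrow> \<bar>t\<bar> < d" for t by (auto simp: b_def flat_def zero_less_mult_iff)
  define \<beta> where "\<beta> x = (\<Prod>j\<in>UNIV. b (x $ j))" for x :: "real^'n"
  have C: "C_k k \<beta>" for k
    unfolding \<beta>_def using \<open>\<And>k. C1k k b\<close> by (intro C_k_prod_components)
  have \<beta>0: "\<beta> x \<ge> 0" for x by (simp add: \<beta>_def b0 prod_nonneg)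
  have \<beta>pos: "\<beta> x > 0 \<longleftrightarrow> (\<forall>j. \<bar>x $ j\<bar> < d)" for x
    using b0 bpos by (auto simp: \<beta>_def less_le prod_nonneg)
  have supp: "\<beta> x = 0" if "norm x \<ge> \<delta>" for x
  proof (rule ccontr)
    assume "\<beta> x \<noteq> 0"
    with \<beta>0[of x] have "\<forall>j. \<bar>x $ j\<bar> < d" using \<beta>pos[of x] by (metis less_le)
    then have "(\<Sum>j\<in>UNIV. \<bar>x $ j\<bar>) < (\<Sum>j\<in>(UNIV::'n set). d)"
      by (intro sum_strict_mono) auto
    then have "norm x < \<delta>" using norm_le_l1_cart[of x] by (simp add: d_def)
    with that show False by simp
  qed
  have cont: "continuous_on UNIV \<beta>" using C[of 0] by simp
  have int: "integrable lborel \<beta>"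
  proof -
    have "integrable lborel (\<lambda>x. indicator (cball 0 \<delta>) x *\<^sub>R \<beta> x)"
      by (rule borel_integrable_compact) (auto intro: continuous_on_subset[OF cont])
    moreover have "(\<lambda>x. indicator (cball 0 \<delta>) x *\<^sub>R \<beta> x) = \<beta>"
      using supp by (auto simp: indicator_def fun_eq_iff)
    ultimately show ?thesis by simp
  qed
  have "(\<integral>x. \<beta> x \<partial>lborel) \<noteq> 0"
  proof
    assume "(\<integral>x. \<beta> x \<partial>lborel) = 0"
    then have "AE x in lborel. \<beta> x = 0"
      using integral_nonneg_eq_0_iff_AE[OF int] \<beta>0 by simp
    then have "AE x in lborel. x \<notin> box (\<chi> j. -d) (\<chi> j. d :: real^'n)"
      by (rule eventually_mono)
         (use \<beta>pos in \<open>auto simp: mem_box_cart abs_less_iff, metis less_irrefl minus_less_iff\<close>)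
    then have "box (\<chi> j. -d) (\<chi> j. d :: real^'n) \<in> null_sets lborel"
      by (simp add: AE_iff_null_sets)
    then have "negligible (box (\<chi> j. -d) (\<chi> j. d :: real^'n))"
      by (simp add: negligible_iff_null_sets null_sets_completionI)
    moreover have "0 \<in> box (\<chi> j. -d) (\<chi> j. d :: real^'n)"
      using d by (simp add: mem_box_cart)
    ultimately show False
      using open_not_negligible[OF open_box] by blast
  qed
  moreover have "(\<integral>x. \<beta> x \<partial>lborel) \<ge> 0" by (simp add: \<beta>0)
  ultimately have I: "(\<integral>x. \<beta> x \<partial>lborel) > 0" by linarith
  define c where "c = 1 / (\<integral>x. \<beta> x \<partial>lborel)"
  have "smooth (\<lambda>x. c * \<beta> x)"
    using C_k_affine[OF C, of _ c 0 1] by (simp add: smooth_def)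
  then have "mollifier \<delta> (\<lambda>x. c * \<beta> x)"
    using \<beta>0 supp int I by (auto simp: mollifier_def c_def)
  then show ?thesis by blast
qed

text \<open>Evaluating a convolution at \<open>x\<close> is testing against this function; hence weak derivatives may
  be moved onto the kernel.\<close>

lemma test_function_mollifier_shift:
  fixes \<rho> :: "real^'n::finite \<Rightarrow> real"
  assumes "mollifier \<delta> \<rho>" "cball x \<delta> \<subseteq> \<Omega>"
  shows "test_function \<Omega> (\<lambda>y. \<rho> (x - y))"
proof -
  have "smooth (\<lambda>y. \<rho> (x - y))"
    using assms(1) C_k_affine[of _ \<rho> 1 x "-1"] by (simp add: smooth_def mollifier_def)
  moreover have "closure {y. \<rho> (x - y) \<noteq> 0} \<subseteq> cball x \<delta>"
    using assms(1) by (intro closure_minimal) (force simp: mollifier_def dist_norm)+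
  moreover from this have "compact (closure {y. \<rho> (x - y) \<noteq> 0})"
    by (meson bounded_cball bounded_subset compact_closure closed_closure compact_eq_bounded_closed)
  ultimately show ?thesis
    using assms(2) by (auto simp: test_function_def)
qed

section \<open>Convolution with smooth kernels, integration by parts\<close>

lemma pderiv_at_eq_0_on_open:
  fixes f :: "real^'n::finite \<Rightarrow> real"
  assumes "open S" "x \<in> S" "\<And>y. y \<in> S \<Longrightarrow> f y = 0"
  shows "pderiv_at i f x = 0"
proof -
  have "((\<lambda>_. 0) has_derivative (\<lambda>_. 0)) (at x)"
    by simp
  then have "(f has_derivative (\<lambda>_. 0)) (at x)"
    by (rule has_derivative_transform_within_open[OF _ assms(1,2)]) (use assms in auto)
  from pderiv_at_eq[OF this] show ?thesis .
qed

lemma pderiv_at_bounded_support: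
  fixes f :: "real^'n::finite \<Rightarrow> real"
  assumes "\<And>x. norm x > R \<Longrightarrow> f x = 0" "norm x > R"
  shows "pderiv_at i f x = 0"
proof (rule pderiv_at_eq_0_on_open[where S = "- cball 0 R"])
  show "open (- cball 0 R :: (real^'n) set)" by (simp add: open_Compl)
qed (use assms in auto)

lemma bounded_of_bounded_support:
  fixes f :: "real^'n::finite \<Rightarrow> real"
  assumes "continuous_on UNIV f" "\<And>x. norm x > R \<Longrightarrow> f x = 0"
  obtains B where "B \<ge> 0" "\<And>x. \<bar>f x\<bar> \<le> B"
proof -
  have "compact (f ` cball 0 R)"
    by (intro compact_continuous_image) (auto intro: continuous_on_subset[OF assms(1)])
  then obtain B where B: "\<And>x. norm x \<le> R \<Longrightarrow> \<bar>f x\<bar> \<le> B"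
    by (force dest!: compact_imp_bounded simp: bounded_iff)
  have "\<bar>f x\<bar> \<le> max B 0" for x
    using B[of x] assms(2)[of x] by (cases "norm x \<le> R") auto
  then show thesis by (intro that[of "max B 0"]) auto
qed

lemma uniformly_continuous_of_bounded_support:
  fixes f :: "real^'n::finite \<Rightarrow> real"
  assumes "continuous_on UNIV f" "\<And>x. norm x > R \<Longrightarrow> f x = 0" "e > 0"
  shows "\<exists>\<delta>>0. \<forall>x y. dist x y < \<delta> \<longrightarrow> \<bar>f x - f y\<bar> < e"
proof -
  have "uniformly_continuous_on (cball 0 (R + 1)) f"
    by (rule compact_uniformly_continuous) (auto intro: continuous_on_subset[OF assms(1)])
  then obtain d where d: "d > 0"
    "\<And>x y. norm x \<le> R + 1 \<Longrightarrow> norm y \<le> R + 1 \<Longrightarrow> dist x y < d \<Longrightarrow> \<bar>f x - f y\<bar> < e"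
    using \<open>e > 0\<close> by (fastforce simp: uniformly_continuous_on_def dist_real_def dist_commute)
  have "\<bar>f x - f y\<bar> < e" if xy: "dist x y < min d 1" for x y
  proof (cases "norm x \<le> R \<or> norm y \<le> R")
    case True
    have "norm x \<le> norm y + dist x y" "norm y \<le> norm x + dist x y"
      by (metis dist_norm norm_triangle_sub add.commute, metis dist_commute dist_norm norm_triangle_sub add.commute)
    with True xy have "norm x \<le> R + 1" "norm y \<le> R + 1" by auto
    then show ?thesis using d(2) xy by simp
  qed (use assms in auto)
  then show ?thesis
    using d(1) by (intro exI[of _ "min d 1"]) auto
qed

lemma axis_mult_sum: "(\<Sum>j\<in>UNIV. axis i 1 $ j * c j) = (c i :: real)"
proof -
  have "(\<Sum>j\<in>UNIV. axis i 1 $ j * c j) = (\<Sum>j\<in>UNIV. if j = i then c j else 0)"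
    by (intro sum.cong) (auto simp: axis_def)
  then show ?thesis by simp
qed

text \<open>Compact support makes the partial derivatives uniformly continuous, and the mean value theorem
  then makes the linearization error uniform in the base point. This uniformity replaces dominated
  convergence when differentiating a convolution.\<close>

lemma uniform_linearization:
  fixes f :: "real^'n::finite \<Rightarrow> real"
  assumes C: "C_k 1 f" and supp: "\<And>x. norm x > R \<Longrightarrow> f x = 0" and "e > 0"
  shows "\<exists>\<delta>>0. \<forall>x h. norm h < \<delta> \<longrightarrow>
    \<bar>f (x + h) - f x - (\<Sum>i\<in>UNIV. h $ i * pderiv_at i f x)\<bar> \<le> e * norm h"
proof -
  define e' where "e' = e / CARD('n)"
  have "e' > 0" using \<open>e > 0\<close> by (simp add: e'_def)
  have "\<forall>i. \<exists>\<delta>>0. \<forall>x y. dist x y < \<delta> \<longrightarrow> \<bar>pderiv_at i f x - pderiv_at i f y\<bar> < e'"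
    by (intro allI uniformly_continuous_of_bounded_support[OF C_1_continuous(2)[OF C] _ \<open>e' > 0\<close>])
       (rule pderiv_at_bounded_support[OF supp])
  then obtain d where "\<forall>i. d i > 0 \<and> (\<forall>x y. dist x y < d i \<longrightarrow> \<bar>pderiv_at i f x - pderiv_at i f y\<bar> < e')"
    by (rule choice[THEN exE])
  then have d: "d i > 0" "dist x y < d i \<Longrightarrow> \<bar>pderiv_at i f x - pderiv_at i f y\<bar> < e'" for i x y
    by blast+
  define \<delta> where "\<delta> = Min (range d)"
  have "\<delta> > 0" using d(1) by (simp add: \<delta>_def)
  have \<delta>: "\<delta> \<le> d i" for i by (simp add: \<delta>_def)
  have "\<bar>f (x + h) - f x - (\<Sum>i\<in>UNIV. h $ i * pderiv_at i f x)\<bar> \<le> e * norm h"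
    if h: "norm h < \<delta>" for x h
  proof -
    have D: "((\<lambda>t. f (x + t *\<^sub>R h)) has_real_derivative (\<Sum>i\<in>UNIV. h $ i * pderiv_at i f (x + t *\<^sub>R h))) (at t)" for t
    proof -
      have "((\<lambda>t. x + t *\<^sub>R h) has_derivative (\<lambda>s. s *\<^sub>R h)) (at t)"
        by (auto intro!: derivative_eq_intros)
      moreover have "(f has_derivative (\<lambda>v. \<Sum>i\<in>UNIV. v $ i * pderiv_at i f (x + t *\<^sub>R h))) (at (x + t *\<^sub>R h))"
        using C by (intro has_derivative_pderiv_at) simp
      ultimately have "((\<lambda>t. f (x + t *\<^sub>R h)) has_derivative
          (\<lambda>s. \<Sum>i\<in>UNIV. (s *\<^sub>R h) $ i * pderiv_at i f (x + t *\<^sub>R h))) (at t)"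
        by (rule has_derivative_compose)
      then show ?thesis
        unfolding has_field_derivative_def
        by (rule has_derivative_eq_rhs) (auto simp: fun_eq_iff sum_distrib_left mult_ac)
    qed
    obtain z where z: "0 < z" "z < 1" "f (x + 1 *\<^sub>R h) - f (x + 0 *\<^sub>R h) =
        (1 - 0) * (\<Sum>i\<in>UNIV. h $ i * pderiv_at i f (x + z *\<^sub>R h))"
      using MVT2[of 0 1 "\<lambda>t. f (x + t *\<^sub>R h)", OF _ D] by auto
    have "\<bar>h $ i * pderiv_at i f (x + z *\<^sub>R h) - h $ i * pderiv_at i f x\<bar> \<le> norm h * e'" for i
    proof -
      have "z * norm h \<le> 1 * norm h"
        using z by (intro mult_right_mono) auto
      then have "dist (x + z *\<^sub>R h) x < d i"
        using z h \<delta>[of i] by (simp add: dist_norm)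
      then have "\<bar>h $ i\<bar> * \<bar>pderiv_at i f (x + z *\<^sub>R h) - pderiv_at i f x\<bar> \<le> norm h * e'"
        using d(2) component_le_norm_cart by (intro mult_mono) (auto intro: less_imp_le)
      then show ?thesis
        by (simp add: abs_mult[symmetric] algebra_simps)
    qed
    then have "(\<Sum>i\<in>UNIV. \<bar>h $ i * pderiv_at i f (x + z *\<^sub>R h) - h $ i * pderiv_at i f x\<bar>)
      \<le> (\<Sum>i\<in>(UNIV::'n set). norm h * e')"
      by (intro sum_mono) auto
    then have "\<bar>\<Sum>i\<in>UNIV. h $ i * pderiv_at i f (x + z *\<^sub>R h) - h $ i * pderiv_at i f x\<bar> \<le> e * norm h"
      by (intro order_trans[OF sum_abs]) (simp add: e'_def mult.commute)
    then show ?thesis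
      using z(3) by (simp add: sum_subtractf)
  qed
  with \<open>\<delta> > 0\<close> show ?thesis by blast
qed

lemma integrable_bounded_times:
  fixes f w :: "real^'n::finite \<Rightarrow> real"
  assumes "integrable lborel w" "f \<in> borel_measurable borel" "\<And>x. \<bar>f x\<bar> \<le> B"
  shows "integrable lborel (\<lambda>y. f y * w y)"
proof (rule Bochner_Integration.integrable_bound)
  show "integrable lborel (\<lambda>y. B * w y)" using assms(1) by simp
  show "(\<lambda>y. f y * w y) \<in> borel_measurable lborel"
    using assms by (auto dest: borel_measurable_integrable)
  show "AE y in lborel. norm (f y * w y) \<le> norm (B * w y)"
    using assms(3) by (auto simp: abs_mult intro!: mult_right_mono order_trans[OF assms(3)])
qed

definition conv :: "(real^'n::finite \<Rightarrow> real) \<Rightarrow> (real^'n \<Rightarrow> real) \<Rightarrow> real^'n \<Rightarrow> real" where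
  "conv \<rho> w x = (\<integral>y. \<rho> (x - y) * w y \<partial>lborel)"

lemma integrable_conv:
  fixes \<rho> w :: "real^'n::finite \<Rightarrow> real"
  assumes "continuous_on UNIV \<rho>" "\<And>x. norm x > R \<Longrightarrow> \<rho> x = 0" "integrable lborel w"
  shows "integrable lborel (\<lambda>y. \<rho> (x - y) * w y)"
proof -
  obtain B where "\<And>x. \<bar>\<rho> x\<bar> \<le> B"
    using bounded_of_bounded_support assms(1,2) by metis
  moreover have "(\<lambda>y. \<rho> (x - y)) \<in> borel_measurable borel"
    by (intro borel_measurable_continuous_onI continuous_on_compose2[OF assms(1)] continuous_intros) auto
  ultimately show ?thesis
    using assms(3) by (intro integrable_bounded_times) auto
qed

lemma has_derivative_conv:
  fixes \<rho> w :: "real^'n::finite \<Rightarrow> real"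
  assumes C: "C_k 1 \<rho>" and supp: "\<And>x. norm x > R \<Longrightarrow> \<rho> x = 0" and w: "integrable lborel w"
  shows "(conv \<rho> w has_derivative (\<lambda>h. \<Sum>i\<in>UNIV. h $ i * conv (pderiv_at i \<rho>) w x)) (at x)"
  unfolding has_derivative_at_alt
proof (intro conjI allI impI)
  show "bounded_linear (\<lambda>h. \<Sum>i\<in>UNIV. h $ i * conv (pderiv_at i \<rho>) w x)"
    by (intro bounded_linear_sum bounded_linear_mult_left[THEN bounded_linear_compose] bounded_linear_vec_nth)
next
  fix e :: real assume "e > 0"
  define W where "W = (\<integral>y. \<bar>w y\<bar> \<partial>lborel)"
  have W: "W \<ge> 0" by (simp add: W_def)
  define e' where "e' = e / (1 + W)"
  have "e' > 0" using \<open>e > 0\<close> W by (simp add: e'_def)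
  from uniform_linearization[OF C supp this] obtain \<delta> where \<delta>: "\<delta> > 0"
    "\<And>x h. norm h < \<delta> \<Longrightarrow> \<bar>\<rho> (x + h) - \<rho> x - (\<Sum>i\<in>UNIV. h $ i * pderiv_at i \<rho> x)\<bar> \<le> e' * norm h"
    by blast
  note I = integrable_conv[OF C_1_continuous(1)[OF C] supp w]
  note I' = integrable_conv[OF C_1_continuous(2)[OF C] pderiv_at_bounded_support[OF supp] w]
  have "norm (conv \<rho> w y - conv \<rho> w x - (\<Sum>i\<in>UNIV. (y - x) $ i * conv (pderiv_at i \<rho>) w x)) \<le> e * norm (y - x)"
    if y: "norm (y - x) < \<delta>" for y
  proof -
    have "(conv \<rho> w y - conv \<rho> w x - (\<Sum>i\<in>UNIV. (y - x) $ i * conv (pderiv_at i \<rho>) w x))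
      = (\<integral>z. \<rho> (y - z) * w z - \<rho> (x - z) * w z
          - (\<Sum>i\<in>UNIV. (y - x) $ i * (pderiv_at i \<rho> (x - z) * w z)) \<partial>lborel)"
      unfolding conv_def
      by (simp add: Bochner_Integration.integral_diff Bochner_Integration.integral_sum
          Bochner_Integration.integrable_diff Bochner_Integration.integrable_sum I I'
          del: vector_minus_component)
    also have "norm \<dots> \<le> (\<integral>z. e' * norm (y - x) * \<bar>w z\<bar> \<partial>lborel)"
    proof (rule order_trans[OF integral_norm_bound], rule integral_mono)
      show "integrable lborel (\<lambda>z. norm (\<rho> (y - z) * w z - \<rho> (x - z) * w z
          - (\<Sum>i\<in>UNIV. (y - x) $ i * (pderiv_at i \<rho> (x - z) * w z))))"
        by (intro integrable_norm Bochner_Integration.integrable_diff I Bochner_Integration.integrable_sum integrable_mult_right I')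
      show "integrable lborel (\<lambda>z. e' * norm (y - x) * \<bar>w z\<bar>)"
        using w by simp
      fix z
      have "\<rho> (y - z) * w z - \<rho> (x - z) * w z
          - (\<Sum>i\<in>UNIV. (y - x) $ i * (pderiv_at i \<rho> (x - z) * w z))
        = (\<rho> ((x - z) + (y - x)) - \<rho> (x - z) - (\<Sum>i\<in>UNIV. (y - x) $ i * pderiv_at i \<rho> (x - z))) * w z"
        by (simp add: left_diff_distrib sum_distrib_right mult.assoc)
      then show "norm (\<rho> (y - z) * w z - \<rho> (x - z) * w z
          - (\<Sum>i\<in>UNIV. (y - x) $ i * (pderiv_at i \<rho> (x - z) * w z))) \<le> e' * norm (y - x) * \<bar>w z\<bar>"
        using \<delta>(2)[OF y, of "x - z"] by (simp add: abs_mult mult_right_mono)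
    qed
    also have "\<dots> = e' * W * norm (y - x)"
      by (simp add: W_def)
    also have "\<dots> \<le> e * norm (y - x)"
      using \<open>e > 0\<close> W by (intro mult_right_mono) (auto simp: e'_def field_simps)
    finally show ?thesis .
  qed
  with \<delta>(1) show "\<exists>d>0. \<forall>y. norm (y - x) < d \<longrightarrow>
      norm (conv \<rho> w y - conv \<rho> w x - (\<Sum>i\<in>UNIV. (y - x) $ i * conv (pderiv_at i \<rho>) w x)) \<le> e * norm (y - x)"
    by blast
qed

lemma pderiv_at_conv:
  fixes \<rho> w :: "real^'n::finite \<Rightarrow> real"
  assumes "C_k 1 \<rho>" "\<And>x. norm x > R \<Longrightarrow> \<rho> x = 0" "integrable lborel w"
  shows "pderiv_at i (conv \<rho> w) = conv (pderiv_at i \<rho>) w"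
proof
  fix x
  show "pderiv_at i (conv \<rho> w) x = conv (pderiv_at i \<rho>) w x"
    using pderiv_at_eq[OF has_derivative_conv[OF assms]] by (simp add: axis_mult_sum)
qed

lemma smooth_conv:
  fixes \<rho> w :: "real^'n::finite \<Rightarrow> real"
  assumes "smooth \<rho>" "\<And>x. norm x > R \<Longrightarrow> \<rho> x = 0" "integrable lborel w"
  shows "smooth (conv \<rho> w)"
proof -
  have "C_k k (conv \<rho> w)" for k
    using assms(1,2)
  proof (induction k arbitrary: \<rho>)
    case 0
    then have "conv \<rho> w differentiable (at x)" for x
      using has_derivative_conv[OF smooth_imp_C_1 _ assms(3)] differentiableI by blast
    then show ?case
      by (simp add: continuous_on_eq_continuous_at differentiable_imp_continuous_within)
  next
    case (Suc k)
    have "conv \<rho> w differentiable (at x)" for x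
      using has_derivative_conv[OF smooth_imp_C_1 _ assms(3)] Suc.prems differentiableI by blast
    moreover have "C_k k (conv (pderiv_at i \<rho>) w)" for i
      by (rule Suc.IH) (use Suc.prems smooth_pderiv_at pderiv_at_bounded_support in blast)+
    ultimately show ?case
      using pderiv_at_conv[OF smooth_imp_C_1[OF Suc.prems(1)] Suc.prems(2) assms(3)] by simp
  qed
  then show ?thesis by (simp add: smooth_def)
qed

lemma lborel_distr_reflect:
  fixes x :: "'a::euclidean_space"
  shows "distr lborel borel (\<lambda>y. x - y) = lborel"
  using lborel_affine[of "-1" x] by (simp add: density_1)

text \<open>Convolving \<open>f\<close> with the indicator of a large ball gives the integral of \<open>f\<close> at every point near the
  origin. This convolution is locally constant, so its derivative, which is the integral of the
  derivative of \<open>f\<close>, vanishes.\<close>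

lemma integral_pderiv_at_eq_0:
  fixes f :: "real^'n::finite \<Rightarrow> real"
  assumes C: "C_k 1 f" and supp: "\<And>x. norm x > R \<Longrightarrow> f x = 0"
  shows "(\<integral>x. pderiv_at i f x \<partial>lborel) = 0"
proof -
  \<comment> \<open>The margin \<open>1\<close> keeps the translates by vectors of the unit ball inside the ball.\<close>
  define w :: "real^'n \<Rightarrow> real" where "w = indicator (cball 0 (R + 1))"
  have w: "integrable lborel w"
    unfolding w_def using emeasure_bounded_finite[OF bounded_cball, of "0 :: real^'n" "R + 1"]
    by (intro integrable_real_indicator) simp_all
  have conv: "conv h w x = (\<integral>y. h y \<partial>lborel)"
    if "\<And>x. norm x > R \<Longrightarrow> h x = 0" "norm x < 1" "continuous_on UNIV h" for h :: "real^'n \<Rightarrow> real" and x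
  proof -
    have "h (x - y) * w y = h (x - y)" for y
    proof (cases "norm y \<le> R + 1")
      case False
      then have "norm (x - y) > R"
        using that(2) norm_triangle_sub[of y x] by (simp add: norm_minus_commute)
      then show ?thesis using that(1) by simp
    qed (simp add: w_def)
    then have "conv h w x = (\<integral>y. h (x - y) \<partial>lborel)"
      by (simp only: conv_def)
    also have "\<dots> = (\<integral>y. h y \<partial>distr lborel borel (\<lambda>y. x - y))"
      using that(3) by (subst integral_distr) (auto intro: borel_measurable_continuous_onI)
    finally show ?thesis by (simp add: lborel_distr_reflect)
  qed
  have "pderiv_at i (\<lambda>x. conv f w x - conv f w 0) 0 = 0"
    by (rule pderiv_at_eq_0_on_open[of "ball 0 1"])
       (use conv[OF supp] C_1_continuous(1)[OF C] in auto)
  moreover have "((\<lambda>x. conv f w x - conv f w 0) has_derivative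
      (\<lambda>h. (\<Sum>i\<in>UNIV. h $ i * conv (pderiv_at i f) w 0) - 0)) (at 0)"
    by (intro has_derivative_diff has_derivative_conv[OF C supp w] has_derivative_const)
  ultimately have "conv (pderiv_at i f) w 0 = 0"
    using pderiv_at_eq by (fastforce simp: axis_mult_sum)
  then show ?thesis
    using conv[of "pderiv_at i f" 0] C_1_continuous(2)[OF C] pderiv_at_bounded_support[of R f, OF supp] by simp
qed

lemma pderiv_at_mult:
  fixes f h :: "real^'n::finite \<Rightarrow> real"
  assumes "f differentiable (at x)" "h differentiable (at x)"
  shows "pderiv_at i (\<lambda>x. f x * h x) x = f x * pderiv_at i h x + pderiv_at i f x * h x"
  using has_derivative_mult[OF assms[unfolded frechet_derivative_works]]
  by (simp add: pderiv_at_eq) (simp add: pderiv_at_def)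

lemma pderiv_at_diff:
  fixes f h :: "real^'n::finite \<Rightarrow> real"
  assumes "f differentiable (at x)" "h differentiable (at x)"
  shows "pderiv_at i (\<lambda>x. f x - h x) x = pderiv_at i f x - pderiv_at i h x"
  using has_derivative_diff[OF assms[unfolded frechet_derivative_works]]
  by (simp add: pderiv_at_eq) (simp add: pderiv_at_def)

lemma C_1_mult:
  assumes "C_k 1 f" "C_k 1 h"
  shows "C_k 1 (\<lambda>x. f x * h x)"
proof -
  have "pderiv_at i (\<lambda>x. f x * h x) = (\<lambda>x. f x * pderiv_at i h x + pderiv_at i f x * h x)" for i
    using assms by (intro ext pderiv_at_mult) auto
  then show ?thesis
    using assms C_1_continuous[OF assms(1)] C_1_continuous[OF assms(2)]
    by (auto intro!: continuous_intros)
qed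

lemma C_1_diff:
  assumes "C_k 1 f" "C_k 1 h"
  shows "C_k 1 (\<lambda>x. f x - h x)"
proof -
  have "pderiv_at i (\<lambda>x. f x - h x) = (\<lambda>x. pderiv_at i f x - pderiv_at i h x)" for i
    using assms by (intro ext pderiv_at_diff) auto
  then show ?thesis
    using assms C_1_continuous[OF assms(1)] C_1_continuous[OF assms(2)]
    by (auto intro!: continuous_intros)
qed

lemma test_function_bounded_support:
  assumes "test_function \<Omega> \<phi>"
  shows "\<exists>R. \<forall>x. norm x > R \<longrightarrow> \<phi> x = 0"
proof -
  have "bounded (closure {x. \<phi> x \<noteq> 0})"
    using assms by (auto simp: test_function_def dest!: compact_imp_bounded)
  then obtain R where "\<And>x. x \<in> closure {x. \<phi> x \<noteq> 0} \<Longrightarrow> norm x \<le> R"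
    unfolding bounded_iff by blast
  then have "norm x > R \<Longrightarrow> \<phi> x = 0" for x
    using closure_subset[of "{x. \<phi> x \<noteq> 0}"] by (metis (mono_tags) mem_Collect_eq not_le subsetD)
  then show ?thesis by blast
qed

lemma test_function_outside:
  assumes "test_function \<Omega> \<phi>" "x \<notin> \<Omega>"
  shows "\<phi> x = 0" "pderiv_at i \<phi> x = 0"
proof -
  have x: "x \<in> - closure {x. \<phi> x \<noteq> 0}"
    using assms by (auto simp: test_function_def)
  then show "\<phi> x = 0"
    using closure_subset[of "{x. \<phi> x \<noteq> 0}"] by blast
  show "pderiv_at i \<phi> x = 0"
    by (rule pderiv_at_eq_0_on_open[OF _ x]) (use closure_subset[of "{x. \<phi> x \<noteq> 0}"] in auto)
qed

lemma test_function_C_1: "test_function \<Omega> \<phi> \<Longrightarrow> C_k 1 \<phi>"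
  by (rule smooth_imp_C_1) (simp add: test_function_def)

lemma integral_lebesgue_on_eq_lborel:
  fixes f :: "real^'n::finite \<Rightarrow> real"
  assumes "\<Omega> \<in> sets lebesgue" "f \<in> borel_measurable borel" "\<And>x. x \<notin> \<Omega> \<Longrightarrow> f x = 0"
  shows "(\<integral>x. f x \<partial>lebesgue_on \<Omega>) = (\<integral>x. f x \<partial>lborel)"
proof -
  have "(\<integral>x. f x \<partial>lebesgue_on \<Omega>) = (\<integral>x. indicator \<Omega> x *\<^sub>R f x \<partial>lebesgue)"
    using assms(1) by (subst integral_restrict_space) auto
  also have "(\<lambda>x. indicator \<Omega> x *\<^sub>R f x) = f"
    using assms(3) by (auto simp: indicator_def fun_eq_iff)
  finally show ?thesis
    using assms(2) by (simp add: integral_completion)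
qed

lemma integrable_continuous_bounded_support:
  fixes f :: "real^'n::finite \<Rightarrow> real"
  assumes "continuous_on UNIV f" "\<And>x. norm x > R \<Longrightarrow> f x = 0"
  shows "integrable lborel f"
proof -
  have "integrable lborel (\<lambda>x. indicator (cball 0 R) x *\<^sub>R f x)"
    by (rule borel_integrable_compact) (auto intro: continuous_on_subset[OF assms(1)])
  moreover have "(\<lambda>x. indicator (cball 0 R) x *\<^sub>R f x) = f"
    using assms(2) by (auto simp: indicator_def fun_eq_iff)
  ultimately show ?thesis by simp
qed

text \<open>Integration by parts: the derivative of the product with a test function has integral zero.\<close>

lemma is_weak_pderiv_pderiv_at:
  fixes p :: "real^'n::finite \<Rightarrow> real"
  assumes p: "C_k 1 p" and "\<Omega> \<in> sets lebesgue"
  shows "is_weak_pderiv \<Omega> i p (pderiv_at i p)"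
  unfolding is_weak_pderiv_def
proof (intro allI impI)
  fix \<phi> assume \<phi>: "test_function \<Omega> \<phi>"
  then obtain R where R: "\<And>x. norm x > R \<Longrightarrow> \<phi> x = 0"
    using test_function_bounded_support by blast
  have R': "pderiv_at i \<phi> x = 0" if "norm x > R" for x
    using pderiv_at_bounded_support[OF R that] .
  note cont = C_1_continuous[OF p] C_1_continuous[OF test_function_C_1[OF \<phi>]]
  have c1: "continuous_on UNIV (\<lambda>x. p x * pderiv_at i \<phi> x)"
    and c2: "continuous_on UNIV (\<lambda>x. pderiv_at i p x * \<phi> x)"
    using cont by (auto intro!: continuous_intros)
  have "(\<integral>x. p x * pderiv_at i \<phi> x \<partial>lborel) + (\<integral>x. pderiv_at i p x * \<phi> x \<partial>lborel)
    = (\<integral>x. p x * pderiv_at i \<phi> x + pderiv_at i p x * \<phi> x \<partial>lborel)"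
    by (intro Bochner_Integration.integral_add[symmetric] integrable_continuous_bounded_support[of _ R] c1 c2)
       (simp_all add: R R')
  also have "\<dots> = (\<integral>x. pderiv_at i (\<lambda>x. p x * \<phi> x) x \<partial>lborel)"
    using p test_function_C_1[OF \<phi>] by (simp add: pderiv_at_mult)
  also have "\<dots> = 0"
    by (rule integral_pderiv_at_eq_0[OF C_1_mult[OF p test_function_C_1[OF \<phi>]], of R]) (simp add: R)
  finally have "(\<integral>x. p x * pderiv_at i \<phi> x \<partial>lborel) = - (\<integral>x. pderiv_at i p x * \<phi> x \<partial>lborel)"
    by simp
  moreover have "(\<integral>x. p x * pderiv_at i \<phi> x \<partial>lebesgue_on \<Omega>) = (\<integral>x. p x * pderiv_at i \<phi> x \<partial>lborel)"
    by (rule integral_lebesgue_on_eq_lborel[OF assms(2)])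
       (use c1 test_function_outside[OF \<phi>] in \<open>auto intro: borel_measurable_continuous_onI\<close>)
  moreover have "(\<integral>x. pderiv_at i p x * \<phi> x \<partial>lebesgue_on \<Omega>) = (\<integral>x. pderiv_at i p x * \<phi> x \<partial>lborel)"
    by (rule integral_lebesgue_on_eq_lborel[OF assms(2)])
       (use c2 test_function_outside[OF \<phi>] in \<open>auto intro: borel_measurable_continuous_onI\<close>)
  ultimately show "(\<integral>x. p x * pderiv_at i \<phi> x \<partial>lebesgue_on \<Omega>) = - (\<integral>x. pderiv_at i p x * \<phi> x \<partial>lebesgue_on \<Omega>)"
    by simp
qed

section \<open>Mean-square convergence of mollifications\<close>

lemma integrable_shift:
  fixes f :: "'a::euclidean_space \<Rightarrow> real"
  assumes "integrable lborel f"
  shows "integrable lborel (\<lambda>x. f (x + y))"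
proof -
  have "integrable (distr lborel borel ((+) y)) f"
    using assms by (simp add: lborel_distr_plus)
  then show ?thesis
    using assms by (subst (asm) integrable_distr_eq) (auto simp: add.commute dest: borel_measurable_integrable)
qed

lemma integral_shift:
  fixes f :: "'a::euclidean_space \<Rightarrow> real"
  assumes "f \<in> borel_measurable borel"
  shows "(\<integral>x. f (x + y) \<partial>lborel) = (\<integral>x. f x \<partial>lborel)"
proof -
  have "(\<integral>x. f x \<partial>lborel) = (\<integral>x. f x \<partial>distr lborel borel ((+) y))"
    by (simp add: lborel_distr_plus)
  also have "\<dots> = (\<integral>x. f (x + y) \<partial>lborel)"
    using assms by (subst integral_distr) (auto simp: add.commute)
  finally show ?thesis by simp
qed

definition L1_shift_continuous :: "('a::euclidean_space \<Rightarrow> real) \<Rightarrow> bool" where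
  "L1_shift_continuous f \<longleftrightarrow> ((\<lambda>y. \<integral>x. \<bar>f (x + y) - f x\<bar> \<partial>lborel) \<longlongrightarrow> 0) (at 0)"

lemma L1_shift_continuous_approx:
  fixes f :: "'a::euclidean_space \<Rightarrow> real"
  assumes f: "integrable lborel f"
    and approx: "\<And>e. e > 0 \<Longrightarrow>
      \<exists>h. integrable lborel h \<and> L1_shift_continuous h \<and> (\<integral>x. \<bar>f x - h x\<bar> \<partial>lborel) \<le> e"
  shows "L1_shift_continuous f"
  unfolding L1_shift_continuous_def
proof (rule tendstoI)
  fix e :: real assume e: "e > 0"
  then obtain h where h: "integrable lborel h" "L1_shift_continuous h"
    and fh: "(\<integral>x. \<bar>f x - h x\<bar> \<partial>lborel) \<le> e / 3"
    using approx[of "e / 3"] by auto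
  have "\<forall>\<^sub>F y in at 0. dist (\<integral>x. \<bar>h (x + y) - h x\<bar> \<partial>lborel) 0 < e / 3"
    using h(2) e unfolding L1_shift_continuous_def by (intro tendstoD) simp_all
  then show "\<forall>\<^sub>F y in at 0. dist (\<integral>x. \<bar>f (x + y) - f x\<bar> \<partial>lborel) 0 < e"
  proof eventually_elim
    case (elim y)
    note I = integrable_shift[OF f] integrable_shift[OF h(1)] f h(1)
    have "(\<integral>x. \<bar>f (x + y) - f x\<bar> \<partial>lborel)
      \<le> (\<integral>x. \<bar>f (x + y) - h (x + y)\<bar> + \<bar>h (x + y) - h x\<bar> + \<bar>f x - h x\<bar> \<partial>lborel)"
      by (intro integral_mono Bochner_Integration.integrable_add integrable_abs
          Bochner_Integration.integrable_diff I) auto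
    also have "\<dots> = (\<integral>x. \<bar>f (x + y) - h (x + y)\<bar> \<partial>lborel) + (\<integral>x. \<bar>h (x + y) - h x\<bar> \<partial>lborel)
        + (\<integral>x. \<bar>f x - h x\<bar> \<partial>lborel)"
      using I by simp
    also have "(\<integral>x. \<bar>f (x + y) - h (x + y)\<bar> \<partial>lborel) = (\<integral>x. \<bar>f x - h x\<bar> \<partial>lborel)"
      using f h(1) by (intro integral_shift[of "\<lambda>x. \<bar>f x - h x\<bar>"]) (auto dest!: borel_measurable_integrable)
    finally have "(\<integral>x. \<bar>f (x + y) - f x\<bar> \<partial>lborel) < e"
      using fh elim by (auto simp: dist_real_def)
    moreover have "(\<integral>x. \<bar>f (x + y) - f x\<bar> \<partial>lborel) \<ge> 0" by simp
    ultimately show ?case by (simp add: dist_real_def)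
  qed
qed

text \<open>The indicator of an open set is lower semicontinuous, so the positive part of the difference to its
  translate tends to zero by dominated convergence. As both indicators have the same integral,
  the negative part has the same integral as the positive part.\<close>

lemma L1_shift_continuous_open:
  fixes U :: "'a::euclidean_space set"
  assumes U: "open U" "emeasure lborel U < \<infinity>"
  shows "L1_shift_continuous (\<lambda>x. indicator U x * c)"
proof -
  let ?f = "indicator U :: 'a \<Rightarrow> real"
  have f: "integrable lborel ?f"
    using U by (intro integrable_real_indicator) auto
  have "(\<lambda>n. \<integral>x. \<bar>?f (x + Y n) * c - ?f x * c\<bar> \<partial>lborel) \<longlonglongrightarrow> 0" if Y: "Y \<longlonglongrightarrow> 0" for Y
  proof -
    define h where "h n x = max 0 (?f x - ?f (x + Y n))" for n x
    have "?f \<in> borel_measurable borel" using U(1) by simp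
    then have h_meas: "h n \<in> borel_measurable lborel" for n
      using measurable_compose[of "\<lambda>x. x + Y n" borel borel ?f borel]
      unfolding h_def by (simp add: borel_measurable_max)
    have h_le: "\<bar>h n x\<bar> \<le> ?f x" for n x by (simp add: h_def indicator_def)
    have h: "integrable lborel (h n)" for n
      by (rule Bochner_Integration.integrable_bound[OF f]) (use h_meas h_le in auto)
    have "(\<lambda>n. \<integral>x. h n x \<partial>lborel) \<longlonglongrightarrow> (\<integral>x. 0 \<partial>(lborel :: 'a measure))"
    proof (rule integral_dominated_convergence[where w = ?f])
      show "AE x in lborel. (\<lambda>n. h n x) \<longlonglongrightarrow> 0"
      proof (rule AE_I2)
        fix x
        have "\<forall>\<^sub>F n in sequentially. h n x = 0"
        proof (cases "x \<in> U")
          case True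
          have "(\<lambda>n. x + Y n) \<longlonglongrightarrow> x"
            using tendsto_add[OF tendsto_const Y, of x] by simp
          then have "\<forall>\<^sub>F n in sequentially. x + Y n \<in> U"
            using U(1) True topological_tendstoD by blast
          then show ?thesis by eventually_elim (simp add: h_def indicator_def)
        qed (simp add: h_def)
        then show "(\<lambda>n. h n x) \<longlonglongrightarrow> 0" by (rule tendsto_eventually)
      qed
    qed (use f h_meas h_le in auto)
    then have "(\<lambda>n. \<bar>c\<bar> * (2 * (\<integral>x. h n x \<partial>lborel))) \<longlonglongrightarrow> \<bar>c\<bar> * (2 * 0)"
      by (intro tendsto_intros) simp
    moreover have "(\<integral>x. \<bar>?f (x + Y n) * c - ?f x * c\<bar> \<partial>lborel) = \<bar>c\<bar> * (2 * (\<integral>x. h n x \<partial>lborel))" for n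
    proof -
      have "(\<integral>x. \<bar>?f (x + Y n) * c - ?f x * c\<bar> \<partial>lborel) = (\<integral>x. \<bar>c\<bar> * (2 * h n x + ?f (x + Y n) - ?f x) \<partial>lborel)"
        by (intro Bochner_Integration.integral_cong) (auto simp: h_def indicator_def)
      also have "\<dots> = \<bar>c\<bar> * (2 * (\<integral>x. h n x \<partial>lborel) + (\<integral>x. ?f (x + Y n) \<partial>lborel) - (\<integral>x. ?f x \<partial>lborel))"
        using f h integrable_shift[OF f] by (simp del: integral_indicator)
      also have "(\<integral>x. ?f (x + Y n) \<partial>lborel) = (\<integral>x. ?f x \<partial>lborel)"
        using U(1) by (intro integral_shift) simp
      finally show ?thesis by simp
    qed
    ultimately show ?thesis by simp
  qed
  then show ?thesis
    unfolding L1_shift_continuous_def tendsto_at_iff_sequentially comp_def by blast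
qed

text \<open>Sets of finite measure are approximated from outside by open sets; sums and dominated limits
  do the rest.\<close>

lemma integrable_imp_L1_shift_continuous:
  fixes f :: "'a::euclidean_space \<Rightarrow> real"
  assumes "integrable lborel f"
  shows "L1_shift_continuous f"
  using assms
proof induction
  case (base A c)
  then have A: "A \<in> sets borel" "emeasure lborel A < \<infinity>" by auto
  have fA: "integrable lborel (\<lambda>x. indicator A x *\<^sub>R c)"
    using base by simp
  show ?case
  proof (rule L1_shift_continuous_approx[OF fA])
    fix e :: real assume e: "e > 0"
    define e' where "e' = e / (1 + \<bar>c\<bar>)"
    have "e' > 0" using e by (simp add: e'_def)
    then obtain U where U: "open U" "A \<subseteq> U" "emeasure lborel (U - A) < e'"
      using outer_regular_lborel[OF A(1)] by blast
    have "emeasure lborel U = emeasure lborel (A \<union> (U - A))"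
      using U(2) by (simp add: Un_absorb1)
    also have "\<dots> \<le> emeasure lborel A + emeasure lborel (U - A)"
      using A U by (intro emeasure_subadditive) auto
    also have "\<dots> < \<infinity>"
      using A(2) U(3) by (auto simp: less_top[symmetric] top_unique)
    finally have Ufin: "emeasure lborel U < \<infinity>" .
    have "measure lborel (U - A) \<le> e'"
      using U(3) \<open>e' > 0\<close> by (simp add: measure_def enn2real_leI less_imp_le)
    moreover have "(\<integral>x. \<bar>indicator A x *\<^sub>R c - indicator U x * c\<bar> \<partial>lborel) = (\<integral>x. indicator (U - A) x * \<bar>c\<bar> \<partial>lborel)"
      using U(2) by (intro Bochner_Integration.integral_cong) (auto simp: indicator_def)
    moreover have "\<dots> = measure lborel (U - A) * \<bar>c\<bar>"
      using U A by simp
    ultimately have "(\<integral>x. \<bar>indicator A x *\<^sub>R c - indicator U x * c\<bar> \<partial>lborel) \<le> e' * \<bar>c\<bar>"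
      by (simp add: mult_right_mono)
    also have "\<dots> \<le> e"
      using e by (simp add: e'_def field_simps)
    finally show "\<exists>h. integrable lborel h \<and> L1_shift_continuous h \<and>
        (\<integral>x. \<bar>indicator A x *\<^sub>R c - h x\<bar> \<partial>lborel) \<le> e"
      using U(1) Ufin by (intro exI[of _ "\<lambda>x. indicator U x * c"])
         (auto intro: L1_shift_continuous_open)
  qed
next
  case (add f h)
  note I = integrable_shift[OF add(1)] integrable_shift[OF add(2)] add(1,2)
  have "((\<lambda>y. (\<integral>x. \<bar>f (x + y) - f x\<bar> \<partial>lborel) + (\<integral>x. \<bar>h (x + y) - h x\<bar> \<partial>lborel)) \<longlongrightarrow> 0 + 0) (at 0)"
    using add by (intro tendsto_add) (simp_all add: L1_shift_continuous_def)
  then have "((\<lambda>y. (\<integral>x. \<bar>f (x + y) - f x\<bar> \<partial>lborel) + (\<integral>x. \<bar>h (x + y) - h x\<bar> \<partial>lborel)) \<longlongrightarrow> 0) (at 0)"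
    by simp
  moreover have *: "norm (\<integral>x. \<bar>f (x + y) + h (x + y) - (f x + h x)\<bar> \<partial>lborel)
      \<le> (\<integral>x. \<bar>f (x + y) - f x\<bar> \<partial>lborel) + (\<integral>x. \<bar>h (x + y) - h x\<bar> \<partial>lborel)" for y
  proof -
    have "(\<integral>x. \<bar>f (x + y) + h (x + y) - (f x + h x)\<bar> \<partial>lborel)
      \<le> (\<integral>x. \<bar>f (x + y) - f x\<bar> + \<bar>h (x + y) - h x\<bar> \<partial>lborel)"
      by (intro integral_mono Bochner_Integration.integrable_add integrable_abs
          Bochner_Integration.integrable_diff I) auto
    also have "\<dots> = (\<integral>x. \<bar>f (x + y) - f x\<bar> \<partial>lborel) + (\<integral>x. \<bar>h (x + y) - h x\<bar> \<partial>lborel)"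
      using I by (intro Bochner_Integration.integral_add integrable_abs Bochner_Integration.integrable_diff)
    finally show ?thesis by simp
  qed
  ultimately show ?case
    unfolding L1_shift_continuous_def
    by (elim Lim_null_comparison[rotated]) (rule always_eventually, rule allI, rule *)
next
  case (lim f s)
  show ?case
  proof (rule L1_shift_continuous_approx[OF lim.hyps(4)])
    fix e :: real assume e: "e > 0"
    have "(\<lambda>i. \<integral>x. \<bar>f x - s i x\<bar> \<partial>lborel) \<longlonglongrightarrow> (\<integral>x. 0 \<partial>(lborel :: 'a measure))"
    proof (rule integral_dominated_convergence[where w = "\<lambda>x. 3 * \<bar>f x\<bar>"])
      show "AE x in lborel. (\<lambda>i. \<bar>f x - s i x\<bar>) \<longlonglongrightarrow> 0"
      proof (rule AE_I2)
        fix x :: 'a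
        have "(\<lambda>i. \<bar>f x - s i x\<bar>) \<longlonglongrightarrow> \<bar>f x - f x\<bar>"
          using lim.hyps(2)[of x] by (intro tendsto_intros) simp
        then show "(\<lambda>i. \<bar>f x - s i x\<bar>) \<longlonglongrightarrow> 0" by simp
      qed
      show "AE x in lborel. norm \<bar>f x - s i x\<bar> \<le> 3 * \<bar>f x\<bar>" for i
      proof (rule AE_I2)
        fix x
        show "norm \<bar>f x - s i x\<bar> \<le> 3 * \<bar>f x\<bar>"
          using lim.hyps(3)[of x i] abs_triangle_ineq4[of "f x" "s i x"] by simp
      qed
    qed (use lim.hyps(1,4) in \<open>auto dest!: borel_measurable_integrable\<close>)
    then have "\<forall>\<^sub>F i in sequentially. (\<integral>x. \<bar>f x - s i x\<bar> \<partial>lborel) < e"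
      using e by (intro order_tendstoD) auto
    then obtain i where "(\<integral>x. \<bar>f x - s i x\<bar> \<partial>lborel) < e"
      by (auto simp: eventually_sequentially)
    then show "\<exists>h. integrable lborel h \<and> L1_shift_continuous h \<and> (\<integral>x. \<bar>f x - h x\<bar> \<partial>lborel) \<le> e"
      using lim.hyps(1) lim.IH by (intro exI[of _ "s i"]) auto
  qed
qed

text \<open>Mean-square distances of \<open>w\<close> to its translates are thereby bounded by mean distances of the integrable
  function \<open>w * \<bar>w\<bar>\<close> to its own, and continuity of translations passes from \<open>L\<^sup>1\<close> to \<open>L\<^sup>2\<close>.\<close>

lemma square_diff_le_signed_squares:
  fixes a b :: real
  shows "(a - b)\<^sup>2 \<le> 2 * \<bar>a * \<bar>a\<bar> - b * \<bar>b\<bar>\<bar>"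
proof -
  have same: "(a - b)\<^sup>2 \<le> 2 * \<bar>a\<^sup>2 - b\<^sup>2\<bar>" if "0 \<le> a * b"
  proof -
    have "\<bar>a - b\<bar> \<le> \<bar>a + b\<bar>"
      using that by (subst abs_le_square_iff) (simp add: power2_eq_square algebra_simps)
    then have "\<bar>a - b\<bar> * \<bar>a - b\<bar> \<le> \<bar>a + b\<bar> * \<bar>a - b\<bar>"
      by (intro mult_right_mono) auto
    then have "(a - b)\<^sup>2 \<le> \<bar>a\<^sup>2 - b\<^sup>2\<bar>"
      by (simp add: abs_mult[symmetric] power2_eq_square algebra_simps)
    also have "\<dots> \<le> 2 * \<bar>a\<^sup>2 - b\<^sup>2\<bar>" by simp
    finally show ?thesis .
  qed
  have opp: "(a - b)\<^sup>2 \<le> 2 * (a\<^sup>2 + b\<^sup>2)"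
    using zero_le_power2[of "a + b"] by (simp add: power2_eq_square algebra_simps)
  consider "a \<ge> 0" "b \<ge> 0" | "a \<le> 0" "b \<le> 0" | "a \<ge> 0" "b \<le> 0" | "a \<le> 0" "b \<ge> 0"
    by linarith
  then show ?thesis
  proof cases
    case 1
    then show ?thesis using same by (simp add: power2_eq_square)
  next
    case 2
    then have "0 \<le> a * b" by (simp add: mult_nonpos_nonpos)
    then show ?thesis using same 2 by (simp add: power2_eq_square abs_minus_commute)
  next
    case 3
    then show ?thesis using opp by (simp add: power2_eq_square)
  next
    case 4
    then have "\<bar>a * \<bar>a\<bar> - b * \<bar>b\<bar>\<bar> = a\<^sup>2 + b\<^sup>2"
      by (simp add: power2_eq_square)
    then show ?thesis using opp by simp
  qed
qed

lemma L2_shift_continuous: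
  fixes w :: "'a::euclidean_space \<Rightarrow> real"
  assumes w[measurable]: "w \<in> borel_measurable borel" and "integrable lborel (\<lambda>x. (w x)\<^sup>2)" and e: "e > 0"
  shows "\<exists>\<delta>>0. \<forall>y. norm y < \<delta> \<longrightarrow> (\<integral>\<^sup>+x. ennreal ((w (x - y) - w x)\<^sup>2) \<partial>lborel) \<le> ennreal e"
proof -
  let ?f = "\<lambda>x. w x * \<bar>w x\<bar>"
  have f: "integrable lborel ?f"
    using assms(2) by (rule Bochner_Integration.integrable_bound) (auto simp: abs_mult power2_eq_square)
  have "\<forall>\<^sub>F y in at 0. dist (\<integral>x. \<bar>?f (x + y) - ?f x\<bar> \<partial>lborel) 0 < e / 2"
    using integrable_imp_L1_shift_continuous[OF f] e unfolding L1_shift_continuous_def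
    by (intro tendstoD) auto
  then obtain \<delta> where \<delta>: "\<delta> > 0"
    "\<And>y. y \<noteq> 0 \<Longrightarrow> norm y < \<delta> \<Longrightarrow> (\<integral>x. \<bar>?f (x + y) - ?f x\<bar> \<partial>lborel) < e / 2"
    by (auto simp: eventually_at dist_real_def)
  have "(\<integral>\<^sup>+x. ennreal ((w (x - y) - w x)\<^sup>2) \<partial>lborel) \<le> ennreal e" if "norm y < \<delta>" for y
  proof (cases "y = 0")
    case False
    have "(\<integral>\<^sup>+x. ennreal ((w (x - y) - w x)\<^sup>2) \<partial>lborel) \<le> (\<integral>\<^sup>+x. ennreal (2 * \<bar>?f (x + - y) - ?f x\<bar>) \<partial>lborel)"
      using square_diff_le_signed_squares[of "w (_ - y)" "w _"] by (intro nn_integral_mono) auto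
    also have "\<dots> = ennreal (\<integral>x. 2 * \<bar>?f (x + - y) - ?f x\<bar> \<partial>lborel)"
      using integrable_shift[OF f, of "- y"] f by (intro nn_integral_eq_integral) auto
    also have "\<dots> \<le> ennreal e"
      using \<delta>(2)[of "- y"] False that by (intro ennreal_leI) simp
    finally show ?thesis .
  qed simp
  with \<delta>(1) show ?thesis by blast
qed

text \<open>The Jensen inequality for squares: with \<open>c\<close> the weighted mean of \<open>X\<close>, integrate \<open>(X - c)\<^sup>2 \<ge> 0\<close> against the
  weight.\<close>

lemma square_weighted_mean_le:
  fixes \<rho> X :: "'a \<Rightarrow> real"
  assumes \<rho>: "integrable M \<rho>" "\<And>x. \<rho> x \<ge> 0" "(\<integral>x. \<rho> x \<partial>M) = 1"
    and X: "integrable M (\<lambda>x. \<rho> x * X x)" "X \<in> borel_measurable M"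
  shows "ennreal ((\<integral>x. \<rho> x * X x \<partial>M)\<^sup>2) \<le> (\<integral>\<^sup>+x. ennreal (\<rho> x * (X x)\<^sup>2) \<partial>M)"
proof (cases "(\<integral>\<^sup>+x. ennreal (\<rho> x * (X x)\<^sup>2) \<partial>M) = \<infinity>")
  case False
  define c where "c = (\<integral>x. \<rho> x * X x \<partial>M)"
  have [measurable]: "\<rho> \<in> borel_measurable M" "X \<in> borel_measurable M"
    using \<rho> X by auto
  have I: "integrable M (\<lambda>x. \<rho> x * (X x)\<^sup>2)"
    using False \<rho>(2) by (intro integrableI_bounded) (auto simp: less_top)
  have "c\<^sup>2 = (\<integral>x. 2 * c * (\<rho> x * X x) - c\<^sup>2 * \<rho> x \<partial>M)"
    using \<rho> X by (simp add: c_def[symmetric] power2_eq_square)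
  also have "\<dots> \<le> (\<integral>x. \<rho> x * (X x)\<^sup>2 \<partial>M)"
  proof (rule integral_mono)
    show "2 * c * (\<rho> x * X x) - c\<^sup>2 * \<rho> x \<le> \<rho> x * (X x)\<^sup>2" for x
      using mult_nonneg_nonneg[OF \<rho>(2) zero_le_power2[of "X x - c"], of x]
      by (simp add: power2_eq_square algebra_simps)
  qed (use \<rho> X I in auto)
  finally have "ennreal (c\<^sup>2) \<le> ennreal (\<integral>x. \<rho> x * (X x)\<^sup>2 \<partial>M)"
    by (rule ennreal_leI)
  also have "\<dots> = (\<integral>\<^sup>+x. ennreal (\<rho> x * (X x)\<^sup>2) \<partial>M)"
    using I \<rho>(2) by (intro nn_integral_eq_integral[symmetric]) auto
  finally show ?thesis by (simp add: c_def)
qed simp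

lemma mollifier_bounded_support: "mollifier \<delta> \<rho> \<Longrightarrow> norm x > \<delta> \<Longrightarrow> \<rho> x = 0"
  by (auto simp: mollifier_def)

lemma mollifier_continuous: "mollifier \<delta> \<rho> \<Longrightarrow> continuous_on UNIV \<rho>"
  by (auto simp: mollifier_def intro: C_1_continuous smooth_imp_C_1)

lemma mollifier_mono: "mollifier \<delta> \<rho> \<Longrightarrow> \<delta> \<le> \<epsilon> \<Longrightarrow> mollifier \<epsilon> \<rho>"
  by (auto simp: mollifier_def)

lemma conv_reflect:
  fixes \<rho> w :: "real^'n::finite \<Rightarrow> real"
  assumes \<rho>: "mollifier \<delta> \<rho>" and w: "integrable lborel w"
  shows "integrable lborel (\<lambda>z. \<rho> z * w (x - z))" "conv \<rho> w x = (\<integral>z. \<rho> z * w (x - z) \<partial>lborel)"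
proof -
  have [measurable]: "\<rho> \<in> borel_measurable borel" "w \<in> borel_measurable borel"
    using mollifier_continuous[OF \<rho>] w borel_measurable_integrable[OF w] by (auto intro: borel_measurable_continuous_onI)
  have "integrable lborel (\<lambda>y. \<rho> (x - y) * w y)"
    by (rule integrable_conv[OF mollifier_continuous[OF \<rho>] mollifier_bounded_support[OF \<rho>] w])
  then have "integrable (distr lborel borel (\<lambda>y. x - y)) (\<lambda>y. \<rho> (x - y) * w y)"
    by (simp add: lborel_distr_reflect)
  then show "integrable lborel (\<lambda>z. \<rho> z * w (x - z))"
    by (subst (asm) integrable_distr_eq) auto
  have "conv \<rho> w x = (\<integral>y. \<rho> (x - y) * w y \<partial>distr lborel borel (\<lambda>y. x - y))"
    by (simp add: conv_def lborel_distr_reflect)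
  then show "conv \<rho> w x = (\<integral>z. \<rho> z * w (x - z) \<partial>lborel)"
    by (subst (asm) integral_distr) auto
qed

text \<open>The error at \<open>x\<close> is a weighted mean of the differences \<open>w (x - z) - w x\<close>. By the Jensen
  inequality and Tonelli, its mean square is a weighted mean over \<open>z\<close> of the mean-square distances of
  \<open>w\<close> to its translates by short vectors.\<close>

lemma L2_convergence_conv:
  fixes w :: "real^'n::finite \<Rightarrow> real"
  assumes w: "integrable lborel w" and w2: "integrable lborel (\<lambda>x. (w x)\<^sup>2)" and e: "e > 0"
  shows "\<exists>\<delta>>0. \<forall>\<rho>. mollifier \<delta> \<rho> \<longrightarrow> (\<integral>\<^sup>+x. ennreal ((conv \<rho> w x - w x)\<^sup>2) \<partial>lborel) \<le> ennreal e"
proof -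
  have wm[measurable]: "w \<in> borel_measurable borel"
    using borel_measurable_integrable[OF w] by simp
  obtain \<delta> where \<delta>: "\<delta> > 0"
    "\<And>y. norm y < \<delta> \<Longrightarrow> (\<integral>\<^sup>+x. ennreal ((w (x - y) - w x)\<^sup>2) \<partial>lborel) \<le> ennreal e"
    using L2_shift_continuous[OF wm w2 e] by blast
  have "(\<integral>\<^sup>+x. ennreal ((conv \<rho> w x - w x)\<^sup>2) \<partial>lborel) \<le> ennreal e" if \<rho>: "mollifier \<delta> \<rho>" for \<rho> :: "real^'n \<Rightarrow> real"
  proof -
    have \<rho>': "integrable lborel \<rho>" "\<rho> x \<ge> 0" "(\<integral>x. \<rho> x \<partial>lborel) = 1" "norm x \<ge> \<delta> \<Longrightarrow> \<rho> x = 0" for x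
      using \<rho> by (auto simp: mollifier_def)
    have [measurable]: "\<rho> \<in> borel_measurable borel"
      using borel_measurable_integrable[OF \<rho>'(1)] by simp
    have "ennreal ((conv \<rho> w x - w x)\<^sup>2) \<le> (\<integral>\<^sup>+z. ennreal (\<rho> z * (w (x - z) - w x)\<^sup>2) \<partial>lborel)" for x
    proof -
      note I = conv_reflect[OF \<rho> w, of x]
      have "integrable lborel (\<lambda>z. \<rho> z * (w (x - z) - w x))"
        using I(1) \<rho>'(1) by (simp add: right_diff_distrib)
      moreover have "conv \<rho> w x - w x = (\<integral>z. \<rho> z * (w (x - z) - w x) \<partial>lborel)"
        using I \<rho>' by (simp add: right_diff_distrib)
      ultimately show ?thesis
        using square_weighted_mean_le[OF \<rho>'(1,2,3), of "\<lambda>z. w (x - z) - w x"] by simp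
    qed
    then have "(\<integral>\<^sup>+x. ennreal ((conv \<rho> w x - w x)\<^sup>2) \<partial>lborel)
        \<le> (\<integral>\<^sup>+x. \<integral>\<^sup>+z. ennreal (\<rho> z * (w (x - z) - w x)\<^sup>2) \<partial>lborel \<partial>lborel)"
      by (intro nn_integral_mono)
    also have "\<dots> = (\<integral>\<^sup>+z. \<integral>\<^sup>+x. ennreal (\<rho> z * (w (x - z) - w x)\<^sup>2) \<partial>lborel \<partial>lborel)"
      by (rule lborel_pair.Fubini') measurable
    also have "\<dots> = (\<integral>\<^sup>+z. ennreal (\<rho> z) * (\<integral>\<^sup>+x. ennreal ((w (x - z) - w x)\<^sup>2) \<partial>lborel) \<partial>lborel)"
      using \<rho>'(2) by (simp add: ennreal_mult nn_integral_cmult)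
    also have "\<dots> \<le> (\<integral>\<^sup>+z. ennreal (\<rho> z) * ennreal e \<partial>lborel)"
    proof (rule nn_integral_mono)
      show "ennreal (\<rho> z) * (\<integral>\<^sup>+x. ennreal ((w (x - z) - w x)\<^sup>2) \<partial>lborel) \<le> ennreal (\<rho> z) * ennreal e" for z
        using \<delta>(2)[of z] \<rho>'(4)[of z] by (cases "norm z < \<delta>") (auto intro: mult_left_mono)
    qed
    also have "\<dots> = ennreal e"
      using nn_integral_eq_integral[OF \<rho>'(1)] \<rho>'(2,3) by (simp add: nn_integral_multc)
    finally show ?thesis .
  qed
  with \<delta>(1) show ?thesis by blast
qed

section \<open>Weak derivatives\<close>

lemma square_integrable_imp_integrable:
  assumes "finite_measure M" "square_integrable M f"
  shows "integrable M f"
proof -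
  interpret finite_measure M by fact
  show ?thesis
  proof (rule Bochner_Integration.integrable_bound)
    show "integrable M (\<lambda>x. 1 + (f x)\<^sup>2)"
      using assms(2) by (auto simp: square_integrable_def)
    show "f \<in> borel_measurable M"
      using assms(2) by (simp add: square_integrable_def)
    have "\<bar>t\<bar> \<le> 1 + t\<^sup>2" for t :: real
      using zero_le_power2[of "\<bar>t\<bar> - 1"] by (simp add: power2_eq_square algebra_simps)
    then show "AE x in M. norm (f x) \<le> norm (1 + (f x)\<^sup>2)"
      by (auto intro!: AE_I2 order_trans[OF _ abs_ge_self])
  qed
qed

lemma square_diff_le: "(a - b)\<^sup>2 \<le> 2 * a\<^sup>2 + 2 * (b :: real)\<^sup>2"
  using zero_le_power2[of "a + b"] by (simp add: power2_eq_square algebra_simps)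

lemma square_integrable_diff:
  assumes "square_integrable M f" "square_integrable M h"
  shows "square_integrable M (\<lambda>x. f x - h x)"
proof -
  have [measurable]: "f \<in> borel_measurable M" "h \<in> borel_measurable M"
    using assms by (auto simp: square_integrable_def)
  have "integrable M (\<lambda>x. 2 * (f x)\<^sup>2 + 2 * (h x)\<^sup>2)"
    using assms by (auto simp: square_integrable_def)
  then have "integrable M (\<lambda>x. (f x - h x)\<^sup>2)"
    by (rule Bochner_Integration.integrable_bound)
       (auto simp: square_diff_le)
  then show ?thesis by (simp add: square_integrable_def)
qed

locale bounded_open =
  fixes \<Omega> :: "(real^'n::finite) set"
  assumes open\<Omega>: "open \<Omega>" and bounded\<Omega>: "bounded \<Omega>"
begin

lemma sets\<Omega> [simp]: "\<Omega> \<in> sets lebesgue"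
  using open\<Omega> by (simp add: borel_open sets_completionI_sets)

lemma finite_lebesgue_on: "finite_measure (lebesgue_on \<Omega>)"
proof
  have "emeasure lebesgue \<Omega> < \<infinity>"
    using emeasure_bounded_finite[OF bounded\<Omega>] open\<Omega> by simp
  then show "emeasure (lebesgue_on \<Omega>) (space (lebesgue_on \<Omega>)) \<noteq> \<infinity>"
    by (simp add: emeasure_restrict_space space_restrict_space)
qed

lemmas sq_imp_int = square_integrable_imp_integrable[OF finite_lebesgue_on]

lemma measurable_lebesgue_on_continuous:
  assumes "continuous_on UNIV (f :: real^'n \<Rightarrow> real)"
  shows "f \<in> borel_measurable (lebesgue_on \<Omega>)"
  using borel_measurable_continuous_onI[OF assms] by (intro measurable_restrict_space1 measurable_completion) simp

lemma continuous_bounded: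
  assumes "continuous_on UNIV (f :: real^'n \<Rightarrow> real)"
  obtains B where "\<And>x. x \<in> \<Omega> \<Longrightarrow> \<bar>f x\<bar> \<le> B"
proof -
  have "compact (f ` closure \<Omega>)"
    using bounded\<Omega> by (intro compact_continuous_image continuous_on_subset[OF assms]) auto
  then show thesis
    using that closure_subset by (force dest!: compact_imp_bounded simp: bounded_iff)
qed

lemma square_integrable_continuous:
  assumes "continuous_on UNIV (f :: real^'n \<Rightarrow> real)"
  shows "square_integrable (lebesgue_on \<Omega>) f"
proof -
  interpret finite_measure "lebesgue_on \<Omega>" by (rule finite_lebesgue_on)
  have "continuous_on UNIV (\<lambda>x. (f x)\<^sup>2)"
    using assms by (intro continuous_intros)
  then obtain B where "\<And>x. x \<in> \<Omega> \<Longrightarrow> \<bar>(f x)\<^sup>2\<bar> \<le> B"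
    using continuous_bounded by metis
  then have "integrable (lebesgue_on \<Omega>) (\<lambda>x. (f x)\<^sup>2)"
    using measurable_lebesgue_on_continuous[OF assms]
    by (intro integrable_const_bound[where B = B] AE_I2) (auto simp: space_restrict_space)
  then show ?thesis
    using measurable_lebesgue_on_continuous[OF assms] by (simp add: square_integrable_def)
qed

lemma integrable_mult_continuous:
  assumes f: "square_integrable (lebesgue_on \<Omega>) f" and h: "continuous_on UNIV (h :: real^'n \<Rightarrow> real)"
  shows "integrable (lebesgue_on \<Omega>) (\<lambda>x. f x * h x)"
proof -
  obtain B where B: "\<And>x. x \<in> \<Omega> \<Longrightarrow> \<bar>h x\<bar> \<le> B"
    using continuous_bounded[OF h] by metis
  have "integrable (lebesgue_on \<Omega>) (\<lambda>x. f x * B)"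
    using sq_imp_int[OF f] by simp
  then show ?thesis
  proof (rule Bochner_Integration.integrable_bound)
    show "(\<lambda>x. f x * h x) \<in> borel_measurable (lebesgue_on \<Omega>)"
      using f measurable_lebesgue_on_continuous[OF h] by (auto simp: square_integrable_def)
    show "AE x in lebesgue_on \<Omega>. norm (f x * h x) \<le> norm (f x * B)"
      using B by (intro AE_I2) (auto simp: space_restrict_space abs_mult intro!: mult_left_mono order_trans[OF B])
  qed
qed

text \<open>Convolutions and Tonelli on the product need Borel functions on the whole space, whereas members of
  \<open>L\<^sup>2\<close> of an open set are only Lebesgue measurable there.\<close>

lemma borel_extension:
  assumes "square_integrable (lebesgue_on \<Omega>) w"
  obtains w' where "w' \<in> borel_measurable borel" "\<And>x. x \<notin> \<Omega> \<Longrightarrow> w' x = 0"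
    "AE x in lebesgue_on \<Omega>. w' x = w x" "integrable lborel w'" "integrable lborel (\<lambda>x. (w' x)\<^sup>2)"
proof -
  have "(\<lambda>x. indicator \<Omega> x *\<^sub>R w x) \<in> borel_measurable lebesgue"
    using assms borel_measurable_restrict_space_iff[of \<Omega> lebesgue w] by (simp add: square_integrable_def)
  then obtain w'' where w'': "w'' \<in> borel_measurable borel"
    and eq: "AE x in lborel. indicator \<Omega> x *\<^sub>R w x = w'' x"
    using completion_ex_borel_measurable_real[of "\<lambda>x. indicator \<Omega> x *\<^sub>R w x" lborel] by auto
  define w' where "w' x = indicator \<Omega> x *\<^sub>R w'' x" for x
  have w'_meas: "w' \<in> borel_measurable borel"
    using w'' open\<Omega> unfolding w'_def by (intro borel_measurable_scaleR borel_measurable_indicator) auto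
  have out: "x \<notin> \<Omega> \<Longrightarrow> w' x = 0" for x by (simp add: w'_def)
  have AE': "AE x in lebesgue. indicator \<Omega> x *\<^sub>R w x = w'' x"
    using eq by (rule AE_completion)
  then have AE: "AE x in lebesgue_on \<Omega>. w' x = w x"
    by (subst AE_restrict_space_iff) (auto simp: w'_def elim!: eventually_mono)
  have I: "integrable lborel h"
    if "h \<in> borel_measurable borel" "\<And>x. x \<notin> \<Omega> \<Longrightarrow> h x = 0" "integrable (lebesgue_on \<Omega>) h" for h :: "real^'n \<Rightarrow> real"
  proof -
    have "integrable lebesgue (\<lambda>x. indicator \<Omega> x *\<^sub>R h x)"
      using that(3) by (subst (asm) integrable_restrict_space) auto
    moreover have "(\<lambda>x. indicator \<Omega> x *\<^sub>R h x) = h"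
      using that(2) by (auto simp: indicator_def fun_eq_iff)
    ultimately show ?thesis
      using that(1) by (simp add: integrable_completion)
  qed
  have w'm2: "w' \<in> borel_measurable (lebesgue_on \<Omega>)"
    using w'_meas by (intro measurable_restrict_space1 measurable_completion) simp
  have "integrable (lebesgue_on \<Omega>) w'"
    using sq_imp_int[OF assms] AE w'm2
    by (subst integrable_cong_AE[of _ _ w]) auto
  then have "integrable lborel w'"
    using w'_meas out by (intro I) auto
  moreover have "integrable (lebesgue_on \<Omega>) (\<lambda>x. (w' x)\<^sup>2)"
    using assms AE w'm2
    by (subst integrable_cong_AE[of _ _ "\<lambda>x. (w x)\<^sup>2"]) (auto simp: square_integrable_def)
  then have "integrable lborel (\<lambda>x. (w' x)\<^sup>2)"
    using w'_meas out by (intro I) auto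
  ultimately show thesis
    using that w'_meas out AE by blast
qed

lemma integral_extension:
  assumes "w' \<in> borel_measurable borel" "\<And>x. x \<notin> \<Omega> \<Longrightarrow> w' x = 0"
    "AE x in lebesgue_on \<Omega>. w' x = w x" "w \<in> borel_measurable (lebesgue_on \<Omega>)"
    and h: "continuous_on UNIV (h :: real^'n \<Rightarrow> real)"
  shows "(\<integral>x. w x * h x \<partial>lebesgue_on \<Omega>) = (\<integral>x. h x * w' x \<partial>lborel)"
proof -
  have [measurable]: "w' \<in> borel_measurable (lebesgue_on \<Omega>)"
    using assms(1) by (intro measurable_restrict_space1 measurable_completion) simp
  have "(\<integral>x. w x * h x \<partial>lebesgue_on \<Omega>) = (\<integral>x. h x * w' x \<partial>lebesgue_on \<Omega>)"
    using assms(3,4) measurable_lebesgue_on_continuous[OF h]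
    by (intro integral_cong_AE) (auto elim!: eventually_mono)
  also have "\<dots> = (\<integral>x. h x * w' x \<partial>lborel)"
    using assms(1,2) borel_measurable_continuous_onI[OF h] by (intro integral_lebesgue_on_eq_lborel) auto
  finally show ?thesis .
qed

text \<open>The convolution of the extension of \<open>w\<close> by zero with a mollifier of small support is a test integral at points away from the
  boundary, hence zero there. As mollifications converge in the mean square, \<open>w\<close> vanishes almost
  everywhere on the sets \<open>S m\<close> of points at distance more than \<open>1 / (m + 1)\<close> from the complement.\<close>

lemma fundamental_lemma:
  assumes w: "square_integrable (lebesgue_on \<Omega>) w"
    and 0: "\<And>\<phi>. test_function \<Omega> \<phi> \<Longrightarrow> (\<integral>x. w x * \<phi> x \<partial>lebesgue_on \<Omega>) = 0"
  shows "AE x in lebesgue_on \<Omega>. w x = 0"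
proof -
  from borel_extension[OF w] obtain w' where
    w': "w' \<in> borel_measurable borel" "\<And>x. x \<notin> \<Omega> \<Longrightarrow> w' x = 0"
    "AE x in lebesgue_on \<Omega>. w' x = w x" "integrable lborel w'" "integrable lborel (\<lambda>x. (w' x)\<^sup>2)"
    by blast
  note [measurable] = w'(1)
  have "- \<Omega> \<noteq> {}"
    using bounded\<Omega> by (metis Compl_UNIV_eq double_complement not_bounded_UNIV)
  define S where "S m = {x \<in> \<Omega>. infdist x (- \<Omega>) > 1 / real (Suc m)}" for m
  have open_S: "open (S m)" for m
  proof -
    have "S m = \<Omega> \<inter> {x. infdist x (- \<Omega>) > 1 / real (Suc m)}"
      by (auto simp: S_def)
    then show ?thesis
      using open\<Omega> by (auto intro!: open_Int open_Collect_less continuous_intros)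
  qed
  have S_cover: "\<Omega> \<subseteq> (\<Union>m. S m)"
  proof
    fix x assume x: "x \<in> \<Omega>"
    then have "infdist x (- \<Omega>) > 0"
      using \<open>- \<Omega> \<noteq> {}\<close> open\<Omega> by (intro infdist_pos_not_in_closed) auto
    then obtain m where "inverse (real (Suc m)) < infdist x (- \<Omega>)"
      using reals_Archimedean by blast
    then show "x \<in> (\<Union>m. S m)"
      using x by (auto simp: S_def inverse_eq_divide)
  qed
  have zero: "(\<integral>\<^sup>+x. ennreal ((w' x)\<^sup>2) * indicator (S m) x \<partial>lborel) = 0" for m
  proof -
    have "(\<integral>\<^sup>+x. ennreal ((w' x)\<^sup>2) * indicator (S m) x \<partial>lborel) \<le> 0 + ennreal e" if e: "e > 0" for e
    proof -
      obtain \<delta> where \<delta>: "\<delta> > 0" "\<And>\<rho>. mollifier \<delta> \<rho> \<Longrightarrow>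
          (\<integral>\<^sup>+x. ennreal ((conv \<rho> w' x - w' x)\<^sup>2) \<partial>lborel) \<le> ennreal e"
        using L2_convergence_conv[OF w'(4,5) e] by blast
      define d where "d = min \<delta> (1 / real (Suc m))"
      have "d > 0" using \<delta>(1) by (simp add: d_def)
      then obtain \<rho> :: "real^'n \<Rightarrow> real" where \<rho>: "mollifier d \<rho>"
        using ex_mollifier by blast
      have conv0: "conv \<rho> w' x = 0" if x: "x \<in> S m" for x
      proof -
        have "cball x d \<subseteq> \<Omega>"
        proof
          fix y assume y: "y \<in> cball x d"
          show "y \<in> \<Omega>"
          proof (rule ccontr)
            assume "y \<notin> \<Omega>"
            then have "infdist x (- \<Omega>) \<le> dist x y" by (intro infdist_le) auto
            then show False using x y by (auto simp: S_def d_def)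
          qed
        qed
        then have "test_function \<Omega> (\<lambda>y. \<rho> (x - y))"
          using \<rho> by (rule test_function_mollifier_shift[rotated])
        from 0[OF this] show ?thesis
          using integral_extension[OF w'(1,2,3) _ C_1_continuous(1)[OF test_function_C_1[OF \<open>test_function \<Omega> (\<lambda>y. \<rho> (x - y))\<close>]]] w
          by (simp add: conv_def square_integrable_def)
      qed
      have "(\<integral>\<^sup>+x. ennreal ((w' x)\<^sup>2) * indicator (S m) x \<partial>lborel)
        \<le> (\<integral>\<^sup>+x. ennreal ((conv \<rho> w' x - w' x)\<^sup>2) \<partial>lborel)"
        by (intro nn_integral_mono) (auto simp: indicator_def conv0)
      also have "\<dots> \<le> ennreal e"
        using \<delta>(2) mollifier_mono[OF \<rho>, of \<delta>] by (simp add: d_def)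
      finally show ?thesis by simp
    qed
    then have "(\<integral>\<^sup>+x. ennreal ((w' x)\<^sup>2) * indicator (S m) x \<partial>lborel) \<le> 0"
      by (rule ennreal_le_epsilon)
    then show ?thesis by simp
  qed
  have "AE x in lborel. \<forall>m. ennreal ((w' x)\<^sup>2) * indicator (S m) x = 0"
    unfolding AE_all_countable
  proof
    fix m
    have "(\<lambda>x. ennreal ((w' x)\<^sup>2) * indicator (S m) x) \<in> borel_measurable lborel"
      using open_S[of m] by simp
    then show "AE x in lborel. ennreal ((w' x)\<^sup>2) * indicator (S m) x = 0"
      using zero[of m] by (simp add: nn_integral_0_iff_AE)
  qed
  then have "AE x in lborel. w' x = 0"
  proof eventually_elim
    case (elim x)
    show ?case
    proof (cases "x \<in> \<Omega>")
      case True
      then obtain m where "x \<in> S m" using S_cover by blast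
      with elim have "ennreal ((w' x)\<^sup>2) = 0"
        by (metis indicator_simps(1) mult.right_neutral)
      then show ?thesis by simp
    qed (use w'(2) in auto)
  qed
  then have "AE x in lebesgue_on \<Omega>. w' x = 0"
    by (subst AE_restrict_space_iff) (auto dest!: AE_completion elim!: eventually_mono)
  with w'(3) show ?thesis by eventually_elim simp
qed

lemma weak_pderiv_unique:
  assumes "square_integrable (lebesgue_on \<Omega>) v1" "is_weak_pderiv \<Omega> i u v1"
    and "square_integrable (lebesgue_on \<Omega>) v2" "is_weak_pderiv \<Omega> i u v2"
  shows "AE x in lebesgue_on \<Omega>. v1 x = v2 x"
proof -
  have "AE x in lebesgue_on \<Omega>. v1 x - v2 x = 0"
  proof (rule fundamental_lemma)
    show "square_integrable (lebesgue_on \<Omega>) (\<lambda>x. v1 x - v2 x)"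
      using assms by (intro square_integrable_diff)
    fix \<phi> assume \<phi>: "test_function \<Omega> \<phi>"
    note c = C_1_continuous(1)[OF test_function_C_1[OF \<phi>]]
    have "(\<integral>x. (v1 x - v2 x) * \<phi> x \<partial>lebesgue_on \<Omega>) =
        (\<integral>x. v1 x * \<phi> x \<partial>lebesgue_on \<Omega>) - (\<integral>x. v2 x * \<phi> x \<partial>lebesgue_on \<Omega>)"
      unfolding left_diff_distrib
      by (intro Bochner_Integration.integral_diff integrable_mult_continuous assms c)
    also have "\<dots> = 0"
      using assms(2,4) \<phi> unfolding is_weak_pderiv_def by force
    finally show "(\<integral>x. (v1 x - v2 x) * \<phi> x \<partial>lebesgue_on \<Omega>) = 0" .
  qed
  then show ?thesis by simp
qed

lemma is_weak_pderiv_diff: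
  assumes p: "C_k 1 p" and u: "square_integrable (lebesgue_on \<Omega>) u"
    and v: "square_integrable (lebesgue_on \<Omega>) v" "is_weak_pderiv \<Omega> i u v"
  shows "is_weak_pderiv \<Omega> i (\<lambda>x. p x - u x) (\<lambda>x. pderiv_at i p x - v x)"
  unfolding is_weak_pderiv_def
proof (intro allI impI)
  fix \<phi> assume \<phi>: "test_function \<Omega> \<phi>"
  note c = C_1_continuous[OF test_function_C_1[OF \<phi>]] 
  note sc = square_integrable_continuous[OF C_1_continuous(1)[OF p]]
    square_integrable_continuous[OF C_1_continuous(2)[OF p, of i]]
  note I1 = integrable_mult_continuous[OF sc(1) c(2)[of i]]
    and I2 = integrable_mult_continuous[OF u c(2)[of i]]
    and I3 = integrable_mult_continuous[OF sc(2) c(1)]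
    and I4 = integrable_mult_continuous[OF v(1) c(1)]
  have "(\<integral>x. (p x - u x) * pderiv_at i \<phi> x \<partial>lebesgue_on \<Omega>) =
      (\<integral>x. p x * pderiv_at i \<phi> x \<partial>lebesgue_on \<Omega>) - (\<integral>x. u x * pderiv_at i \<phi> x \<partial>lebesgue_on \<Omega>)"
    unfolding left_diff_distrib
    using I1 I2 by (rule Bochner_Integration.integral_diff)
  also have "\<dots> = - (\<integral>x. pderiv_at i p x * \<phi> x \<partial>lebesgue_on \<Omega>) - - (\<integral>x. v x * \<phi> x \<partial>lebesgue_on \<Omega>)"
    using is_weak_pderiv_pderiv_at[OF p sets\<Omega>, of i, unfolded is_weak_pderiv_def, rule_format, OF \<phi>]
      v(2)[unfolded is_weak_pderiv_def, rule_format, OF \<phi>] by (simp only:)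
  also have "\<dots> = - (\<integral>x. pderiv_at i p x * \<phi> x - v x * \<phi> x \<partial>lebesgue_on \<Omega>)"
    using Bochner_Integration.integral_diff[OF I3 I4] by linarith
  finally show "(\<integral>x. (p x - u x) * pderiv_at i \<phi> x \<partial>lebesgue_on \<Omega>) =
      - (\<integral>x. (pderiv_at i p x - v x) * \<phi> x \<partial>lebesgue_on \<Omega>)"
    by (simp only: left_diff_distrib)
qed

lemma weak_pderiv_spec:
  assumes "H1 \<Omega> u"
  shows "square_integrable (lebesgue_on \<Omega>) (weak_pderiv \<Omega> i u)" "is_weak_pderiv \<Omega> i u (weak_pderiv \<Omega> i u)"
  using someI_ex[of "\<lambda>v. square_integrable (lebesgue_on \<Omega>) v \<and> is_weak_pderiv \<Omega> i u v"] assms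
  by (auto simp: H1_def weak_pderiv_def)

lemma H1_diff:
  assumes "C_k 1 p" "H1 \<Omega> u"
  shows "H1 \<Omega> (\<lambda>x. p x - u x)"
proof -
  have u: "square_integrable (lebesgue_on \<Omega>) u" using assms(2) by (simp add: H1_def)
  show ?thesis
    unfolding H1_def
  proof (intro conjI allI exI)
    show "square_integrable (lebesgue_on \<Omega>) (\<lambda>x. p x - u x)"
      by (intro square_integrable_diff square_integrable_continuous C_1_continuous assms u)
    show "square_integrable (lebesgue_on \<Omega>) (\<lambda>x. pderiv_at i p x - weak_pderiv \<Omega> i u x)" for i
      by (intro square_integrable_diff square_integrable_continuous C_1_continuous assms weak_pderiv_spec)
    show "is_weak_pderiv \<Omega> i (\<lambda>x. p x - u x) (\<lambda>x. pderiv_at i p x - weak_pderiv \<Omega> i u x)" for i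
      by (intro is_weak_pderiv_diff assms u weak_pderiv_spec)
  qed
qed

text \<open>By uniqueness, any weak derivatives of \<open>u\<close> compute the norm of a difference.\<close>

lemma H1_norm_square:
  assumes p: "C_k 1 p" and u: "H1 \<Omega> u"
    and v: "\<And>i. square_integrable (lebesgue_on \<Omega>) (v i)" "\<And>i. is_weak_pderiv \<Omega> i u (v i)"
  shows "(H1_norm \<Omega> (\<lambda>x. p x - u x))\<^sup>2 = (\<integral>x. (p x - u x)\<^sup>2 \<partial>lebesgue_on \<Omega>) +
    (\<Sum>i\<in>UNIV. \<integral>x. (pderiv_at i p x - v i x)\<^sup>2 \<partial>lebesgue_on \<Omega>)"
proof -
  have u2: "square_integrable (lebesgue_on \<Omega>) u" using u by (simp add: H1_def)
  note spec = weak_pderiv_spec[OF H1_diff[OF p u]]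
  have sq: "square_integrable (lebesgue_on \<Omega>) (\<lambda>x. pderiv_at i p x - v i x)" for i
    by (rule square_integrable_diff[OF square_integrable_continuous[OF C_1_continuous(2)[OF p]] v(1)])
  have "(\<integral>x. (weak_pderiv \<Omega> i (\<lambda>x. p x - u x) x)\<^sup>2 \<partial>lebesgue_on \<Omega>) =
      (\<integral>x. (pderiv_at i p x - v i x)\<^sup>2 \<partial>lebesgue_on \<Omega>)" for i
  proof (rule integral_cong_AE)
    show "AE x in lebesgue_on \<Omega>. (weak_pderiv \<Omega> i (\<lambda>x. p x - u x) x)\<^sup>2 = (pderiv_at i p x - v i x)\<^sup>2"
      using weak_pderiv_unique[OF spec[of i] sq is_weak_pderiv_diff[OF p u2 v, of i]]
      by eventually_elim simp
  qed (use spec(1) sq in \<open>auto simp: square_integrable_def\<close>)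
  then show ?thesis
    unfolding H1_norm_def by (subst real_sqrt_pow2) (auto intro!: add_nonneg_nonneg sum_nonneg)
qed

end

section \<open>Integration over the cell and its faces\<close>

lemma nn_integral_reflect:
  fixes f :: "'a::euclidean_space \<Rightarrow> ennreal"
  assumes "f \<in> borel_measurable borel"
  shows "(\<integral>\<^sup>+x. f (a - x) \<partial>lborel) = (\<integral>\<^sup>+x. f x \<partial>lborel)"
  using assms nn_integral_distr[of "\<lambda>x. a - x" lborel borel f] by (simp add: lborel_distr_reflect)

lemma nn_integral_shift:
  fixes f :: "'a::euclidean_space \<Rightarrow> ennreal"
  assumes "f \<in> borel_measurable borel"
  shows "(\<integral>\<^sup>+x. f (x + a) \<partial>lborel) = (\<integral>\<^sup>+x. f x \<partial>lborel)"
  using assms nn_integral_distr[of "(+) a" lborel borel f] by (simp add: lborel_distr_plus add.commute)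

text \<open>The image of Lebesgue measure under a linear bijection is translation invariant, hence a multiple
  of Lebesgue measure. The proof is the usual one for the uniqueness of such measures: insert the
  indicator of a set \<open>B\<close> of measure one and shift the variables twice. The factor is finite because the
  preimage of \<open>B\<close> is bounded.\<close>

lemma nn_integral_linear_bij:
  fixes T T' :: "'a::euclidean_space \<Rightarrow> 'a"
  assumes T: "linear T" "linear T'" "\<And>x. T (T' x) = x" "\<And>x. T' (T x) = x"
  obtains c :: real where "c \<ge> 0"
    "\<And>F. F \<in> borel_measurable borel \<Longrightarrow> (\<integral>\<^sup>+x. F (T x) \<partial>lborel) = ennreal c * (\<integral>\<^sup>+x. F x \<partial>lborel)"
proof -
  define B :: "'a set" where "B = box 0 One"
  have [measurable]: "B \<in> sets borel" by (simp add: B_def)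
  have B1: "emeasure lborel B = 1"
    by (simp add: B_def emeasure_lborel_box_eq)
  have [measurable]: "T \<in> borel_measurable borel" "T' \<in> borel_measurable borel"
    using T by (auto intro!: borel_measurable_continuous_onI linear_continuous_on linear_conv_bounded_linear[THEN iffD1])
  define C where "C = (\<integral>\<^sup>+x. indicator B (T x) \<partial>lborel)"
  have "C = (\<integral>\<^sup>+x. indicator (T -` B) x \<partial>lborel)"
    by (auto simp: C_def indicator_def intro!: nn_integral_cong)
  also have "\<dots> = emeasure lborel (T -` B)"
    using measurable_sets[of T borel borel B] by (intro nn_integral_indicator) simp
  also have "T -` B = T' ` B"
    using T by (auto simp: image_iff) metis
  also have "emeasure lborel (T' ` B) < \<infinity>"
    by (intro emeasure_bounded_finite bounded_linear_image)
       (auto simp: B_def T linear_conv_bounded_linear[symmetric])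
  finally have C: "C < \<infinity>" .
  have main: "(\<integral>\<^sup>+x. F (T x) \<partial>lborel) = C * (\<integral>\<^sup>+x. F x \<partial>lborel)"
    if [measurable]: "F \<in> borel_measurable borel" for F
  proof -
    have "(\<integral>\<^sup>+x. F (T x) \<partial>lborel) = (\<integral>\<^sup>+y. indicator B y * (\<integral>\<^sup>+x. F (T x) \<partial>lborel) \<partial>lborel)"
      by (simp add: nn_integral_multc B1)
    also have "\<dots> = (\<integral>\<^sup>+y. \<integral>\<^sup>+x. indicator B y * F (T x + y) \<partial>lborel \<partial>lborel)"
    proof (rule nn_integral_cong)
      fix y
      have "(\<integral>\<^sup>+x. F (T x) \<partial>lborel) = (\<integral>\<^sup>+x. F (T (x + T' y)) \<partial>lborel)"
        by (rule nn_integral_shift[symmetric]) measurable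
      also have "\<dots> = (\<integral>\<^sup>+x. F (T x + y) \<partial>lborel)"
        using T by (simp add: linear_add)
      finally show "indicator B y * (\<integral>\<^sup>+x. F (T x) \<partial>lborel) = (\<integral>\<^sup>+x. indicator B y * F (T x + y) \<partial>lborel)"
        by (simp add: nn_integral_cmult)
    qed
    also have "\<dots> = (\<integral>\<^sup>+x. \<integral>\<^sup>+y. indicator B y * F (T x + y) \<partial>lborel \<partial>lborel)"
      by (rule lborel_pair.Fubini') measurable
    also have "\<dots> = (\<integral>\<^sup>+x. \<integral>\<^sup>+y. indicator B (y - T x) * F y \<partial>lborel \<partial>lborel)"
    proof (rule nn_integral_cong)
      fix x
      show "(\<integral>\<^sup>+y. indicator B y * F (T x + y) \<partial>lborel) = (\<integral>\<^sup>+y. indicator B (y - T x) * F y \<partial>lborel)"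
        using nn_integral_shift[of "\<lambda>y. indicator B (y - T x) * F y" "T x"]
        by (simp add: add.commute)
    qed
    also have "\<dots> = (\<integral>\<^sup>+y. \<integral>\<^sup>+x. indicator B (y - T x) * F y \<partial>lborel \<partial>lborel)"
      by (rule lborel_pair.Fubini') measurable
    also have "\<dots> = (\<integral>\<^sup>+y. C * F y \<partial>lborel)"
    proof (rule nn_integral_cong)
      fix y
      have "(\<integral>\<^sup>+x. indicator B (y - T x) \<partial>lborel) = (\<integral>\<^sup>+x. indicator B (T (T' y - x)) \<partial>lborel)"
        using T by (simp add: linear_diff)
      also have "\<dots> = (C :: ennreal)"
        unfolding C_def by (rule nn_integral_reflect) measurable
      finally show "(\<integral>\<^sup>+x. indicator B (y - T x) * F y \<partial>lborel) = C * F y"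
        by (simp add: nn_integral_multc)
    qed
    finally show ?thesis by (simp add: nn_integral_cmult)
  qed
  show thesis
    by (rule that[of "enn2real C"]) (use C main in \<open>auto simp: less_top\<close>)
qed

lemma measurable_vec_lambda:
  "(vec_lambda :: ('n::finite \<Rightarrow> real) \<Rightarrow> _) \<in> borel_measurable (\<Pi>\<^sub>M j\<in>UNIV. lborel)"
  by (subst borel_measurable_euclidean_space) (auto simp: Basis_vec_def inner_axis)

lemma lborel_eq_distr_vec_lambda:
  "(lborel :: (real^'n::finite) measure) = distr (\<Pi>\<^sub>M j\<in>UNIV. lborel) borel vec_lambda"
proof (rule lborel_eqI)
  interpret product_sigma_finite "\<lambda>_::'n. lborel :: real measure" by standard
  fix l u :: "real^'n"
  assume le: "\<And>b. b \<in> Basis \<Longrightarrow> l \<bullet> b \<le> u \<bullet> b"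
  have le': "l $ j \<le> u $ j" for j
    using le[of "axis j 1"] by (simp add: inner_axis)
  have m: "vec_lambda \<in> (\<Pi>\<^sub>M j\<in>UNIV. lborel) \<rightarrow>\<^sub>M (borel :: (real^'n) measure)"
    by (rule measurable_vec_lambda)
  have "vec_lambda -` box l u \<inter> space (\<Pi>\<^sub>M j\<in>(UNIV::'n set). lborel) = (\<Pi>\<^sub>E j\<in>UNIV. {l $ j<..<u $ j})"
    by (auto simp: mem_box_cart space_PiM PiE_iff)
  then have "emeasure (distr (\<Pi>\<^sub>M j\<in>UNIV. lborel) borel vec_lambda) (box l u) =
      emeasure (\<Pi>\<^sub>M j\<in>(UNIV::'n set). lborel) (\<Pi>\<^sub>E j\<in>UNIV. {l $ j<..<u $ j})"
    using m by (simp add: emeasure_distr)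
  also have "\<dots> = (\<Prod>j\<in>UNIV. emeasure lborel {l $ j<..<u $ j})"
    by (rule emeasure_PiM) auto
  also have "\<dots> = ennreal (\<Prod>j\<in>UNIV. u $ j - l $ j)"
    using le' by (simp add: prod_ennreal)
  also have "(\<Prod>j\<in>UNIV. u $ j - l $ j) = (\<Prod>b\<in>Basis. (u - l) \<bullet> b)"
    unfolding Basis_vec_def
    by (subst prod.UNION_disjoint) (auto simp: inner_axis axis_eq_axis)
  finally show "emeasure (distr (\<Pi>\<^sub>M j\<in>UNIV. lborel) borel vec_lambda) (box l u) = ennreal (\<Prod>b\<in>Basis. (u - l) \<bullet> b)" .
qed simp

abbreviation unit_interval :: "real measure" where
  "unit_interval \<equiv> restrict_space lborel {0..1}"

text \<open>Rectangles determine the product measure, but that the two sides have the same measurable sets is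
  not automatic; it follows because the identity is measurable in both directions.\<close>

lemma PiM_unit_interval:
  assumes "finite I"
  shows "(\<Pi>\<^sub>M j\<in>I. unit_interval) = restrict_space (\<Pi>\<^sub>M j\<in>I. lborel) (\<Pi>\<^sub>E j\<in>I. {0..1})"
proof -
  interpret L: product_sigma_finite "\<lambda>_::'a. lborel :: real measure" by standard
  have U: "sigma_finite_measure unit_interval"
    by (rule sigma_finite_measure_restrict_space) (auto intro: sigma_finite_lborel)
  interpret U: product_sigma_finite "\<lambda>_::'a. unit_interval"
    by (simp add: product_sigma_finite_def U)
  have cube: "(\<Pi>\<^sub>E j\<in>I. {0..1}) \<in> sets (\<Pi>\<^sub>M j\<in>I. lborel :: real measure)"
    using assms by (intro sets_PiM_I_finite) auto
  have "restrict_space (\<Pi>\<^sub>M j\<in>I. lborel) (\<Pi>\<^sub>E j\<in>I. {0..1}) = (\<Pi>\<^sub>M j\<in>I. unit_interval)"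
  proof (rule U.PiM_eqI[OF assms])
    have sp: "space (restrict_space (\<Pi>\<^sub>M j\<in>I. lborel) (\<Pi>\<^sub>E j\<in>I. {0..1::real})) = space (\<Pi>\<^sub>M j\<in>I. unit_interval)"
      by (auto simp: space_restrict_space space_PiM)
    have 1: "(\<lambda>s. s) \<in> restrict_space (\<Pi>\<^sub>M j\<in>I. lborel) (\<Pi>\<^sub>E j\<in>I. {0..1}) \<rightarrow>\<^sub>M (\<Pi>\<^sub>M j\<in>I. unit_interval)"
    proof (rule measurable_PiM_single')
      fix j assume j: "j \<in> I"
      show "(\<lambda>s. s j) \<in> restrict_space (\<Pi>\<^sub>M j\<in>I. lborel) (\<Pi>\<^sub>E j\<in>I. {0..1}) \<rightarrow>\<^sub>M unit_interval"
        using j by (intro measurable_restrict_space2 measurable_restrict_space1 measurable_component_singleton)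
          (auto simp: space_restrict_space space_PiM)
    qed (auto simp: space_restrict_space space_PiM)
    have 2: "(\<lambda>s. s) \<in> (\<Pi>\<^sub>M j\<in>I. unit_interval) \<rightarrow>\<^sub>M restrict_space (\<Pi>\<^sub>M j\<in>I. lborel) (\<Pi>\<^sub>E j\<in>I. {0..1})"
    proof (rule measurable_restrict_space2)
      have "(\<lambda>x. x) \<in> unit_interval \<rightarrow>\<^sub>M lborel"
        by (rule measurable_restrict_space1) simp
      then have "(\<lambda>s. s j) \<in> (\<Pi>\<^sub>M j\<in>I. unit_interval) \<rightarrow>\<^sub>M lborel" if "j \<in> I" for j
        by (rule measurable_compose[OF measurable_component_singleton[OF that], of "\<lambda>x. x"])
      then show "(\<lambda>s. s) \<in> (\<Pi>\<^sub>M j\<in>I. unit_interval) \<rightarrow>\<^sub>M (\<Pi>\<^sub>M j\<in>I. lborel)"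
        by (intro measurable_PiM_single') (auto simp: space_PiM)
    qed (auto simp: space_PiM)
    show "sets (restrict_space (\<Pi>\<^sub>M j\<in>I. lborel) (\<Pi>\<^sub>E j\<in>I. {0..1})) = sets (\<Pi>\<^sub>M j\<in>I. unit_interval)"
    proof
      show "sets (restrict_space (\<Pi>\<^sub>M j\<in>I. lborel) (\<Pi>\<^sub>E j\<in>I. {0..1})) \<subseteq> sets (\<Pi>\<^sub>M j\<in>I. unit_interval)"
      proof
        fix A assume A: "A \<in> sets (restrict_space (\<Pi>\<^sub>M j\<in>I. lborel :: real measure) (\<Pi>\<^sub>E j\<in>I. {0..1}))"
        from measurable_sets[OF 2 A] sets.sets_into_space[OF A] show "A \<in> sets (\<Pi>\<^sub>M j\<in>I. unit_interval)"
          by (simp add: sp Int_absorb2)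
      qed
      show "sets (\<Pi>\<^sub>M j\<in>I. unit_interval) \<subseteq> sets (restrict_space (\<Pi>\<^sub>M j\<in>I. lborel) (\<Pi>\<^sub>E j\<in>I. {0..1}))"
      proof
        fix A assume A: "A \<in> sets (\<Pi>\<^sub>M j\<in>I. unit_interval)"
        from measurable_sets[OF 1 A] sets.sets_into_space[OF A]
        show "A \<in> sets (restrict_space (\<Pi>\<^sub>M j\<in>I. lborel) (\<Pi>\<^sub>E j\<in>I. {0..1}))"
          by (simp add: sp Int_absorb2)
      qed
    qed
    fix A :: "'a \<Rightarrow> real set" assume A: "\<And>i. i \<in> I \<Longrightarrow> A i \<in> sets unit_interval"
    then have A': "A i \<in> sets borel" "A i \<subseteq> {0..1}" if "i \<in> I" for i
      using that by (auto simp: sets_restrict_space_iff)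
    then have "emeasure (restrict_space (\<Pi>\<^sub>M j\<in>I. lborel) (\<Pi>\<^sub>E j\<in>I. {0..1})) (Pi\<^sub>E I A) = emeasure (\<Pi>\<^sub>M j\<in>I. lborel) (Pi\<^sub>E I A)"
      using cube by (intro emeasure_restrict_space) (auto simp: space_PiM PiE_Int)
    also have "\<dots> = (\<Prod>i\<in>I. emeasure lborel (A i))"
      using A' assms by (intro L.emeasure_PiM) auto
    also have "\<dots> = (\<Prod>i\<in>I. emeasure unit_interval (A i))"
      using A' by (intro prod.cong) (auto simp: emeasure_restrict_space)
    finally show "emeasure (restrict_space (\<Pi>\<^sub>M j\<in>I. lborel) (\<Pi>\<^sub>E j\<in>I. {0..1})) (Pi\<^sub>E I A) = (\<Prod>i\<in>I. emeasure unit_interval (A i))" .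
  qed
  then show ?thesis by simp
qed

lemma product_sigma_finite_unit_interval: "product_sigma_finite (\<lambda>_. unit_interval)"
  by (simp add: product_sigma_finite_def sigma_finite_measure_restrict_space sigma_finite_lborel)

text \<open>The one-dimensional trace inequality. At the end point \<open>1\<close>, integrate the derivative
  \<open>h\<^sup>2 + 2 y h h'\<close> of \<open>y h\<^sup>2\<close> over the unit interval and use \<open>2 y h h' \<le> h\<^sup>2 + h'\<^sup>2\<close>; at the end point
  \<open>0\<close>, the weight \<open>y - 1\<close> takes the place of \<open>y\<close>.\<close>

lemma endpoint_square_le:
  fixes h h' :: "real \<Rightarrow> real"
  assumes h: "\<And>t. (h has_real_derivative h' t) (at t)" and h': "continuous_on UNIV h'" and t: "t = 0 \<or> t = 1"
  shows "ennreal ((h t)\<^sup>2) \<le> (\<integral>\<^sup>+y. ennreal (2 * (h y)\<^sup>2 + (h' y)\<^sup>2) \<partial>unit_interval)"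
proof -
  define m where "m y = (if t = 0 then y - 1 else y)" for y :: real
  have m: "continuous_on UNIV m" "\<And>y. (m has_real_derivative 1) (at y)"
    using t by (auto simp: m_def[abs_def] intro!: continuous_intros derivative_eq_intros)
  have hc: "continuous_on UNIV h"
    using h by (auto simp: continuous_on_eq_continuous_at intro: DERIV_isCont)
  define d where "d y = (h y)\<^sup>2 + 2 * m y * h y * h' y" for y
  define r where "r y = 2 * (h y)\<^sup>2 + (h' y)\<^sup>2" for y
  have dc: "continuous_on UNIV d" and rc: "continuous_on UNIV r"
    unfolding d_def r_def by (intro continuous_intros hc h' m)+
  have deriv: "((\<lambda>y. m y * (h y)\<^sup>2) has_real_derivative d y) (at y)" for y
  proof -
    have "((\<lambda>y. m y * (h y)\<^sup>2) has_real_derivative 1 * (h y)\<^sup>2 + (2 * h y * h' y) * m y) (at y)"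
      using DERIV_power[OF h, of 2 y] by (intro DERIV_mult m) (simp add: mult_ac)
    then show ?thesis by (simp add: d_def mult_ac)
  qed
  have "(h t)\<^sup>2 = m 1 * (h 1)\<^sup>2 - m 0 * (h 0)\<^sup>2"
    using t by (auto simp: m_def)
  also have "\<dots> = (\<integral>y. indicator {0..1} y *\<^sub>R d y \<partial>lborel)"
    by (rule integral_FTC_Icc[symmetric])
       (simp_all add: continuous_on_subset[OF dc] has_field_derivative_at_within[OF deriv]
          has_real_derivative_iff_has_vector_derivative[symmetric])
  also have "\<dots> \<le> (\<integral>y. indicator {0..1} y *\<^sub>R r y \<partial>lborel)"
  proof (rule integral_mono)
    show "integrable lborel (\<lambda>y. indicator {0..1} y *\<^sub>R d y)" "integrable lborel (\<lambda>y. indicator {0..1} y *\<^sub>R r y)"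
      by (intro borel_integrable_compact continuous_on_subset[OF dc] continuous_on_subset[OF rc]; simp)+
    show "indicator {0..1} y *\<^sub>R d y \<le> indicator {0..1} y *\<^sub>R r y" for y
    proof (cases "y \<in> {0..1}")
      case True
      then have "\<bar>m y\<bar> \<le> 1" by (auto simp: m_def)
      then have "(m y)\<^sup>2 \<le> 1" by (simp add: abs_square_le_1)
      then have "(m y)\<^sup>2 * (h y)\<^sup>2 \<le> 1 * (h y)\<^sup>2" by (intro mult_right_mono) auto
      then have "d y \<le> r y"
        using sum_squares_bound[of "m y * h y" "h' y"]
        unfolding d_def r_def power_mult_distrib by linarith
      then show ?thesis using True by simp
    qed simp
  qed
  finally have "ennreal ((h t)\<^sup>2) \<le> ennreal (\<integral>y. indicator {0..1} y *\<^sub>R r y \<partial>lborel)"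
    by (rule ennreal_leI)
  also have "\<dots> = (\<integral>\<^sup>+y. ennreal (indicator {0..1} y *\<^sub>R r y) \<partial>lborel)"
    by (rule nn_integral_eq_integral[symmetric])
       (intro borel_integrable_compact continuous_on_subset[OF rc] AE_I2; simp add: r_def)+
  also have "\<dots> = (\<integral>\<^sup>+y. ennreal (r y) * indicator {0..1} y \<partial>lborel)"
    by (intro nn_integral_cong) (auto simp: indicator_def)
  also have "\<dots> = (\<integral>\<^sup>+y. ennreal (r y) \<partial>unit_interval)"
    by (subst nn_integral_restrict_space) auto
  finally show ?thesis by (simp add: r_def)
qed

locale lattice_cell =
  fixes g :: "'n::finite \<Rightarrow> real^'n"
  assumes inj_g: "inj g" and indep: "independent (range g)"
begin

text \<open>The coordinates \<open>s\<close> are kept as functions, as in the surface measures; \<open>cell_map\<close> is the same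
  parametrization in terms of vectors, where linearity can be used.\<close>

definition comb :: "('n \<Rightarrow> real) \<Rightarrow> real^'n" where
  "comb s = (\<Sum>j\<in>UNIV. s j *\<^sub>R g j)"

definition cell_map :: "real^'n \<Rightarrow> real^'n" where
  "cell_map x = comb (($) x)"

lemma linear_cell_map: "linear cell_map"
  by (rule linearI) (auto simp: cell_map_def comb_def sum.distrib scaleR_left_distrib scaleR_sum_right)

lemma comb_eq_0: "comb s = 0 \<Longrightarrow> s k = 0"
proof -
  assume 0: "comb s = 0"
  have "(\<Sum>v\<in>range g. s (inv g v) *\<^sub>R v) = 0"
    using 0 inj_g by (subst sum.reindex) (auto simp: comb_def)
  then have "s (inv g (g k)) = 0"
    by (intro independentD[OF indep, of "range g" "\<lambda>v. s (inv g v)"]) auto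
  then show "s k = 0" using inj_g by simp
qed

lemma comb_inj: "comb s = comb t \<Longrightarrow> s = t"
proof
  fix k assume "comb s = comb t"
  then have "comb (\<lambda>j. s j - t j) = 0"
    by (simp add: comb_def scaleR_left_diff_distrib sum_subtractf)
  from comb_eq_0[OF this] show "s k = t k" by simp
qed

lemma inj_cell_map: "inj cell_map"
  by (intro injI) (metis cell_map_def comb_inj vec_nth_inject)

lemma cell_map_vec_lambda: "cell_map (vec_lambda s) = comb s"
  by (simp add: cell_map_def comb_def)

lemma cell_eq: "cell g = cell_map ` cbox 0 1"
proof
  show "cell g \<subseteq> cell_map ` cbox 0 1"
  proof
    fix x assume "x \<in> cell g"
    then obtain s where s: "x = comb s" "\<And>j. s j \<in> {0..1}" by (auto simp: cell_def comb_def)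
    then show "x \<in> cell_map ` cbox 0 1"
      by (intro image_eqI[of _ _ "vec_lambda s"]) (auto simp: cell_map_vec_lambda mem_box_cart)
  qed
  show "cell_map ` cbox 0 1 \<subseteq> cell g"
  proof
    fix y assume "y \<in> cell_map ` cbox 0 1"
    then obtain x where "x \<in> cbox 0 1" "y = cell_map x" by blast
    then show "y \<in> cell g"
      unfolding cell_def cell_map_def comb_def by (auto simp: mem_box_cart intro!: exI[of _ "($) x"])
  qed
qed

lemma compact_cell: "compact (cell g)"
  unfolding cell_eq 
  by (intro compact_continuous_image linear_continuous_on compact_cbox)
     (simp add: linear_cell_map linear_conv_bounded_linear[symmetric])
     
lemma convex_cell: "convex (cell g)"
  unfolding cell_eq by (intro convex_linear_image linear_cell_map convex_box)

sublocale bounded_open "interior (cell g)"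
  by unfold_locales (simp_all add: compact_imp_bounded[OF compact_cell] bounded_interior)

text \<open>The cell is convex, so its frontier is a null set.\<close>

lemma nn_integral_cell:
  assumes "F \<in> borel_measurable borel"
  shows "(\<integral>\<^sup>+x. F x * indicator (cell g) x \<partial>lborel) = (\<integral>\<^sup>+x. F x \<partial>lebesgue_on (interior (cell g)))"
proof -
  have "negligible (frontier (cell g))"
    by (rule negligible_convex_frontier[OF convex_cell])
  then have "AE x in lebesgue. x \<notin> frontier (cell g)"
    by (simp add: negligible_iff_null_sets AE_not_in)
  then have "(\<integral>\<^sup>+x. F x * indicator (cell g) x \<partial>lebesgue) = (\<integral>\<^sup>+x. F x * indicator (interior (cell g)) x \<partial>lebesgue)"
  proof (intro nn_integral_cong_AE, elim eventually_mono)
    fix x assume "x \<notin> frontier (cell g)"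
    then have "x \<in> cell g \<longleftrightarrow> x \<in> interior (cell g)"
      using compact_imp_closed[OF compact_cell] interior_subset[of "cell g"] by (auto simp: frontier_def)
    then show "F x * indicator (cell g) x = F x * indicator (interior (cell g)) x"
      by (simp add: indicator_def)
  qed
  also have "\<dots> = (\<integral>\<^sup>+x. F x \<partial>lebesgue_on (interior (cell g)))"
    by (subst nn_integral_restrict_space) auto
  finally show ?thesis by (simp add: nn_integral_completion)
qed

lemma measurable_unit_interval_component:
  "j \<in> I \<Longrightarrow> (\<lambda>s. s j) \<in> borel_measurable (\<Pi>\<^sub>M j\<in>I. unit_interval)"
proof -
  assume j: "j \<in> I"
  have "(\<lambda>x::real. x) \<in> borel_measurable unit_interval"
    by (intro measurable_restrict_space1) simp
  from measurable_compose[OF measurable_component_singleton[OF j] this] show ?thesis .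
qed

lemma measurable_comb: "comb \<in> borel_measurable (\<Pi>\<^sub>M j\<in>UNIV. unit_interval)"
proof -
  note [measurable] = measurable_unit_interval_component[of _ UNIV]
  show ?thesis unfolding comb_def[abs_def] by simp
qed

lemma nn_integral_comb:
  obtains c :: real where "c \<ge> 0"
    "\<And>F. F \<in> borel_measurable borel \<Longrightarrow>
      (\<integral>\<^sup>+s. F (comb s) \<partial>(\<Pi>\<^sub>M j\<in>UNIV. unit_interval)) = ennreal c * (\<integral>\<^sup>+x. F x \<partial>lebesgue_on (interior (cell g)))"
proof -
  obtain T' where T': "linear T'" "T' \<circ> cell_map = id"
    using linear_injective_left_inverse[OF linear_cell_map inj_cell_map] by blast
  then have T'T: "T' (cell_map x) = x" for x by (metis comp_apply id_apply)
  have TT': "cell_map (T' x) = x" for x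
    using linear_injective_imp_surjective[OF linear_cell_map inj_cell_map] T'T by (metis surjD)
  from nn_integral_linear_bij[OF linear_cell_map T'(1) TT' T'T] obtain c where c: "c \<ge> 0"
    "\<And>F. F \<in> borel_measurable borel \<Longrightarrow> (\<integral>\<^sup>+x. F (cell_map x) \<partial>lborel) = ennreal c * (\<integral>\<^sup>+x. F x \<partial>lborel)"
    by metis
  have cell_meas[measurable]: "cell g \<in> sets borel"
    using compact_cell by (simp add: borel_compact)
  have cell_map_meas[measurable]: "cell_map \<in> borel_measurable borel"
    using linear_cell_map by (intro borel_measurable_continuous_onI linear_continuous_on) (simp add: linear_conv_bounded_linear)
  have main: "(\<integral>\<^sup>+s. F (comb s) \<partial>(\<Pi>\<^sub>M j\<in>UNIV. unit_interval)) = ennreal c * (\<integral>\<^sup>+x. F x \<partial>lebesgue_on (interior (cell g)))"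
    if F[measurable]: "F \<in> borel_measurable borel" for F
  proof -
    have "(\<integral>\<^sup>+s. F (comb s) \<partial>(\<Pi>\<^sub>M j\<in>UNIV. unit_interval)) =
        (\<integral>\<^sup>+s. F (comb s) * indicator (\<Pi>\<^sub>E j\<in>UNIV. {0..1}) s \<partial>(\<Pi>\<^sub>M j\<in>UNIV. lborel))"
      unfolding PiM_unit_interval[OF finite]
      by (subst nn_integral_restrict_space) (auto intro!: sets_PiM_I_finite simp: space_PiM)
    also have "\<dots> = (\<integral>\<^sup>+s. F (cell_map (vec_lambda s)) * indicator (cell g) (cell_map (vec_lambda s)) \<partial>(\<Pi>\<^sub>M j\<in>UNIV. lborel))"
    proof (rule nn_integral_cong)
      fix s :: "'n \<Rightarrow> real"
      note cell_map_vec_lambda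
      moreover have "cell_map (vec_lambda s) \<in> cell g \<longleftrightarrow> vec_lambda s \<in> cbox 0 1"
        unfolding cell_eq using inj_cell_map by (simp add: inj_image_mem_iff)
      ultimately show "F (comb s) * indicator (\<Pi>\<^sub>E j\<in>UNIV. {0..1}) s = F (cell_map (vec_lambda s)) * indicator (cell g) (cell_map (vec_lambda s))"
        by (auto simp: indicator_def mem_box_cart)
    qed
    also have "\<dots> = (\<integral>\<^sup>+x. F (cell_map x) * indicator (cell g) (cell_map x) \<partial>lborel)"
      unfolding lborel_eq_distr_vec_lambda
      by (subst nn_integral_distr) (auto intro!: measurable_vec_lambda)
    also have "\<dots> = ennreal c * (\<integral>\<^sup>+x. F x * indicator (cell g) x \<partial>lborel)"
      by (rule c(2)) measurable
    also have "\<dots> = ennreal c * (\<integral>\<^sup>+x. F x \<partial>lebesgue_on (interior (cell g)))"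
      by (simp add: nn_integral_cell)
    finally show ?thesis .
  qed
  show thesis by (rule that[OF c(1) main])
qed

end

section \<open>The trace inequality\<close>

lemma nn_integral_face_measure:
  fixes F :: "real^'n::finite \<Rightarrow> ennreal"
  assumes "F \<in> borel_measurable borel"
  shows "(\<integral>\<^sup>+x. F x \<partial>face_measure g k a) = ennreal (face_area g k) *
    (\<integral>\<^sup>+s. F (a + (\<Sum>j\<in>UNIV - {k}. s j *\<^sub>R g j)) \<partial>(\<Pi>\<^sub>M j\<in>UNIV - {k}. unit_interval))"
  unfolding face_measure_def using assms
  by (subst nn_integral_scale_measure, simp)
     (subst nn_integral_distr, rule measurable_face_param, simp_all)

lemma nn_integral_boundary_measure:
  fixes F :: "real^'n::finite \<Rightarrow> ennreal"
  assumes "F \<in> borel_measurable borel"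
  shows "(\<integral>\<^sup>+x. F x \<partial>boundary_measure g) =
    (\<Sum>k\<in>UNIV. (\<integral>\<^sup>+x. F x \<partial>face_measure g k 0) + (\<integral>\<^sup>+x. F x \<partial>face_measure g k (g k)))"
  using assms
proof (induction rule: borel_measurable_induct)
  case (cong f h)
  then show ?case by (simp cong: nn_integral_cong)
next
  case (set A)
  then show ?case by (simp add: emeasure_boundary_measure)
next
  case (mult u c)
  then have "u \<in> borel_measurable M" if "sets M = sets borel" for M
    using that by (simp cong: measurable_cong_sets)
  then have "(\<integral>\<^sup>+x. c * u x \<partial>M) = c * (\<integral>\<^sup>+x. u x \<partial>M)" if "sets M = sets borel" for M
    using that by (intro nn_integral_cmult) simp
  then show ?case
    by (simp add: mult.IH sum_distrib_left distrib_left)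
next
  case (add u v)
  then have "u \<in> borel_measurable M" "v \<in> borel_measurable M" if "sets M = sets borel" for M
    using that by (simp_all cong: measurable_cong_sets)
  then have "(\<integral>\<^sup>+x. v x + u x \<partial>M) = (\<integral>\<^sup>+x. v x \<partial>M) + (\<integral>\<^sup>+x. u x \<partial>M)" if "sets M = sets borel" for M
    using that by (intro nn_integral_add) simp_all
  then show ?case
    by (simp add: add.IH sum.distrib ac_simps)
next
  case (seq U)
  then have [measurable]: "U i \<in> borel_measurable borel" for i by simp
  have lim: "(\<lambda>i. \<integral>\<^sup>+x. U i x \<partial>M) \<longlonglongrightarrow> (\<integral>\<^sup>+x. (SUP i. U i) x \<partial>M)" if "sets M = sets borel" for M
  proof -
    have "incseq (\<lambda>i. \<integral>\<^sup>+x. U i x \<partial>M)"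
      using seq.hyps(3) by (auto intro!: incseq_SucI nn_integral_mono simp: incseq_Suc_iff le_fun_def)
    then have "(\<lambda>i. \<integral>\<^sup>+x. U i x \<partial>M) \<longlonglongrightarrow> (SUP i. \<integral>\<^sup>+x. U i x \<partial>M)"
      by (rule LIMSEQ_SUP)
    also have "(SUP i. \<integral>\<^sup>+x. U i x \<partial>M) = (\<integral>\<^sup>+x. (SUP i. U i x) \<partial>M)"
      using seq.hyps(3) that by (intro nn_integral_monotone_convergence_SUP[symmetric]) (auto simp: measurable_cong_sets[OF that refl])
    finally show ?thesis by (simp add: image_image)
  qed
  have "(\<lambda>i. \<integral>\<^sup>+x. U i x \<partial>boundary_measure g) \<longlonglongrightarrow>
    (\<Sum>k\<in>UNIV. (\<integral>\<^sup>+x. (SUP i. U i) x \<partial>face_measure g k 0) + (\<integral>\<^sup>+x. (SUP i. U i) x \<partial>face_measure g k (g k)))"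
    unfolding seq.IH by (intro tendsto_sum tendsto_add lim sets_face_measure)
  with lim[OF sets_boundary_measure] show ?case
    by (rule LIMSEQ_unique)
qed

context lattice_cell
begin

lemma comb_update: "comb (s(k := y)) = (\<Sum>j\<in>UNIV - {k}. s j *\<^sub>R g j) + y *\<^sub>R g k"
  unfolding comb_def by (subst sum.remove[of UNIV k]) (auto intro!: sum.cong simp: add.commute)

text \<open>The one-dimensional inequality on the segments in direction \<open>g k\<close>, integrated over the remaining
  coordinates. The sum on the right is the derivative of \<open>p\<close> in direction \<open>g k\<close>.\<close>

lemma nn_integral_face_le:
  assumes p: "C_k 1 p" and t: "t = 0 \<or> t = 1"
  shows "(\<integral>\<^sup>+s. ennreal ((p (t *\<^sub>R g k + (\<Sum>j\<in>UNIV - {k}. s j *\<^sub>R g j)))\<^sup>2) \<partial>(\<Pi>\<^sub>M j\<in>UNIV - {k}. unit_interval))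
    \<le> (\<integral>\<^sup>+s. ennreal (2 * (p (comb s))\<^sup>2 + (\<Sum>i\<in>UNIV. g k $ i * pderiv_at i p (comb s))\<^sup>2) \<partial>(\<Pi>\<^sub>M j\<in>UNIV. unit_interval))"
    (is "_ \<le> (\<integral>\<^sup>+s. ?F s \<partial>_)")
proof -
  interpret product_sigma_finite "\<lambda>_::'n. unit_interval"
    by (rule product_sigma_finite_unit_interval)
  have ins: "insert k (UNIV - {k}) = (UNIV :: 'n set)" by auto
  have "continuous_on UNIV (\<lambda>x. 2 * (p x)\<^sup>2 + (\<Sum>i\<in>UNIV. g k $ i * pderiv_at i p x)\<^sup>2)"
    by (intro continuous_intros C_1_continuous[OF p])
  then have F: "?F \<in> borel_measurable (\<Pi>\<^sub>M j\<in>UNIV. unit_interval)"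
    using measurable_compose[OF measurable_comb borel_measurable_continuous_onI] by measurable
  have "(\<integral>\<^sup>+s. ?F s \<partial>(\<Pi>\<^sub>M j\<in>UNIV. unit_interval)) =
      (\<integral>\<^sup>+s. \<integral>\<^sup>+y. ?F (s(k := y)) \<partial>unit_interval \<partial>(\<Pi>\<^sub>M j\<in>UNIV - {k}. unit_interval))"
    using product_nn_integral_insert[of "UNIV - {k}" k ?F] F by (simp add: ins)
  moreover have "ennreal ((p (t *\<^sub>R g k + b))\<^sup>2) \<le>
      (\<integral>\<^sup>+y. ennreal (2 * (p (b + y *\<^sub>R g k))\<^sup>2 + (\<Sum>i\<in>UNIV. g k $ i * pderiv_at i p (b + y *\<^sub>R g k))\<^sup>2) \<partial>unit_interval)" for b
  proof -
    have D: "((\<lambda>y. p (b + y *\<^sub>R g k)) has_real_derivative (\<Sum>i\<in>UNIV. g k $ i * pderiv_at i p (b + y *\<^sub>R g k))) (at y)" for y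
    proof -
      have "((\<lambda>y. b + y *\<^sub>R g k) has_derivative (\<lambda>s. s *\<^sub>R g k)) (at y)"
        by (auto intro!: derivative_eq_intros)
      moreover have "(p has_derivative (\<lambda>v. \<Sum>i\<in>UNIV. v $ i * pderiv_at i p (b + y *\<^sub>R g k))) (at (b + y *\<^sub>R g k))"
        using p by (intro has_derivative_pderiv_at) simp
      ultimately have "((\<lambda>y. p (b + y *\<^sub>R g k)) has_derivative
          (\<lambda>s. \<Sum>i\<in>UNIV. (s *\<^sub>R g k) $ i * pderiv_at i p (b + y *\<^sub>R g k))) (at y)"
        by (rule has_derivative_compose)
      then show ?thesis
        unfolding has_field_derivative_def
        by (rule has_derivative_eq_rhs) (auto simp: fun_eq_iff sum_distrib_left mult_ac)
    qed
    have "continuous_on UNIV (\<lambda>y::real. b + y *\<^sub>R g k)"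
      by (intro continuous_intros)
    then have "continuous_on UNIV (\<lambda>y. \<Sum>i\<in>UNIV. g k $ i * pderiv_at i p (b + y *\<^sub>R g k))"
      by (intro continuous_intros continuous_on_compose2[OF C_1_continuous(2)[OF p]]) auto
    from endpoint_square_le[OF D this t] show ?thesis
      by (simp add: add.commute)
  qed
  ultimately show ?thesis
    by (simp add: comb_update nn_integral_mono)
qed

text \<open>By the Cauchy-Schwarz inequality the directional derivative along \<open>g k\<close> is bounded by the full
  gradient; summing over the faces gives the constant.\<close>

theorem trace_inequality:
  obtains C :: real where "C \<ge> 0"
    "\<And>p. C_k 1 p \<Longrightarrow> (\<integral>\<^sup>+x. ennreal ((p x)\<^sup>2) \<partial>boundary_measure g) \<le>
      ennreal C * (\<integral>\<^sup>+x. ennreal ((p x)\<^sup>2 + (\<Sum>i\<in>UNIV. (pderiv_at i p x)\<^sup>2)) \<partial>lebesgue_on (interior (cell g)))"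
proof -
  obtain c :: real where c: "c \<ge> 0"
    "\<And>F. F \<in> borel_measurable borel \<Longrightarrow>
      (\<integral>\<^sup>+s. F (comb s) \<partial>(\<Pi>\<^sub>M j\<in>UNIV. unit_interval)) = ennreal c * (\<integral>\<^sup>+x. F x \<partial>lebesgue_on (interior (cell g)))"
    using nn_integral_comb by blast
  define K where "K k = 2 + (norm (g k))\<^sup>2" for k
  define C where "C = (\<Sum>k\<in>UNIV. 2 * (ennreal (face_area g k) * (ennreal c * ennreal (K k))))"
  have C: "C < \<infinity>"
    by (simp add: C_def ennreal_mult_less_top)
  have main: "(\<integral>\<^sup>+x. ennreal ((p x)\<^sup>2) \<partial>boundary_measure g) \<le>
      C * (\<integral>\<^sup>+x. ennreal ((p x)\<^sup>2 + (\<Sum>i\<in>UNIV. (pderiv_at i p x)\<^sup>2)) \<partial>lebesgue_on (interior (cell g)))"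
    if p: "C_k 1 p" for p
  proof -
    define E where "E x = (p x)\<^sup>2 + (\<Sum>i\<in>UNIV. (pderiv_at i p x)\<^sup>2)" for x
    have "continuous_on UNIV E"
      unfolding E_def by (intro continuous_intros C_1_continuous[OF p])
    then have E[measurable]: "E \<in> borel_measurable borel"
      by (rule borel_measurable_continuous_onI)
    have p_meas[measurable]: "p \<in> borel_measurable borel"
      by (rule borel_measurable_continuous_onI[OF C_1_continuous(1)[OF p]])
    have E0: "E x \<ge> 0" for x by (simp add: E_def sum_nonneg)
    have K0: "K k \<ge> 0" for k by (simp add: K_def)
    have bound: "2 * (p x)\<^sup>2 + (\<Sum>i\<in>UNIV. g k $ i * pderiv_at i p x)\<^sup>2 \<le> K k * E x" for k x
    proof -
      have eq: "(\<Sum>i\<in>UNIV. g k $ i * pderiv_at i p x) = g k \<bullet> (\<chi> i. pderiv_at i p x)"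
        by (simp add: inner_vec_def)
      have "(\<Sum>i\<in>UNIV. g k $ i * pderiv_at i p x)\<^sup>2 \<le> (norm (g k))\<^sup>2 * (\<Sum>i\<in>UNIV. (pderiv_at i p x)\<^sup>2)"
      proof -
        have "(\<Sum>i\<in>UNIV. (pderiv_at i p x)\<^sup>2) = (\<chi> i. pderiv_at i p x) \<bullet> (\<chi> i. pderiv_at i p x)"
          by (simp add: inner_vec_def power2_eq_square)
        then show ?thesis
          using Cauchy_Schwarz_ineq[of "g k" "\<chi> i. pderiv_at i p x"] unfolding eq by (simp only: power2_norm_eq_inner)
      qed
      moreover have "(norm (g k))\<^sup>2 * (p x)\<^sup>2 \<ge> 0" "(\<Sum>i\<in>UNIV. (pderiv_at i p x)\<^sup>2) \<ge> 0"
        by (simp_all add: sum_nonneg)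
      ultimately show ?thesis
        unfolding K_def E_def distrib_left distrib_right by linarith
    qed
    have face: "(\<integral>\<^sup>+x. ennreal ((p x)\<^sup>2) \<partial>face_measure g k (t *\<^sub>R g k)) \<le>
        ennreal (face_area g k) * (ennreal c * ennreal (K k)) * (\<integral>\<^sup>+x. ennreal (E x) \<partial>lebesgue_on (interior (cell g)))"
      if t: "t = 0 \<or> t = 1" for k t
    proof -
      have "(\<integral>\<^sup>+s. ennreal ((p (t *\<^sub>R g k + (\<Sum>j\<in>UNIV - {k}. s j *\<^sub>R g j)))\<^sup>2) \<partial>(\<Pi>\<^sub>M j\<in>UNIV - {k}. unit_interval))
        \<le> (\<integral>\<^sup>+s. ennreal (K k * E (comb s)) \<partial>(\<Pi>\<^sub>M j\<in>UNIV. unit_interval))"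
        by (rule order_trans[OF nn_integral_face_le[OF p t]]) (intro nn_integral_mono ennreal_leI bound)
      also have "\<dots> = ennreal c * (\<integral>\<^sup>+x. ennreal (K k * E x) \<partial>lebesgue_on (interior (cell g)))"
        by (rule c(2)) measurable
      also have "(\<integral>\<^sup>+x. ennreal (K k * E x) \<partial>lebesgue_on (interior (cell g))) =
          ennreal (K k) * (\<integral>\<^sup>+x. ennreal (E x) \<partial>lebesgue_on (interior (cell g)))"
      proof -
        have "E \<in> borel_measurable (lebesgue_on (interior (cell g)))"
          using E by (intro measurable_restrict_space1 measurable_completion) simp
        then show ?thesis
          using E0 K0 by (simp add: ennreal_mult nn_integral_cmult)
      qed
      finally show ?thesis
        by (subst nn_integral_face_measure) (auto simp: mult.assoc intro!: mult_left_mono)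
    qed
    have "(\<integral>\<^sup>+x. ennreal ((p x)\<^sup>2) \<partial>boundary_measure g) =
      (\<Sum>k\<in>UNIV. (\<integral>\<^sup>+x. ennreal ((p x)\<^sup>2) \<partial>face_measure g k 0) + (\<integral>\<^sup>+x. ennreal ((p x)\<^sup>2) \<partial>face_measure g k (g k)))"
      by (rule nn_integral_boundary_measure) measurable
    also have "\<dots> \<le> (\<Sum>k\<in>UNIV. 2 * (ennreal (face_area g k) * (ennreal c * ennreal (K k))) * (\<integral>\<^sup>+x. ennreal (E x) \<partial>lebesgue_on (interior (cell g))))"
    proof (rule sum_mono)
      fix k
      show "(\<integral>\<^sup>+x. ennreal ((p x)\<^sup>2) \<partial>face_measure g k 0) + (\<integral>\<^sup>+x. ennreal ((p x)\<^sup>2) \<partial>face_measure g k (g k))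
        \<le> 2 * (ennreal (face_area g k) * (ennreal c * ennreal (K k))) * (\<integral>\<^sup>+x. ennreal (E x) \<partial>lebesgue_on (interior (cell g)))"
        using add_mono[OF face[of 0 k] face[of 1 k]] by (simp add: mult_2 distrib_right)
    qed
    also have "\<dots> = C * (\<integral>\<^sup>+x. ennreal (E x) \<partial>lebesgue_on (interior (cell g)))"
      by (simp add: C_def sum_distrib_right)
    finally show ?thesis by (simp add: E_def)
  qed
  show thesis
    by (rule that[of "enn2real C"]) (use C main in \<open>auto simp: less_top\<close>)
qed

lemma emeasure_face_measure_upper:
  assumes "N \<in> sets borel"
  shows "emeasure (face_measure g k (g k)) N = emeasure (face_measure g k 0) ((\<lambda>x. x + g k) -` N)"
proof -
  have N': "(\<lambda>x. x + g k) -` N \<in> sets borel"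
    using measurable_sets_borel[of "\<lambda>x. x + g k" borel N] assms by simp
  have "emeasure (face_measure g k (g k)) N = (\<integral>\<^sup>+x. indicator N x \<partial>face_measure g k (g k))"
    using assms by simp
  also have "\<dots> = (\<integral>\<^sup>+x. indicator ((\<lambda>x. x + g k) -` N) x \<partial>face_measure g k 0)"
    using assms N'
    by (simp add: nn_integral_face_measure del: nn_integral_indicator)
       (simp add: indicator_def add.commute)
  finally show ?thesis using N' by simp
qed

text \<open>A face other than \<open>lower_face g k\<close> meets it only where the coordinate \<open>k\<close>
  vanishes: a null set of that face, and empty for the face opposite to \<open>lower_face g k\<close>, where this
  coordinate is \<open>1\<close>. The point is that an exceptional set inside one face need not be checked against
  the other faces.\<close>

lemma emeasure_face_measure_lower_face:
  assumes "N \<in> sets borel" "N \<subseteq> lower_face g k" and a: "j \<noteq> k \<and> (a = 0 \<or> a = g j) \<or> j = k \<and> a = g k"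
  shows "emeasure (face_measure g j a) N = 0"
proof -
  interpret product_sigma_finite "\<lambda>_::'n. unit_interval"
    by (rule product_sigma_finite_unit_interval)
  obtain t where t: "a = t *\<^sub>R g j" "t = 0 \<or> t = 1" "j = k \<longrightarrow> t = 1"
    using a by (metis scaleR_one scaleR_zero_left)
  \<comment> \<open>The parameters on face \<open>j\<close> with coordinate \<open>k\<close> equal to zero.\<close>
  define Z where "Z = (\<Pi>\<^sub>E i\<in>UNIV - {j}. if i = k then {0} else {0..1::real})"
  have coord: "(s(j := t)) k = 0" if low: "a + (\<Sum>i\<in>UNIV - {j}. s i *\<^sub>R g i) \<in> lower_face g k" for s
  proof -
    obtain r where r: "a + (\<Sum>i\<in>UNIV - {j}. s i *\<^sub>R g i) = comb r" "r k = 0"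
      using low unfolding lower_face_def comb_def by blast
    then have "comb (s(j := t)) = comb r"
      by (simp add: comb_update t(1) add.commute)
    from comb_inj[OF this] r(2) show ?thesis by simp
  qed
  have sub: "a + (\<Sum>i\<in>UNIV - {j}. s i *\<^sub>R g i) \<in> N \<Longrightarrow> j \<noteq> k \<and> s \<in> Z" if "s \<in> space (\<Pi>\<^sub>M i\<in>UNIV - {j}. unit_interval)" for s
    using coord[of s] assms(2) t that by (auto simp: Z_def space_PiM space_restrict_space PiE_iff split: if_splits)
  have "emeasure (face_measure g j a) N = (\<integral>\<^sup>+x. indicator N x \<partial>face_measure g j a)"
    using assms by simp
  also have "\<dots> = ennreal (face_area g j) *
      (\<integral>\<^sup>+s. indicator N (a + (\<Sum>i\<in>UNIV - {j}. s i *\<^sub>R g i)) \<partial>(\<Pi>\<^sub>M i\<in>UNIV - {j}. unit_interval))"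
    using assms(1) by (intro nn_integral_face_measure) simp
  also have "(\<integral>\<^sup>+s. indicator N (a + (\<Sum>i\<in>UNIV - {j}. s i *\<^sub>R g i)) \<partial>(\<Pi>\<^sub>M i\<in>UNIV - {j}. unit_interval)) = 0"
  proof (cases "j = k")
    case True
    then have "(\<integral>\<^sup>+s. indicator N (a + (\<Sum>i\<in>UNIV - {j}. s i *\<^sub>R g i)) \<partial>(\<Pi>\<^sub>M i\<in>UNIV - {j}. unit_interval))
      = (\<integral>\<^sup>+s. 0 \<partial>(\<Pi>\<^sub>M i\<in>UNIV - {j}. unit_interval))"
      using sub by (intro nn_integral_cong) (auto simp: indicator_def)
    then show ?thesis by simp
  next
    case False
    have sets: "(if i = k then {0} else {0..1}) \<in> sets unit_interval" for i
      by (auto simp: sets_restrict_space_iff)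
    then have Z: "Z \<in> sets (\<Pi>\<^sub>M i\<in>UNIV - {j}. unit_interval)"
      unfolding Z_def by (intro sets_PiM_I_finite) auto
    have "(\<integral>\<^sup>+s. indicator N (a + (\<Sum>i\<in>UNIV - {j}. s i *\<^sub>R g i)) \<partial>(\<Pi>\<^sub>M i\<in>UNIV - {j}. unit_interval))
      \<le> (\<integral>\<^sup>+s. indicator Z s \<partial>(\<Pi>\<^sub>M i\<in>UNIV - {j}. unit_interval))"
      using sub by (intro nn_integral_mono) (auto simp: indicator_def)
    also have "\<dots> = emeasure (\<Pi>\<^sub>M i\<in>UNIV - {j}. unit_interval) Z"
      using Z by simp
    also have "\<dots> = (\<Prod>i\<in>UNIV - {j}. emeasure unit_interval (if i = k then {0} else {0..1}))"
      unfolding Z_def using sets by (intro emeasure_PiM) auto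
    also have "\<dots> = 0"
      using False by (intro prod_zero) (auto intro!: bexI[of _ k] simp: emeasure_restrict_space)
    finally show ?thesis by simp
  qed
  finally show ?thesis by simp
qed

end

section \<open>Mean-square limits\<close>

text \<open>A finite sum bounds each term, so the increments decay geometrically.\<close>

lemma convergent_of_weighted_increments:
  fixes a :: "nat \<Rightarrow> real"
  assumes "(\<Sum>n. ennreal (2 ^ n * (a n - a (Suc n))\<^sup>2)) \<noteq> \<infinity>"
  shows "convergent a"
proof -
  define t where "t = (\<lambda>n. ennreal (2 ^ n * (a n - a (Suc n))\<^sup>2))"
  have "suminf t \<noteq> \<infinity>"
    using assms unfolding t_def .
  then obtain S where S: "S \<ge> 0" "suminf t = ennreal S"
    by (cases "suminf t") auto
  have bound: "norm (a (Suc n) - a n) \<le> sqrt S * (sqrt (1/2)) ^ n" for n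
  proof -
    have "t n \<le> suminf t"
      using sum_le_suminf[of t "{n}"] by simp
    then have "2 ^ n * (a n - a (Suc n))\<^sup>2 \<le> S"
      unfolding S(2) unfolding t_def using S(1) by simp
    then have "(a (Suc n) - a n)\<^sup>2 \<le> S * (1/2) ^ n"
      by (simp add: field_simps power2_commute power_one_over)
    then have "sqrt ((a (Suc n) - a n)\<^sup>2) \<le> sqrt (S * (1/2) ^ n)"
      by (rule real_sqrt_le_mono)
    then show ?thesis
      unfolding real_sqrt_abs by (simp add: real_sqrt_mult real_sqrt_power)
  qed
  have "summable (\<lambda>n. sqrt S * (sqrt (1/2)) ^ n)"
    by (intro summable_mult summable_geometric) (simp add: real_sqrt_divide)
  then have "summable (\<lambda>n. a (Suc n) - a n)"
    by (rule summable_comparison_test') (rule bound)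
  then have "convergent (\<lambda>n. \<Sum>i<n. a (Suc i) - a i)"
    by (simp add: summable_iff_convergent)
  then have "convergent (\<lambda>n. (a n - a 0) + a 0)"
    unfolding sum_lessThan_telescope by (intro convergent_add convergent_const)
  then show ?thesis by simp
qed

text \<open>Completeness of \<open>L\<^sup>2\<close>, for sequences fast enough to converge almost everywhere. The weights \<open>2 ^ n\<close> leave
  a summable series of mean-square increments, which is therefore finite almost everywhere; the
  rate passes to the limit by the Fatou lemma.\<close>

lemma L2_limit_of_fast_Cauchy:
  fixes \<phi> :: "nat \<Rightarrow> 'a \<Rightarrow> real"
  assumes meas[measurable]: "\<And>n. \<phi> n \<in> borel_measurable M" and K: "K \<ge> 0"
    and cauchy: "\<And>n m. n \<le> m \<Longrightarrow> (\<integral>\<^sup>+x. ennreal ((\<phi> n x - \<phi> m x)\<^sup>2) \<partial>M) \<le> ennreal (K * (1/4) ^ n)"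
  obtains f where "f \<in> borel_measurable M"
    "\<And>n. (\<integral>\<^sup>+x. ennreal ((\<phi> n x - f x)\<^sup>2) \<partial>M) \<le> ennreal (K * (1/4) ^ n)"
proof -
  define f where "f x = lim (\<lambda>n. \<phi> n x)" for x
  have f[measurable]: "f \<in> borel_measurable M"
    unfolding f_def by measurable
  have "(\<integral>\<^sup>+x. (\<Sum>n. ennreal (2 ^ n * (\<phi> n x - \<phi> (Suc n) x)\<^sup>2)) \<partial>M)
    = (\<Sum>n. \<integral>\<^sup>+x. ennreal (2 ^ n * (\<phi> n x - \<phi> (Suc n) x)\<^sup>2) \<partial>M)"
    by (rule nn_integral_suminf) measurable
  also have "\<dots> \<le> (\<Sum>n. ennreal (K * (1/2) ^ n))"
  proof (rule suminf_le)
    fix n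
    have "(\<integral>\<^sup>+x. ennreal (2 ^ n * (\<phi> n x - \<phi> (Suc n) x)\<^sup>2) \<partial>M)
      = ennreal (2 ^ n) * (\<integral>\<^sup>+x. ennreal ((\<phi> n x - \<phi> (Suc n) x)\<^sup>2) \<partial>M)"
      by (subst nn_integral_cmult[symmetric]) (auto simp: ennreal_mult)
    also have "\<dots> \<le> ennreal (2 ^ n) * ennreal (K * (1/4) ^ n)"
      by (intro mult_left_mono cauchy) auto
    also have "\<dots> = ennreal (2 ^ n * (K * (1/4) ^ n))"
      using K by (simp add: ennreal_mult)
    also have "(2::real) ^ n * (K * (1/4) ^ n) = K * (2 * (1/4)) ^ n"
      by (simp only: power_mult_distrib mult_ac)
    finally show "(\<integral>\<^sup>+x. ennreal (2 ^ n * (\<phi> n x - \<phi> (Suc n) x)\<^sup>2) \<partial>M) \<le> ennreal (K * (1/2) ^ n)"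
      by simp
  qed auto
  also have "\<dots> = ennreal (\<Sum>n. K * (1/2) ^ n)"
  proof (rule suminf_ennreal2)
    show "summable (\<lambda>n. K * (1/2) ^ n)"
      by (rule summable_mult[OF summable_geometric]) simp
  qed (use K in simp)
  also have "\<dots> < \<infinity>" by simp
  finally have fin: "(\<integral>\<^sup>+x. (\<Sum>n. ennreal (2 ^ n * (\<phi> n x - \<phi> (Suc n) x)\<^sup>2)) \<partial>M) < \<infinity>" .
  have "(\<lambda>x. \<Sum>n. ennreal (2 ^ n * (\<phi> n x - \<phi> (Suc n) x)\<^sup>2)) \<in> borel_measurable M"
    by measurable
  from nn_integral_PInf_AE[OF this less_imp_neq[OF fin]]
  have conv: "AE x in M. (\<lambda>n. \<phi> n x) \<longlonglongrightarrow> f x"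
  proof eventually_elim
    case (elim x)
    have "convergent (\<lambda>n. \<phi> n x)"
      by (rule convergent_of_weighted_increments) (rule elim)
    then show ?case
      by (simp add: f_def convergent_LIMSEQ_iff)
  qed
  have "(\<integral>\<^sup>+x. ennreal ((\<phi> n x - f x)\<^sup>2) \<partial>M) \<le> ennreal (K * (1/4) ^ n)" for n
  proof -
    have "(\<integral>\<^sup>+x. ennreal ((\<phi> n x - f x)\<^sup>2) \<partial>M) = (\<integral>\<^sup>+x. liminf (\<lambda>m. ennreal ((\<phi> n x - \<phi> m x)\<^sup>2)) \<partial>M)"
    proof (rule nn_integral_cong_AE)
      show "AE x in M. ennreal ((\<phi> n x - f x)\<^sup>2) = liminf (\<lambda>m. ennreal ((\<phi> n x - \<phi> m x)\<^sup>2))"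
        using conv
      proof eventually_elim
        case (elim x)
        then have "(\<lambda>m. ennreal ((\<phi> n x - \<phi> m x)\<^sup>2)) \<longlonglongrightarrow> ennreal ((\<phi> n x - f x)\<^sup>2)"
          by (intro tendsto_ennrealI tendsto_intros)
        then show ?case
          by (intro lim_imp_Liminf[symmetric]) simp_all
      qed
    qed
    also have "\<dots> \<le> liminf (\<lambda>m. \<integral>\<^sup>+x. ennreal ((\<phi> n x - \<phi> m x)\<^sup>2) \<partial>M)"
      by (rule nn_integral_liminf) measurable
    also have "\<dots> \<le> liminf (\<lambda>m. ennreal (K * (1/4) ^ n))"
      by (rule Liminf_mono) (use cauchy in \<open>auto simp: eventually_sequentially\<close>)
    also have "\<dots> = ennreal (K * (1/4) ^ n)"
      by (simp add: Liminf_const)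
    finally show ?thesis .
  qed
  with f show thesis by (rule that)
qed

section \<open>Periodic mollification\<close>

lemma AE_lebesgue_shift:
  fixes a :: "'a::euclidean_space"
  assumes "AE x in lebesgue. P x"
  shows "AE x in lebesgue. P (x + a)"
proof -
  obtain N where N: "{x. \<not> P x} \<subseteq> N" "N \<in> null_sets lebesgue"
    using assms by (auto simp: eventually_ae_filter)
  then have "negligible ((+) (- a) ` N)"
    by (intro negligible_translation) (simp add: negligible_iff_null_sets)
  then have "(+) (- a) ` N \<in> null_sets lebesgue"
    by (simp add: negligible_iff_null_sets)
  moreover have "{x \<in> space lebesgue. \<not> P (x + a)} \<subseteq> (+) (- a) ` N"
    using N(1) by (auto intro!: image_eqI[of _ _ "_ + a"])
  ultimately show ?thesis by (rule AE_I')
qed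

context bounded_open
begin

lemma integral_le_of_nn_integral_le:
  assumes F: "F \<in> borel_measurable borel" "\<And>x. F x \<ge> 0" and le: "(\<integral>\<^sup>+x. ennreal (F x) \<partial>lborel) \<le> ennreal e"
    and "e \<ge> 0"
  shows "(\<integral>x. F x \<partial>lebesgue_on \<Omega>) \<le> e"
proof -
  have [measurable]: "F \<in> borel_measurable (lebesgue_on \<Omega>)"
    using F by (intro measurable_restrict_space1 measurable_completion) simp
  have "(\<integral>\<^sup>+x. ennreal (F x) \<partial>lebesgue_on \<Omega>) = (\<integral>\<^sup>+x. ennreal (F x) * indicator \<Omega> x \<partial>lebesgue)"
    by (subst nn_integral_restrict_space) auto
  also have "\<dots> \<le> (\<integral>\<^sup>+x. ennreal (F x) \<partial>lebesgue)"
    by (intro nn_integral_mono) (auto simp: indicator_def)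
  also have "\<dots> \<le> ennreal e"
    using le by (simp add: nn_integral_completion)
  finally have "enn2real (\<integral>\<^sup>+x. ennreal (F x) \<partial>lebesgue_on \<Omega>) \<le> e"
    using \<open>e \<ge> 0\<close> by (rule enn2real_leI[rotated])
  then show ?thesis
    using F(2) by (subst integral_eq_nn_integral) auto
qed

lemma square_integrable_restrict:
  assumes "f \<in> borel_measurable borel" "integrable lborel (\<lambda>x. (f x)\<^sup>2)"
  shows "square_integrable (lebesgue_on \<Omega>) f"
proof -
  have "integrable lebesgue (\<lambda>x. (f x)\<^sup>2)"
    using assms by (subst integrable_completion) auto
  then have "integrable lebesgue (\<lambda>x. indicator \<Omega> x *\<^sub>R (f x)\<^sup>2)"
    by (intro integrable_mult_indicator) auto
  then have "integrable (lebesgue_on \<Omega>) (\<lambda>x. (f x)\<^sup>2)"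
    by (subst integrable_restrict_space) auto
  moreover have "f \<in> borel_measurable (lebesgue_on \<Omega>)"
    using assms by (intro measurable_restrict_space1 measurable_completion) simp
  ultimately show ?thesis by (simp add: square_integrable_def)
qed

end

text \<open>On \<open>\<Omega>\<close>, the derivative of the mollification is the mollification of the weak derivative, provided
  that the weak derivative exists on a set \<open>B\<close> that contains a neighbourhood of \<open>\<Omega>\<close> of uniform width.
  This width is what gives convergence up to the boundary of \<open>\<Omega>\<close>.\<close>

lemma H1_mollification:
  fixes u u' :: "real^'n::finite \<Rightarrow> real"
  assumes \<Omega>: "bounded_open \<Omega>" and B: "bounded_open B" and d: "d > 0" "\<And>x. x \<in> \<Omega> \<Longrightarrow> cball x d \<subseteq> B"
    and u: "H1 B u" "H1 \<Omega> u"
    and u': "u' \<in> borel_measurable borel" "\<And>x. x \<notin> B \<Longrightarrow> u' x = 0"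
      "AE x in lebesgue_on B. u' x = u x" "integrable lborel u'" "integrable lborel (\<lambda>x. (u' x)\<^sup>2)"
    and e: "e > 0"
  shows "\<exists>\<delta>>0. \<forall>\<rho>. mollifier \<delta> \<rho> \<longrightarrow> (H1_norm \<Omega> (\<lambda>x. conv \<rho> u' x - u x))\<^sup>2 \<le> e"
proof -
  interpret \<Omega>: bounded_open \<Omega> by fact
  interpret B: bounded_open B by fact
  have sub: "\<Omega> \<subseteq> B"
  proof
    fix x assume "x \<in> \<Omega>"
    from d(2)[OF this] show "x \<in> B" using d(1) by (simp add: subset_eq)
  qed
  define V where "V i = weak_pderiv B i u" for i
  have V: "square_integrable (lebesgue_on B) (V i)" "is_weak_pderiv B i u (V i)" for i
    using B.weak_pderiv_spec[OF u(1)] by (simp_all add: V_def)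
  have "\<forall>i. \<exists>v. v \<in> borel_measurable borel \<and> (\<forall>x. x \<notin> B \<longrightarrow> v x = 0) \<and>
      (AE x in lebesgue_on B. v x = V i x) \<and> integrable lborel v \<and> integrable lborel (\<lambda>x. (v x)\<^sup>2)"
  proof
    fix i
    from B.borel_extension[OF V(1)[of i]]
    show "\<exists>v. v \<in> borel_measurable borel \<and> (\<forall>x. x \<notin> B \<longrightarrow> v x = 0) \<and>
      (AE x in lebesgue_on B. v x = V i x) \<and> integrable lborel v \<and> integrable lborel (\<lambda>x. (v x)\<^sup>2)"
      by blast
  qed
  then obtain V' where "\<forall>i. V' i \<in> borel_measurable borel \<and> (\<forall>x. x \<notin> B \<longrightarrow> V' i x = 0) \<and>
      (AE x in lebesgue_on B. V' i x = V i x) \<and> integrable lborel (V' i) \<and> integrable lborel (\<lambda>x. (V' i x)\<^sup>2)"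
    by (rule choice[THEN exE])
  then have V': "V' i \<in> borel_measurable borel" "x \<notin> B \<Longrightarrow> V' i x = 0"
      "AE x in lebesgue_on B. V' i x = V i x" "integrable lborel (V' i)" "integrable lborel (\<lambda>x. (V' i x)\<^sup>2)" for i x
    by blast+
  have u_meas: "u \<in> borel_measurable (lebesgue_on B)" and V_meas: "V i \<in> borel_measurable (lebesgue_on B)" for i
    using u(1) V(1) by (simp_all add: H1_def square_integrable_def)
  have weak: "(\<integral>x. pderiv_at i \<phi> x * u' x \<partial>lborel) = - (\<integral>x. \<phi> x * V' i x \<partial>lborel)"
    if \<phi>: "test_function B \<phi>" for \<phi> i
  proof -
    note c = C_1_continuous[OF test_function_C_1[OF \<phi>]]
    show ?thesis
      using V(2)[of i, unfolded is_weak_pderiv_def, rule_format, OF \<phi>]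
        B.integral_extension[OF u'(1,2,3) u_meas c(2)[of i]]
        B.integral_extension[OF V'(1)[of i] V'(2)[of _ i] V'(3)[of i] V_meas c(1)]
      by simp
  qed
  have test_mono: "test_function B \<phi>" if "test_function \<Omega> \<phi>" for \<phi>
    using that sub by (auto simp: test_function_def)
  have "AE x in lebesgue. x \<in> B \<longrightarrow> u' x = u x"
    using u'(3) B.sets\<Omega> by (subst (asm) AE_restrict_space_iff) auto
  then have u'\<Omega>: "AE x in lebesgue_on \<Omega>. u' x = u x"
    using sub by (subst AE_restrict_space_iff) (auto elim!: eventually_mono)
  have sqV': "square_integrable (lebesgue_on \<Omega>) (V' i)" for i
    by (rule \<Omega>.square_integrable_restrict[OF V'(1,5)])
  have u\<Omega>: "u \<in> borel_measurable (lebesgue_on \<Omega>)"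
    using u(2) by (simp add: H1_def square_integrable_def)
  have u'm: "u' \<in> borel_measurable (lebesgue_on \<Omega>)"
    using u'(1) by (intro measurable_restrict_space1 measurable_completion) simp
  have weakV': "is_weak_pderiv \<Omega> i u (V' i)" for i
    unfolding is_weak_pderiv_def
  proof (intro allI impI)
    fix \<phi> assume \<phi>: "test_function \<Omega> \<phi>"
    note c = C_1_continuous[OF test_function_C_1[OF \<phi>]] and out = test_function_outside[OF \<phi>]
    have "(\<integral>x. u x * pderiv_at i \<phi> x \<partial>lebesgue_on \<Omega>) = (\<integral>x. u' x * pderiv_at i \<phi> x \<partial>lebesgue_on \<Omega>)"
      using u'\<Omega> u\<Omega> u'm \<Omega>.measurable_lebesgue_on_continuous[OF c(2)[of i]]
      by (intro integral_cong_AE) (auto elim!: eventually_mono)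
    also have "\<dots> = (\<integral>x. u' x * pderiv_at i \<phi> x \<partial>lborel)"
      using u'(1) out(2) borel_measurable_continuous_onI[OF c(2)[of i]]
      by (intro integral_lebesgue_on_eq_lborel) auto
    also have "\<dots> = - (\<integral>x. V' i x * \<phi> x \<partial>lborel)"
      using weak[OF test_mono[OF \<phi>], of i] by (simp add: mult.commute)
    also have "(\<integral>x. V' i x * \<phi> x \<partial>lborel) = (\<integral>x. V' i x * \<phi> x \<partial>lebesgue_on \<Omega>)"
      using V'(1)[of i] out(1) borel_measurable_continuous_onI[OF c(1)]
      by (intro integral_lebesgue_on_eq_lborel[symmetric]) auto
    finally show "(\<integral>x. u x * pderiv_at i \<phi> x \<partial>lebesgue_on \<Omega>) = - (\<integral>x. V' i x * \<phi> x \<partial>lebesgue_on \<Omega>)" .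
  qed
  define e' where "e' = e / (1 + real CARD('n))"
  have e': "e' > 0" using e by (simp add: e'_def add_pos_nonneg)
  obtain \<delta>0 where \<delta>0: "\<delta>0 > 0" "\<And>\<rho>. mollifier \<delta>0 \<rho> \<Longrightarrow> (\<integral>\<^sup>+x. ennreal ((conv \<rho> u' x - u' x)\<^sup>2) \<partial>lborel) \<le> ennreal e'"
    using L2_convergence_conv[OF u'(4,5) e'] by blast
  have "\<forall>i. \<exists>\<delta>>0. \<forall>\<rho>. mollifier \<delta> \<rho> \<longrightarrow> (\<integral>\<^sup>+x. ennreal ((conv \<rho> (V' i) x - V' i x)\<^sup>2) \<partial>lborel) \<le> ennreal e'"
    by (intro allI L2_convergence_conv V'(4,5) e')
  then obtain \<delta>1 where "\<forall>i. \<delta>1 i > 0 \<and> (\<forall>\<rho>. mollifier (\<delta>1 i) \<rho> \<longrightarrow>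
      (\<integral>\<^sup>+x. ennreal ((conv \<rho> (V' i) x - V' i x)\<^sup>2) \<partial>lborel) \<le> ennreal e')"
    by (rule choice[THEN exE])
  then have \<delta>1: "\<delta>1 i > 0" "mollifier (\<delta>1 i) \<rho> \<Longrightarrow> (\<integral>\<^sup>+x. ennreal ((conv \<rho> (V' i) x - V' i x)\<^sup>2) \<partial>lborel) \<le> ennreal e'" for i \<rho>
    by blast+
  define \<delta> where "\<delta> = min d (min \<delta>0 (Min (range \<delta>1)))"
  have \<delta>: "\<delta> > 0" "\<delta> \<le> d" "\<delta> \<le> \<delta>0" "\<delta> \<le> \<delta>1 i" for i
    using d(1) \<delta>0(1) \<delta>1(1) by (auto simp: \<delta>_def min.coboundedI2)
  have "(H1_norm \<Omega> (\<lambda>x. conv \<rho> u' x - u x))\<^sup>2 \<le> e" if \<rho>: "mollifier \<delta> \<rho>" for \<rho>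
  proof -
    note \<rho>s = mollifier_bounded_support[OF \<rho>]
    have smooth: "smooth \<rho>" using \<rho> by (simp add: mollifier_def)
    have C1: "C_k 1 (conv \<rho> u')"
      by (rule smooth_imp_C_1[OF smooth_conv[OF smooth \<rho>s u'(4)]])
    have conv_meas: "conv \<rho> w \<in> borel_measurable borel" if "integrable lborel w" for w
      by (intro borel_measurable_continuous_onI C_1_continuous(1)[OF smooth_imp_C_1] smooth_conv[OF smooth \<rho>s that])
    have pd: "pderiv_at i (conv \<rho> u') x = conv \<rho> (V' i) x" if x: "x \<in> \<Omega>" for i x
    proof -
      have "cball x \<delta> \<subseteq> B" using d(2)[OF x] \<delta>(2) by auto
      then have t: "test_function B (\<lambda>y. \<rho> (x - y))"
        by (rule test_function_mollifier_shift[OF \<rho>])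
      have "pderiv_at i (\<lambda>y. \<rho> (x - y)) y = - pderiv_at i \<rho> (x - y)" for y
        using smooth_imp_C_1[OF smooth] by (intro pderiv_at_reflect) simp
      then have "conv (pderiv_at i \<rho>) u' x = conv \<rho> (V' i) x"
        using weak[OF t, of i] by (simp add: conv_def)
      then show ?thesis
        using pderiv_at_conv[OF smooth_imp_C_1[OF smooth] \<rho>s u'(4)] by simp
    qed
    have "(H1_norm \<Omega> (\<lambda>x. conv \<rho> u' x - u x))\<^sup>2 = (\<integral>x. (conv \<rho> u' x - u x)\<^sup>2 \<partial>lebesgue_on \<Omega>) +
        (\<Sum>i\<in>UNIV. \<integral>x. (pderiv_at i (conv \<rho> u') x - V' i x)\<^sup>2 \<partial>lebesgue_on \<Omega>)"
      by (rule \<Omega>.H1_norm_square[OF C1 u(2) sqV' weakV'])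
    also have "(\<integral>x. (conv \<rho> u' x - u x)\<^sup>2 \<partial>lebesgue_on \<Omega>) = (\<integral>x. (conv \<rho> u' x - u' x)\<^sup>2 \<partial>lebesgue_on \<Omega>)"
      using u'\<Omega> u\<Omega> u'm \<Omega>.measurable_lebesgue_on_continuous[OF C_1_continuous(1)[OF C1]]
      by (intro integral_cong_AE) (auto elim!: eventually_mono)
    also have "\<dots> \<le> e'"
      using \<delta>0(2)[OF mollifier_mono[OF \<rho> \<delta>(3)]] e' conv_meas[OF u'(4)] u'(1)
      by (intro \<Omega>.integral_le_of_nn_integral_le) auto
    also have "(\<Sum>i\<in>UNIV. \<integral>x. (pderiv_at i (conv \<rho> u') x - V' i x)\<^sup>2 \<partial>lebesgue_on \<Omega>) \<le> (\<Sum>i\<in>(UNIV::'n set). e')"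
    proof (rule sum_mono)
      fix i
      have "(\<integral>x. (pderiv_at i (conv \<rho> u') x - V' i x)\<^sup>2 \<partial>lebesgue_on \<Omega>) = (\<integral>x. (conv \<rho> (V' i) x - V' i x)\<^sup>2 \<partial>lebesgue_on \<Omega>)"
        by (intro Bochner_Integration.integral_cong) (auto simp: space_restrict_space pd)
      also have "\<dots> \<le> e'"
        using \<delta>1(2)[OF mollifier_mono[OF \<rho> \<delta>(4)]] e' conv_meas[OF V'(4)[of i]] V'(1)[of i]
        by (intro \<Omega>.integral_le_of_nn_integral_le) auto
      finally show "(\<integral>x. (pderiv_at i (conv \<rho> u') x - V' i x)\<^sup>2 \<partial>lebesgue_on \<Omega>) \<le> e'" .
    qed
    finally have "(H1_norm \<Omega> (\<lambda>x. conv \<rho> u' x - u x))\<^sup>2 \<le> e' + real CARD('n) * e'"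
      by simp
    also have "\<dots> = (1 + real CARD('n)) * e'"
      by (simp add: distrib_right)
    also have "\<dots> = e"
    proof -
      have "1 + real CARD('n) \<noteq> 0" by linarith
      then show ?thesis
        unfolding e'_def times_divide_eq_right by (rule nonzero_mult_div_cancel_left)
    qed
    finally show ?thesis .
  qed
  with \<delta>(1) show ?thesis by blast
qed

context lattice_cell
begin

lemma lower_face_subset_cell: "lower_face g k \<subseteq> cell g"
  by (auto simp: lower_face_def cell_def)

lemma lower_face_shift_in_cell:
  assumes "x \<in> lower_face g k"
  shows "x + g k \<in> cell g"
proof -
  obtain s where s: "x = (\<Sum>j\<in>UNIV. s j *\<^sub>R g j)" "\<forall>j. s j \<in> {0..1}" "s k = 0"
    using assms unfolding lower_face_def by blast
  then have "x + g k = comb (s(k := 1))"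
    by (simp add: comb_update sum.remove[of UNIV k "\<lambda>j. s j *\<^sub>R g j"])
  moreover have "\<forall>j. (s(k := 1)) j \<in> {0..1}"
    using s(2) by simp
  ultimately show ?thesis
    unfolding cell_def comb_def by blast
qed

lemma H1_interior_cell:
  assumes "H1_loc UNIV u"
  shows "H1 (interior (cell g)) u"
  using assms bounded\<Omega> by (auto simp: H1_loc_def)

text \<open>Only the values of \<open>u\<close> in a ball around the cell enter a mollification of small width on the cell, so
  \<open>u\<close> may be cut off outside that ball; the cut-off function is integrable, and still periodic as
  far as points near opposite faces are concerned.\<close>

lemma ex_periodic_approx:
  assumes per: "periodic (group_closure (range g)) u" and H1: "H1_loc UNIV u" and e: "e > 0"
  shows "\<exists>\<phi>. smooth \<phi> \<and> (\<forall>k x. x \<in> lower_face g k \<longrightarrow> \<phi> (x + g k) = \<phi> x) \<and>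
    (H1_norm (interior (cell g)) (\<lambda>x. \<phi> x - u x))\<^sup>2 \<le> e"
proof -
  obtain R where R: "\<And>x. x \<in> cell g \<Longrightarrow> norm x \<le> R"
    using compact_imp_bounded[OF compact_cell] by (auto simp: bounded_iff)
  \<comment> \<open>Contains the unit neighbourhood of the cell, so that kernels of width at most \<open>1\<close> see \<open>u\<close> only.\<close>
  define B where "B = ball (0 :: real^'n) (R + 2)"
  interpret B: bounded_open B by unfold_locales (simp_all add: B_def)
  have near: "cball x 1 \<subseteq> B" if "x \<in> cell g" for x
  proof
    fix y assume "y \<in> cball x 1"
    then show "y \<in> B"
      using R[OF that] norm_triangle_sub[of y x] by (simp add: B_def dist_norm norm_minus_commute)
  qed
  have uB: "H1 B u"
    using H1 by (simp add: H1_loc_def B_def)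
  then have "square_integrable (lebesgue_on B) u"
    by (simp add: H1_def)
  from B.borel_extension[OF this] obtain u' where u': "u' \<in> borel_measurable borel" "\<And>x. x \<notin> B \<Longrightarrow> u' x = 0"
      "AE x in lebesgue_on B. u' x = u x" "integrable lborel u'" "integrable lborel (\<lambda>x. (u' x)\<^sup>2)"
    by blast
  have "\<exists>\<delta>>0. \<forall>\<rho>. mollifier \<delta> \<rho> \<longrightarrow> (H1_norm (interior (cell g)) (\<lambda>x. conv \<rho> u' x - u x))\<^sup>2 \<le> e"
    by (rule H1_mollification[OF bounded_open_axioms B.bounded_open_axioms zero_less_one _ uB H1_interior_cell[OF H1] u' e])
       (use near interior_subset in blast)
  then obtain \<delta> where \<delta>: "\<delta> > 0"
    "\<And>\<rho>. mollifier \<delta> \<rho> \<Longrightarrow> (H1_norm (interior (cell g)) (\<lambda>x. conv \<rho> u' x - u x))\<^sup>2 \<le> e"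
    by blast
  obtain \<rho> :: "real^'n \<Rightarrow> real" where \<rho>: "mollifier (min \<delta> 1) \<rho>"
    using ex_mollifier[of "min \<delta> 1"] \<delta>(1) by auto
  have u'u: "AE z in lebesgue. z \<in> B \<longrightarrow> u' z = u z"
    using u'(3) by (subst (asm) AE_restrict_space_iff) auto
  have \<rho>_meas: "\<rho> \<in> borel_measurable borel"
    using mollifier_continuous[OF \<rho>] by (rule borel_measurable_continuous_onI)
  have periodic: "conv \<rho> u' (x + g k) = conv \<rho> u' x" if x: "x \<in> lower_face g k" for k x
  proof -
    have "g k \<in> group_closure (range g)"
      by (intro group_closure.base) auto
    then have "AE z in lebesgue. u (z + g k) = u z"
      using per by (simp add: periodic_def)
    with u'u AE_lebesgue_shift[OF u'u, of "g k"]
    have "AE z in lebesgue. \<rho> (x - z) * u' (z + g k) = \<rho> (x - z) * u' z"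
    proof eventually_elim
      case (elim z)
      show ?case
      proof (cases "norm (x - z) < 1")
        case True
        then have "z \<in> B" "z + g k \<in> B"
          using near[of x] near[of "x + g k"] x lower_face_subset_cell lower_face_shift_in_cell
          by (auto simp: subset_eq dist_norm)
        then show ?thesis using elim by simp
      next
        case False
        then show ?thesis using \<rho> by (simp add: mollifier_def)
      qed
    qed
    then have AE: "AE z in lborel. \<rho> (x - z) * u' (z + g k) = \<rho> (x - z) * u' z"
      by (simp add: AE_completion_iff)
    have [measurable]: "\<rho> \<in> borel_measurable borel" "u' \<in> borel_measurable borel" by fact+
    have "conv \<rho> u' (x + g k) = (\<integral>z. \<rho> (x + g k - (z + g k)) * u' (z + g k) \<partial>lborel)"
      unfolding conv_def by (rule integral_shift[symmetric]) measurable
    also have "\<dots> = conv \<rho> u' x"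
      unfolding conv_def by (rule integral_cong_AE) (use AE in \<open>simp_all\<close>)
    finally show ?thesis .
  qed
  show ?thesis
  proof (intro exI conjI allI impI)
    show "smooth (conv \<rho> u')"
      using \<rho> by (intro smooth_conv[OF _ mollifier_bounded_support[OF \<rho>] u'(4)]) (simp add: mollifier_def)
    show "(H1_norm (interior (cell g)) (\<lambda>x. conv \<rho> u' x - u x))\<^sup>2 \<le> e"
      by (rule \<delta>(2)[OF mollifier_mono[OF \<rho>]]) simp
  qed (rule periodic)
qed

lemma ex_periodic_approx_sequence:
  assumes "periodic (group_closure (range g)) u" "H1_loc UNIV u"
  shows "\<exists>\<phi>. \<forall>n. smooth (\<phi> n) \<and> (\<forall>k x. x \<in> lower_face g k \<longrightarrow> \<phi> n (x + g k) = \<phi> n x) \<and>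
      (H1_norm (interior (cell g)) (\<lambda>x. \<phi> n x - u x))\<^sup>2 \<le> (1/4) ^ n"
proof -
  have "\<exists>\<phi>. smooth \<phi> \<and> (\<forall>k x. x \<in> lower_face g k \<longrightarrow> \<phi> (x + g k) = \<phi> x) \<and>
      (H1_norm (interior (cell g)) (\<lambda>x. \<phi> x - u x))\<^sup>2 \<le> (1/4) ^ n" for n :: nat
  proof -
    have "(1/4 :: real) ^ n > 0" by simp
    from ex_periodic_approx[OF assms this] show ?thesis .
  qed
  then have "\<forall>n. \<exists>\<phi>. smooth \<phi> \<and> (\<forall>k x. x \<in> lower_face g k \<longrightarrow> \<phi> (x + g k) = \<phi> x) \<and>
      (H1_norm (interior (cell g)) (\<lambda>x. \<phi> x - u x))\<^sup>2 \<le> (1/4) ^ n"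
    by (rule allI)
  then show ?thesis
    by (rule choice)
qed

section \<open>Traces\<close>

text \<open>The trace inequality for \<open>p - q\<close>, with \<open>u\<close> inserted between \<open>p\<close> and \<open>q\<close>. This controls both the Cauchy
  property of one approximating sequence and the distance between two of them.\<close>

lemma trace_difference_le:
  assumes u: "H1 (interior (cell g)) u"
  obtains C :: real where "C \<ge> 0"
    "\<And>p q. C_k 1 p \<Longrightarrow> C_k 1 q \<Longrightarrow> (\<integral>\<^sup>+x. ennreal ((p x - q x)\<^sup>2) \<partial>boundary_measure g) \<le>
      ennreal (C * ((H1_norm (interior (cell g)) (\<lambda>x. p x - u x))\<^sup>2 + (H1_norm (interior (cell g)) (\<lambda>x. q x - u x))\<^sup>2))"
proof -
  let ?\<Omega> = "interior (cell g)"
  obtain C :: real where C: "C \<ge> 0"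
    "\<And>p. C_k 1 p \<Longrightarrow> (\<integral>\<^sup>+x. ennreal ((p x)\<^sup>2) \<partial>boundary_measure g) \<le>
      ennreal C * (\<integral>\<^sup>+x. ennreal ((p x)\<^sup>2 + (\<Sum>i\<in>UNIV. (pderiv_at i p x)\<^sup>2)) \<partial>lebesgue_on ?\<Omega>)"
    using trace_inequality by blast
  define v where "v i = weak_pderiv ?\<Omega> i u" for i
  have v: "square_integrable (lebesgue_on ?\<Omega>) (v i)" "is_weak_pderiv ?\<Omega> i u (v i)" for i
    using weak_pderiv_spec[OF u] by (simp_all add: v_def)
  have u2: "square_integrable (lebesgue_on ?\<Omega>) u" using u by (simp add: H1_def)
  define E where "E p x = (p x - u x)\<^sup>2 + (\<Sum>i\<in>UNIV. (pderiv_at i p x - v i x)\<^sup>2)" for p x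
  have E0: "E p x \<ge> 0" for p x by (simp add: E_def sum_nonneg)
  have E: "integrable (lebesgue_on ?\<Omega>) (E p)"
    "(\<integral>x. E p x \<partial>lebesgue_on ?\<Omega>) = (H1_norm ?\<Omega> (\<lambda>x. p x - u x))\<^sup>2" if p: "C_k 1 p" for p
  proof -
    have I: "integrable (lebesgue_on ?\<Omega>) (\<lambda>x. (p x - u x)\<^sup>2)"
      using square_integrable_diff[OF square_integrable_continuous[OF C_1_continuous(1)[OF p]] u2]
      by (simp add: square_integrable_def)
    have J: "integrable (lebesgue_on ?\<Omega>) (\<lambda>x. (pderiv_at i p x - v i x)\<^sup>2)" for i
      using square_integrable_diff[OF square_integrable_continuous[OF C_1_continuous(2)[OF p]] v(1)]
      by (simp add: square_integrable_def)
    show "integrable (lebesgue_on ?\<Omega>) (E p)"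
      unfolding E_def by (intro Bochner_Integration.integrable_add Bochner_Integration.integrable_sum I J)
    show "(\<integral>x. E p x \<partial>lebesgue_on ?\<Omega>) = (H1_norm ?\<Omega> (\<lambda>x. p x - u x))\<^sup>2"
      unfolding E_def H1_norm_square[OF p u v] using I J by simp
  qed
  have main: "(\<integral>\<^sup>+x. ennreal ((p x - q x)\<^sup>2) \<partial>boundary_measure g) \<le>
      ennreal (C * 2 * ((H1_norm ?\<Omega> (\<lambda>x. p x - u x))\<^sup>2 + (H1_norm ?\<Omega> (\<lambda>x. q x - u x))\<^sup>2))"
    if p: "C_k 1 p" and q: "C_k 1 q" for p q
  proof -
    have pd: "pderiv_at i (\<lambda>x. p x - q x) x = pderiv_at i p x - pderiv_at i q x" for i x
      using p q by (intro pderiv_at_diff) auto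
    have sq: "(a - b)\<^sup>2 \<le> 2 * ((a - c)\<^sup>2 + (b - c)\<^sup>2)" for a b c :: real
      using square_diff_le[of "a - c" "b - c"] by simp
    have pw: "(p x - q x)\<^sup>2 + (\<Sum>i\<in>UNIV. (pderiv_at i (\<lambda>x. p x - q x) x)\<^sup>2) \<le> 2 * (E p x + E q x)" for x
    proof -
      have "(\<Sum>i\<in>UNIV. (pderiv_at i (\<lambda>x. p x - q x) x)\<^sup>2) \<le>
          (\<Sum>i\<in>UNIV. 2 * ((pderiv_at i p x - v i x)\<^sup>2 + (pderiv_at i q x - v i x)\<^sup>2))"
        unfolding pd by (intro sum_mono sq)
      then show ?thesis
        using sq[of "p x" "q x" "u x"]
        by (simp add: E_def sum.distrib sum_distrib_left[symmetric])
    qed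
    have "(\<integral>\<^sup>+x. ennreal ((p x - q x)\<^sup>2) \<partial>boundary_measure g) \<le>
        ennreal C * (\<integral>\<^sup>+x. ennreal ((p x - q x)\<^sup>2 + (\<Sum>i\<in>UNIV. (pderiv_at i (\<lambda>x. p x - q x) x)\<^sup>2)) \<partial>lebesgue_on ?\<Omega>)"
      by (rule C(2)[OF C_1_diff[OF p q]])
    also have "\<dots> \<le> ennreal C * (\<integral>\<^sup>+x. ennreal (2 * (E p x + E q x)) \<partial>lebesgue_on ?\<Omega>)"
      by (intro mult_left_mono nn_integral_mono ennreal_leI pw) simp
    also have "(\<integral>\<^sup>+x. ennreal (2 * (E p x + E q x)) \<partial>lebesgue_on ?\<Omega>) = ennreal (\<integral>x. 2 * (E p x + E q x) \<partial>lebesgue_on ?\<Omega>)"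
      using E(1)[OF p] E(1)[OF q] E0 by (intro nn_integral_eq_integral) auto
    also have "(\<integral>x. 2 * (E p x + E q x) \<partial>lebesgue_on ?\<Omega>) =
        2 * ((H1_norm ?\<Omega> (\<lambda>x. p x - u x))\<^sup>2 + (H1_norm ?\<Omega> (\<lambda>x. q x - u x))\<^sup>2)"
      using E[OF p] E[OF q] by simp
    also have "ennreal C * ennreal (2 * ((H1_norm ?\<Omega> (\<lambda>x. p x - u x))\<^sup>2 + (H1_norm ?\<Omega> (\<lambda>x. q x - u x))\<^sup>2)) =
        ennreal (C * 2 * ((H1_norm ?\<Omega> (\<lambda>x. p x - u x))\<^sup>2 + (H1_norm ?\<Omega> (\<lambda>x. q x - u x))\<^sup>2))"
      using C(1) by (subst ennreal_mult[symmetric]) (auto simp: mult_ac)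
    finally show ?thesis .
  qed
  show thesis
    by (rule that[of "C * 2"]) (use C(1) main in auto)
qed

lemma square_integrable_boundary:
  assumes p: "C_k 1 p"
  shows "square_integrable (boundary_measure g) p"
proof -
  let ?\<Omega> = "interior (cell g)"
  obtain C :: real where C: "\<And>p. C_k 1 p \<Longrightarrow> (\<integral>\<^sup>+x. ennreal ((p x)\<^sup>2) \<partial>boundary_measure g) \<le>
      ennreal C * (\<integral>\<^sup>+x. ennreal ((p x)\<^sup>2 + (\<Sum>i\<in>UNIV. (pderiv_at i p x)\<^sup>2)) \<partial>lebesgue_on ?\<Omega>)"
    using trace_inequality by blast
  have "integrable (lebesgue_on ?\<Omega>) (\<lambda>x. (p x)\<^sup>2 + (\<Sum>i\<in>UNIV. (pderiv_at i p x)\<^sup>2))"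
    using square_integrable_continuous[OF C_1_continuous(1)[OF p]] square_integrable_continuous[OF C_1_continuous(2)[OF p]]
    by (auto simp: square_integrable_def)
  then have "(\<integral>\<^sup>+x. ennreal ((p x)\<^sup>2 + (\<Sum>i\<in>UNIV. (pderiv_at i p x)\<^sup>2)) \<partial>lebesgue_on ?\<Omega>) < \<infinity>"
    by (subst nn_integral_eq_integral) (auto intro!: add_nonneg_nonneg sum_nonneg)
  then have "(\<integral>\<^sup>+x. ennreal ((p x)\<^sup>2) \<partial>boundary_measure g) < \<infinity>"
    by (intro le_less_trans[OF C[OF p]]) (simp add: ennreal_mult_less_top)
  moreover have "p \<in> borel_measurable (boundary_measure g)"
    using borel_measurable_continuous_onI[OF C_1_continuous(1)[OF p]] by (simp cong: measurable_cong_sets)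
  ultimately show ?thesis
    unfolding square_integrable_def by (auto intro!: integrableI_bounded)
qed

lemma ex_trace:
  assumes per: "periodic (group_closure (range g)) u" and H1: "H1_loc UNIV u"
  shows "\<exists>f. is_trace g u f"
proof -
  let ?M = "boundary_measure g" and ?N = "\<lambda>p. H1_norm (interior (cell g)) (\<lambda>x. p x - u x)"
  have u: "H1 (interior (cell g)) u" by (rule H1_interior_cell[OF H1])
  obtain \<phi> where "\<forall>n. smooth (\<phi> n) \<and> (\<forall>k x. x \<in> lower_face g k \<longrightarrow> \<phi> n (x + g k) = \<phi> n x) \<and>
      (?N (\<phi> n))\<^sup>2 \<le> (1/4) ^ n"
    using ex_periodic_approx_sequence[OF per H1] by (rule exE)
  then have \<phi>: "smooth (\<phi> n)" "x \<in> lower_face g k \<Longrightarrow> \<phi> n (x + g k) = \<phi> n x"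
    "(?N (\<phi> n))\<^sup>2 \<le> (1/4) ^ n" for n k x
    by blast+
  have C1: "C_k 1 (\<phi> n)" for n by (rule smooth_imp_C_1[OF \<phi>(1)])
  have sqi: "square_integrable ?M (\<phi> n)" for n
    by (rule square_integrable_boundary[OF C1])
  then have \<phi>_meas: "\<phi> n \<in> borel_measurable ?M" for n
    by (simp add: square_integrable_def)
  obtain C where C: "C \<ge> 0"
    "\<And>p q. C_k 1 p \<Longrightarrow> C_k 1 q \<Longrightarrow> (\<integral>\<^sup>+x. ennreal ((p x - q x)\<^sup>2) \<partial>?M) \<le> ennreal (C * ((?N p)\<^sup>2 + (?N q)\<^sup>2))"
    using trace_difference_le[OF u] by blast
  have "(\<integral>\<^sup>+x. ennreal ((\<phi> n x - \<phi> m x)\<^sup>2) \<partial>?M) \<le> ennreal (2 * C * (1/4) ^ n)" if "n \<le> m" for n m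
  proof -
    have "(1/4 :: real) ^ m \<le> (1/4) ^ n"
      using that by (intro power_decreasing) auto
    then have "(?N (\<phi> n))\<^sup>2 + (?N (\<phi> m))\<^sup>2 \<le> 2 * (1/4) ^ n"
      using \<phi>(3)[of n] \<phi>(3)[of m] by linarith
    then have "C * ((?N (\<phi> n))\<^sup>2 + (?N (\<phi> m))\<^sup>2) \<le> C * (2 * (1/4) ^ n)"
      using C(1) by (rule mult_left_mono)
    then have "ennreal (C * ((?N (\<phi> n))\<^sup>2 + (?N (\<phi> m))\<^sup>2)) \<le> ennreal (2 * C * (1/4) ^ n)"
      by (intro ennreal_leI) (simp only: mult.assoc mult.left_commute)
    with C(2)[OF C1 C1] show ?thesis
      by (rule order_trans)
  qed
  from L2_limit_of_fast_Cauchy[OF \<phi>_meas _ this] C(1) obtain f where f: "f \<in> borel_measurable ?M"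
    "\<And>n. (\<integral>\<^sup>+x. ennreal ((\<phi> n x - f x)\<^sup>2) \<partial>?M) \<le> ennreal (2 * C * (1/4) ^ n)"
    by auto
  have I: "integrable ?M (\<lambda>x. (\<phi> n x - f x)\<^sup>2)" for n
    using f(1) \<phi>_meas le_less_trans[OF f(2) ennreal_less_top] by (intro integrableI_bounded) auto
  have sqd: "square_integrable ?M (\<lambda>x. \<phi> n x - f x)" for n
    using I f(1) \<phi>_meas by (simp add: square_integrable_def)
  have geo: "(\<lambda>n. c * (1/4) ^ n) \<longlonglongrightarrow> 0" for c :: real
    using tendsto_mult[OF tendsto_const LIMSEQ_realpow_zero[of "1/4"], of c] by simp
  \<comment> \<open>The limit inherits square integrability from any member of the sequence.\<close>
  have "square_integrable ?M (\<lambda>x. \<phi> 0 x - (\<phi> 0 x - f x))"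
    by (rule square_integrable_diff[OF sqi sqd])
  then have "square_integrable ?M f" by simp
  moreover have "(\<lambda>n. ?N (\<phi> n)) \<longlonglongrightarrow> 0"
  proof -
    have "(\<lambda>n. (?N (\<phi> n))\<^sup>2) \<longlonglongrightarrow> 0"
      by (rule tendsto_sandwich[OF _ _ tendsto_const geo[of 1]]) (use \<phi>(3) in auto)
    then show ?thesis by simp
  qed
  moreover have "(\<lambda>n. \<integral>x. (\<phi> n x - f x)\<^sup>2 \<partial>?M) \<longlonglongrightarrow> 0"
  proof (rule tendsto_sandwich[OF _ _ tendsto_const geo[of "2 * C"]])
    have "(\<integral>x. (\<phi> n x - f x)\<^sup>2 \<partial>?M) \<le> 2 * C * (1/4) ^ n" for n
      using f(2)[of n] C(1) by (subst (asm) nn_integral_eq_integral[OF I]) auto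
    then show "\<forall>\<^sub>F n in sequentially. (\<integral>x. (\<phi> n x - f x)\<^sup>2 \<partial>?M) \<le> 2 * C * (1/4) ^ n"
      by simp
  qed simp
  ultimately show ?thesis
    unfolding is_trace_def using u \<phi>(1) by blast
qed

lemma closed_lower_face: "closed (lower_face g k)"
proof -
  have "lower_face g k = cell_map ` (cbox 0 1 \<inter> {x. x $ k = 0})"
  proof (intro equalityI subsetI)
    fix x assume "x \<in> lower_face g k"
    then obtain s where s: "x = comb s" "\<forall>j. s j \<in> {0..1}" "s k = 0"
      unfolding lower_face_def comb_def by blast
    then show "x \<in> cell_map ` (cbox 0 1 \<inter> {x. x $ k = 0})"
      by (intro image_eqI[of _ _ "vec_lambda s"]) (auto simp: cell_map_vec_lambda mem_box_cart)
  next
    fix y assume "y \<in> cell_map ` (cbox 0 1 \<inter> {x. x $ k = 0})"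
    then obtain x where "x \<in> cbox 0 1" "x $ k = 0" "y = cell_map x" by blast
    then show "y \<in> lower_face g k"
      unfolding lower_face_def cell_map_def comb_def by (auto simp: mem_box_cart intro!: exI[of _ "($) x"])
  qed
  moreover have "compact (cbox 0 1 \<inter> {x :: real^'n. x $ k = 0})"
    by (intro compact_Int_closed compact_cbox closed_Collect_eq continuous_intros)
  moreover have "continuous_on A cell_map" for A
    using linear_cell_map by (intro linear_continuous_on) (simp add: linear_conv_bounded_linear)
  ultimately show ?thesis
    by (simp add: compact_continuous_image compact_imp_closed)
qed

text \<open>The surface measure of the upper face is the translate of that of the lower face, so a property
  that holds almost everywhere on the boundary holds at almost all pairs of opposite points.\<close>

lemma AE_lower_face_shift:
  assumes "AE x in boundary_measure g. P x"
  shows "AE x in boundary_measure g. x \<in> lower_face g k \<longrightarrow> P x \<and> P (x + g k)"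
proof -
  have space: "space (boundary_measure g) = UNIV"
    using sets_eq_imp_space_eq[OF sets_boundary_measure[of g]] by simp
  obtain N where N: "N \<in> null_sets (boundary_measure g)" "{x. \<not> P x} \<subseteq> N"
    using assms unfolding eventually_ae_filter space by auto
  have N_sets: "N \<in> sets borel" using null_setsD2[OF N(1)] by simp
  have N_shift: "(\<lambda>x. x + g k) -` N \<in> sets borel"
    using measurable_sets_borel[of "\<lambda>x. x + g k" borel N] N_sets by simp
  have face_N: "emeasure (face_measure g j 0) N = 0 \<and> emeasure (face_measure g j (g j)) N = 0" for j
  proof -
    have "(\<Sum>j\<in>UNIV. emeasure (face_measure g j 0) N + emeasure (face_measure g j (g j)) N) = 0"
      using null_setsD1[OF N(1)] emeasure_boundary_measure[OF N_sets, of g] by simp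
    then have "\<forall>j\<in>UNIV. emeasure (face_measure g j 0) N + emeasure (face_measure g j (g j)) N = 0"
      by (subst (asm) sum_eq_0_iff) simp_all
    then show ?thesis by simp
  qed
  define Z where "Z = lower_face g k \<inter> (N \<union> (\<lambda>x. x + g k) -` N)"
  have Z: "Z \<in> sets borel"
    unfolding Z_def using closed_lower_face N_sets N_shift by (intro sets.Int sets.Un) auto
  have "emeasure (face_measure g k 0) Z \<le> emeasure (face_measure g k 0) (N \<union> (\<lambda>x. x + g k) -` N)"
    using N_sets N_shift by (intro emeasure_mono) (auto simp: Z_def)
  also have "\<dots> \<le> emeasure (face_measure g k 0) N + emeasure (face_measure g k 0) ((\<lambda>x. x + g k) -` N)"
    using N_sets N_shift by (intro emeasure_subadditive) auto
  also have "\<dots> = 0"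
    using face_N emeasure_face_measure_upper[OF N_sets, of k] by simp
  finally have "emeasure (face_measure g k 0) Z = 0" by simp
  moreover have "emeasure (face_measure g j a) Z = 0" if "j \<noteq> k \<and> (a = 0 \<or> a = g j) \<or> j = k \<and> a = g k" for j a
    by (rule emeasure_face_measure_lower_face[OF Z _ that]) (simp add: Z_def)
  ultimately have "emeasure (face_measure g j 0) Z = 0 \<and> emeasure (face_measure g j (g j)) Z = 0" for j
    by (cases "j = k") simp_all
  then have "Z \<in> null_sets (boundary_measure g)"
    using Z by (simp add: null_sets_def emeasure_boundary_measure)
  then have "AE x in boundary_measure g. x \<notin> Z" by (rule AE_not_in)
  then show ?thesis
    by (rule eventually_mono) (use N(2) in \<open>auto simp: Z_def\<close>)
qed

text \<open>The sequence \<open>\<psi>\<close> that comes with the trace \<open>f\<close> need not be periodic, but on the boundary it has the same limit as the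
  sequence \<open>\<phi>\<close> of mollifications, which agree at opposite points. A subsequence of \<open>\<phi>\<close> then converges to \<open>f\<close> at almost all points of the boundary, in
  particular at almost all pairs of opposite points.\<close>

lemma trace_periodic:
  assumes per: "periodic (group_closure (range g)) u" and H1: "H1_loc UNIV u" and tr: "is_trace g u f"
  shows "AE x in boundary_measure g. x \<in> lower_face g k \<longrightarrow> f (x + g k) = f x"
proof -
  let ?M = "boundary_measure g" and ?N = "\<lambda>p. H1_norm (interior (cell g)) (\<lambda>x. p x - u x)"
  obtain \<psi> where u: "H1 (interior (cell g)) u" and f: "square_integrable ?M f"
    and \<psi>: "\<And>n. smooth (\<psi> n)" "(\<lambda>n. ?N (\<psi> n)) \<longlonglongrightarrow> 0" "(\<lambda>n. \<integral>x. (\<psi> n x - f x)\<^sup>2 \<partial>?M) \<longlonglongrightarrow> 0"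
    using tr unfolding is_trace_def by blast
  obtain \<phi> where "\<forall>n. smooth (\<phi> n) \<and> (\<forall>k x. x \<in> lower_face g k \<longrightarrow> \<phi> n (x + g k) = \<phi> n x) \<and>
      (?N (\<phi> n))\<^sup>2 \<le> (1/4) ^ n"
    using ex_periodic_approx_sequence[OF per H1] by (rule exE)
  then have \<phi>: "smooth (\<phi> n)" "x \<in> lower_face g k \<Longrightarrow> \<phi> n (x + g k) = \<phi> n x"
    "(?N (\<phi> n))\<^sup>2 \<le> (1/4) ^ n" for n k x
    by blast+
  have sq\<phi>: "square_integrable ?M (\<phi> n)" for n
    by (rule square_integrable_boundary[OF smooth_imp_C_1[OF \<phi>(1)]])
  have sq\<psi>: "square_integrable ?M (\<psi> n)" for n
    by (rule square_integrable_boundary[OF smooth_imp_C_1[OF \<psi>(1)]])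
  obtain C where C: "C \<ge> 0"
    "\<And>p q. C_k 1 p \<Longrightarrow> C_k 1 q \<Longrightarrow> (\<integral>\<^sup>+x. ennreal ((p x - q x)\<^sup>2) \<partial>?M) \<le> ennreal (C * ((?N p)\<^sup>2 + (?N q)\<^sup>2))"
    using trace_difference_le[OF u] by blast
  have I: "integrable ?M (\<lambda>x. (h x - k x)\<^sup>2)" if "square_integrable ?M h" "square_integrable ?M k" for h k
    using square_integrable_diff[OF that] by (simp add: square_integrable_def)
  have le: "(\<integral>x. (\<phi> n x - f x)\<^sup>2 \<partial>?M) \<le> 2 * (C * ((1/4) ^ n + (?N (\<psi> n))\<^sup>2)) + 2 * (\<integral>x. (\<psi> n x - f x)\<^sup>2 \<partial>?M)" for n
  proof -
    have "(\<integral>x. (\<phi> n x - f x)\<^sup>2 \<partial>?M) \<le> (\<integral>x. 2 * (\<phi> n x - \<psi> n x)\<^sup>2 + 2 * (\<psi> n x - f x)\<^sup>2 \<partial>?M)"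
    proof (rule integral_mono)
      show "(\<phi> n x - f x)\<^sup>2 \<le> 2 * (\<phi> n x - \<psi> n x)\<^sup>2 + 2 * (\<psi> n x - f x)\<^sup>2" for x
        using square_diff_le[of "\<phi> n x - \<psi> n x" "f x - \<psi> n x"] by (simp add: power2_commute)
    qed (use I sq\<phi> sq\<psi> f in auto)
    also have "\<dots> = 2 * (\<integral>x. (\<phi> n x - \<psi> n x)\<^sup>2 \<partial>?M) + 2 * (\<integral>x. (\<psi> n x - f x)\<^sup>2 \<partial>?M)"
      using I sq\<phi> sq\<psi> f by simp
    also have "(\<integral>x. (\<phi> n x - \<psi> n x)\<^sup>2 \<partial>?M) \<le> C * ((?N (\<phi> n))\<^sup>2 + (?N (\<psi> n))\<^sup>2)"
      using C(2)[OF smooth_imp_C_1[OF \<phi>(1)] smooth_imp_C_1[OF \<psi>(1)], of n n] C(1)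
      by (subst (asm) nn_integral_eq_integral[OF I[OF sq\<phi> sq\<psi>]]) auto
    also have "\<dots> \<le> C * ((1/4) ^ n + (?N (\<psi> n))\<^sup>2)"
      using C(1) \<phi>(3)[of n] by (intro mult_left_mono) auto
    finally show ?thesis by simp
  qed
  have "(\<lambda>n. 2 * (C * ((1/4) ^ n + (?N (\<psi> n))\<^sup>2)) + 2 * (\<integral>x. (\<psi> n x - f x)\<^sup>2 \<partial>?M)) \<longlonglongrightarrow> 2 * (C * (0 + 0\<^sup>2)) + 2 * 0"
    by (intro tendsto_intros \<psi> LIMSEQ_realpow_zero) auto
  then have lim: "(\<lambda>n. 2 * (C * ((1/4) ^ n + (?N (\<psi> n))\<^sup>2)) + 2 * (\<integral>x. (\<psi> n x - f x)\<^sup>2 \<partial>?M)) \<longlonglongrightarrow> 0"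
    by simp
  have "(\<lambda>n. \<integral>x. (\<phi> n x - f x)\<^sup>2 \<partial>?M) \<longlonglongrightarrow> 0"
    by (rule tendsto_sandwich[OF always_eventually always_eventually tendsto_const lim]) (use le in simp_all)
  then obtain r where r: "AE x in ?M. (\<lambda>n. (\<phi> (r n) x - f x)\<^sup>2) \<longlonglongrightarrow> 0"
    using tendsto_L1_AE_subseq[of ?M "\<lambda>n x. (\<phi> n x - f x)\<^sup>2"] I[OF sq\<phi> f] by auto
  have "AE x in ?M. x \<in> lower_face g k \<longrightarrow>
      (\<lambda>n. (\<phi> (r n) x - f x)\<^sup>2) \<longlonglongrightarrow> 0 \<and> (\<lambda>n. (\<phi> (r n) (x + g k) - f (x + g k))\<^sup>2) \<longlonglongrightarrow> 0"
    by (rule AE_lower_face_shift[OF r])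
  then show ?thesis
  proof (rule eventually_mono, intro impI)
    fix x
    assume "x \<in> lower_face g k \<longrightarrow>
      (\<lambda>n. (\<phi> (r n) x - f x)\<^sup>2) \<longlonglongrightarrow> 0 \<and> (\<lambda>n. (\<phi> (r n) (x + g k) - f (x + g k))\<^sup>2) \<longlonglongrightarrow> 0"
      and x: "x \<in> lower_face g k"
    then have "(\<lambda>n. \<phi> (r n) x - f x) \<longlonglongrightarrow> 0" "(\<lambda>n. \<phi> (r n) (x + g k) - f (x + g k)) \<longlonglongrightarrow> 0"
      by simp_all
    then have "(\<lambda>n. \<phi> (r n) x) \<longlonglongrightarrow> f x" "(\<lambda>n. \<phi> (r n) x) \<longlonglongrightarrow> f (x + g k)"
      by (simp_all add: LIM_zero_iff \<phi>(2)[OF x])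
    then show "f (x + g k) = f x"
      by (rule LIMSEQ_unique[symmetric])
  qed
qed

end

theorem lemma12:
  fixes g :: "'n::finite \<Rightarrow> real^'n" and u :: "real^'n \<Rightarrow> real"
  assumes "CARD('n) \<ge> 2"
    and "inj g" and "independent (range g)"
    and "periodic (group_closure (range g)) u"
    and "H1_loc UNIV u"
  shows "\<forall>k. AE x in boundary_measure g. x \<in> lower_face g k \<longrightarrow> tr g u (x + g k) = tr g u x"
proof -
  interpret lattice_cell g
    by unfold_locales fact+
  have "is_trace g u (tr g u)"
    unfolding tr_def using ex_trace[OF assms(4,5)] by (rule someI_ex)
  then show ?thesis
    using trace_periodic[OF assms(4,5)] by blast
qed

end
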